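(* Let $f:\mathbf R\to\mathbf R$ be Lipschitz continuous and let $X=F(\xi,Y)$, $Y_0=f(\mathbf E[X\mid Y])$, $Y_{1/K}=f\big(\frac1K\sum_{k=1}^KF(\xi_k,Y)\big)$ be as in the nested Monte Carlo setting. If $X\in L^p(\mathbf P)$ for some $p\ge2$, then there exists a constant $V_1^{(p)}$ such that, for all $h=\frac1K$ and $h'=\frac1{K'}$ with $K,K'\in K_0\mathbf N^*$, $$\|Y_{h'}-Y_h\|_p^p\le V_1^{(p)}\,|h'-h|^{\frac p2}.$$ As a consequence, $(SE_\beta)$ and the $L^p$-strong error assumption (existence of a constant $V$ with $\|Y_h-Y_0\|_p^p\le V h^{\frac\beta2p}$ for all $h\in\mathcal H$) are satisfied with $\beta=1$. Then (under the weak error expansion $(WE_{\alpha,\bar R})$ for all $\bar R\ge1$) both the ML2R and MLMC estimators satisfy the Strong Law of Large Numbers: for every sequence of positive reals $(\varepsilon_k)_{k\ge1}$ with $\sum_{k\ge1}\varepsilon_k^p<+\infty$, $I_\pi^N(\varepsilon_k)\to I_0=\mathbf E[Y_0]$ almost surely as $k\to+\infty$.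
   Context: Nested Monte Carlo setting. $(X,Y)$ is a couple of $\mathbf R\times\mathbf R^{q_Y}$-valued random variables on $(\Omega,\mathcal A,\mathbf P)$ with $X\in L^2(\mathbf P)$, and $X=F(\xi,Y)$ with $F:\mathbf R^{q_\xi}\times\mathbf R^{q_Y}\to\mathbf R$ Borel and $\xi$ an $\mathbf R^{q_\xi}$-valued random variable independent of $Y$. $K_0\ge1$ is an integer, $\mathbf N^*=\{1,2,\dots\}$, $\mathbf h=1/K_0$, $\mathcal H=\{\mathbf h/n:n\ge1\}=\{1/K:K\in K_0\mathbf N^*\}$. $(\xi_k)_{k\ge1}$ is an i.i.d. sequence with $\xi_k\sim\xi$, independent of $Y$. $Y_0:=f(\mathbf E[X\mid Y])$ and, for $h=1/K\in\mathcal H$, $Y_h:=f\big(\frac1K\sum_{k=1}^KF(\xi_k,Y)\big)$. Multilevel setting. For the estimators, $\mathrm{Var}(Y_0)>0$. $M\ge2$ is a fixed integer and $n_j=M^{j-1}$, $j\ge1$. $\lceil x\rceil$ is the unique positive integer $n$ with $n-1<x\le n$ (for $x>0$). Weak error $(WE_{\alpha,\bar R})$ (with $\alpha>0$ and real coefficients $c_k$): $\mathbf E[Y_h]-\mathbf E[Y_0]=\sum_{k=1}^{\bar R}c_kh^{\alpha k}+h^{\alpha\bar R}\eta_{\bar R}(h)$ with $\lim_{h\to0}\eta_{\bar R}(h)=0$. Strong error $(SE_\beta)$: there is a constant $V_1$ with $\mathbf E[|Y_h-Y_0|^2]\le V_1h^\beta$ for all $h\in\mathcal H$; a constant $V_1>0$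 for which it holds is fixed. Below $\beta=1$. Standing assumptions for the estimators: $2\alpha\ge\beta$; for MLMC, $c_1\ne0$; for ML2R, $\widetilde c_\infty:=\lim_{R\to\infty}|c_R|^{1/R}$ exists in $(0,+\infty)$. Estimators. Let $Y^{(j)}=(Y^{(j)}_h)_{h\in\mathcal H\cup\{0\}}$, $j\ge1$, be independent copies of the family $(Y_h)_{h\in\mathcal H\cup\{0\}}$ and let $(Y^{(j),k})_{k\ge1}$, $j\ge1$, be independent sequences of independent copies of $Y^{(j)}$ (not depending on $\varepsilon$). For $h\in\mathcal H$, $R\ge2$, $q=(q_1,\dots,q_R)\in(0,1)^R$ with $\sum_jq_j=1$, and $N>0$, put $h_j=h/n_j$, $N_j=\lceil Nq_j\rceil$, $\pi=(h,R,q)$ and $$I_\pi^N=\frac1{N_1}\sum_{k=1}^{N_1}Y_h^{(1),k}+\sum_{j=2}^R\frac{W_j^R}{N_j}\sum_{k=1}^{N_j}\big(Y_{h_j}^{(j),k}-Y_{h_{j-1}}^{(j),k}\big),$$ with $W_j^R=1$ for MLMC and $W_j^R=\mathbf W_j^R$ for ML2R, where $\mathbf W_j^R=\sum_{r=j}^R\mathbf w_r$ and $(\mathbf w_1,\dots,\mathbf w_R)$ is the solution of the Vandermonde system $\sum_{r=1}^R\mathbf w_r=1$, $\sum_{r=1}^R\mathbf w_r n_r^{-\alpha i}=0$ for $i=1,\dots,R-1$. Parameters as functions of $\varepsilon>0$ (small enough that $R(\varepsilon)\ge2$). Put $\theta=\sqrt{V_1/\mathrm{Var}(Y_0)}$,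 $\underline C_{M,\beta}=\frac{1+M^{\beta/2}}{\sqrt{1+M^{-1}}}$, $\bar C_{M,\beta}=(1+M^{\beta/2})\sqrt{1+M^{-1}}$. ML2R: $R(\varepsilon)=\Big\lceil \kappa+\sqrt{\kappa^2+\frac{2\log(\sqrt{1+4\alpha}/\varepsilon)}{\alpha\log M}}\Big\rceil$ with $\kappa=\frac12+\frac{\log(\widetilde c_\infty^{1/\alpha}\mathbf h)}{\log M}$; $h(\varepsilon)=\mathbf h/\big\lceil\mathbf h(1+2\alpha R)^{\frac1{2\alpha R}}\widetilde c_\infty^{1/\alpha}\varepsilon^{-\frac1{\alpha R}}M^{-\frac{R-1}2}\big\rceil$. MLMC: $R(\varepsilon)=\Big\lceil1+\frac{\log(|c_1|^{1/\alpha}\mathbf h)}{\log M}+\frac{\log(\sqrt{1+2\alpha}/\varepsilon)}{\alpha\log M}\Big\rceil$; $h(\varepsilon)=\mathbf h/\big\lceil\mathbf h(1+2\alpha)^{\frac1{2\alpha}}|c_1|^{1/\alpha}\varepsilon^{-\frac1\alpha}M^{-(R-1)}\big\rceil$. For both, with $R=R(\varepsilon)$, $h=h(\varepsilon)$: $q_1=\mu^*(1+\theta h^{\beta/2})$, $q_j=\mu^*\theta h^{\beta/2}\underline C_{M,\beta}|W_j^R|M^{-\frac{1+\beta}2(j-1)}$ for $2\le j\le R$, with $\mu^*=\mu^*(\varepsilon)$ such that $\sum_{j=1}^Rq_j=1$; and $$N(\varepsilon)=\rho\,\frac{\mathrm{Var}(Y_0)\Big(1+\theta h^{\beta/2}+\theta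 h^{\beta/2}\bar C_{M,\beta}\sum_{j=2}^R|W_j^R|M^{\frac{1-\beta}2(j-1)}\Big)}{\varepsilon^2\mu^*},$$ where $\rho=1+\frac1{2\alpha R}$ for ML2R and $\rho=1+\frac1{2\alpha}$ for MLMC. Finally $I_\pi^N(\varepsilon):=I_{\pi(\varepsilon)}^{N(\varepsilon)}$ with $\pi(\varepsilon)=(h(\varepsilon),R(\varepsilon),q(\varepsilon))$. *)

theory Defs
  imports "HOL-Probability.Probability"
begin

definition in_Lp :: "'a measure \<Rightarrow> real \<Rightarrow> ('a \<Rightarrow> real) \<Rightarrow> bool" where
  "in_Lp P p Z \<longleftrightarrow> Z \<in> borel_measurable P \<and> integrable P (\<lambda>\<omega>. \<bar>Z \<omega>\<bar> powr p)"

text \<open>The \<open>p\<close>-th power of the \<open>L\<^sup>p\<close>-norm. The value is extended: it is infinite (rather than 0,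
  as the Bochner integral would be) outside \<open>L\<^sup>p\<close>, so an upper bound on it carries integrability.\<close>

definition Lp_norm_pow :: "'a measure \<Rightarrow> real \<Rightarrow> ('a \<Rightarrow> real) \<Rightarrow> ennreal" where
  "Lp_norm_pow P p Z = (\<integral>\<^sup>+\<omega>. ennreal (\<bar>Z \<omega>\<bar> powr p) \<partial>P)"

definition levels :: "nat \<Rightarrow> real set" where
  "levels K\<^sub>0 = {1 / real (K\<^sub>0 * n) | n. n \<ge> 1}"

definition cond_exp_given ::
  "'a measure \<Rightarrow> ('a \<Rightarrow> real) \<Rightarrow> ('a \<Rightarrow> 'b::topological_space) \<Rightarrow> 'a \<Rightarrow> real" where
  "cond_exp_given P X Y = real_cond_exp P (vimage_algebra (space P) Y borel) X"

text \<open>The family indexed by the bias parameter: index \<open>0\<close> is the target variable, and a nonzero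
  index \<open>h = 1/K\<close> is the approximation with \<open>K\<close> inner samples, \<open>K\<close> being read off as
  \<open>\<lfloor>1/h\<rfloor>\<close>. Only the indices \<open>0\<close> and \<open>1/K\<close> are meaningful.\<close>

definition nested ::
  "'a measure \<Rightarrow> (real \<Rightarrow> real) \<Rightarrow> ('c \<times> 'b::topological_space \<Rightarrow> real) \<Rightarrow> ('a \<Rightarrow> real) \<Rightarrow> ('a \<Rightarrow> 'b)
    \<Rightarrow> (nat \<Rightarrow> 'a \<Rightarrow> 'c) \<Rightarrow> real \<Rightarrow> 'a \<Rightarrow> real" where
  "nested P f F X Y \<xi>s h \<omega> =
    (if h = 0 then f (cond_exp_given P X Y \<omega>)
     else let K = nat \<lfloor>1 / h\<rfloor> in f (1 / real K * (\<Sum>k=1..K. F (\<xi>s k \<omega>, Y \<omega>))))"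

lemma nested_zero: "nested P f F X Y \<xi>s 0 \<omega> = f (cond_exp_given P X Y \<omega>)"
  by (simp add: nested_def)

lemma nested_inverse:
  assumes "K \<ge> 1"
  shows "nested P f F X Y \<xi>s (1 / real K) \<omega> = f (1 / real K * (\<Sum>k=1..K. F (\<xi>s k \<omega>, Y \<omega>)))"
  using assms by (simp add: nested_def)

text \<open>Independence of two random variables whose value types may differ (the library's
  \<open>indep_var\<close> forces both to have the same value type): independence of the generated
  \<open>\<sigma>\<close>-algebras.\<close>

definition indep_rv ::
  "'a measure \<Rightarrow> 'b measure \<Rightarrow> ('a \<Rightarrow> 'b) \<Rightarrow> 'c measure \<Rightarrow> ('a \<Rightarrow> 'c) \<Rightarrow> bool" where
  "indep_rv P S U T V \<longleftrightarrow> U \<in> measurable P S \<and> V \<in> measurable P T \<and>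
     prob_space.indep_set P (sets (vimage_algebra (space P) U S)) (sets (vimage_algebra (space P) V T))"

lemma indep_rv_iff_indep_var:
  assumes "prob_space P"
  shows "indep_rv P S U T V \<longleftrightarrow> prob_space.indep_var P S U T V"
  by (simp add: indep_rv_def prob_space.indep_var_eq[OF assms] sets_vimage_algebra)

text \<open>The whole sequence \<open>(\<xi>s k)\<^sub>k\<close> (not merely each term) is independent of \<open>Y\<close>.\<close>

definition inner_samples ::
  "'a measure \<Rightarrow> ('a \<Rightarrow> 'c::topological_space) \<Rightarrow> ('a \<Rightarrow> 'b::topological_space)
    \<Rightarrow> (nat \<Rightarrow> 'a \<Rightarrow> 'c) \<Rightarrow> bool" where
  "inner_samples P \<xi> Y \<xi>s \<longleftrightarrow>
    prob_space.indep_vars P (\<lambda>_. borel) \<xi>s {1..} \<and>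
    (\<forall>k\<ge>1. distr P borel (\<xi>s k) = distr P borel \<xi>) \<and>
    indep_rv P borel Y (\<Pi>\<^sub>M k\<in>{1..}. borel) (\<lambda>\<omega>. \<lambda>k\<in>{1..}. \<xi>s k \<omega>)"

definition weak_error ::
  "'a measure \<Rightarrow> real set \<Rightarrow> (real \<Rightarrow> 'a \<Rightarrow> real) \<Rightarrow> real \<Rightarrow> (nat \<Rightarrow> real) \<Rightarrow> nat \<Rightarrow> bool" where
  "weak_error P H Z \<alpha> c R \<longleftrightarrow>
    (\<exists>\<eta>. (\<forall>h\<in>H. (\<integral>\<omega>. Z h \<omega> \<partial>P) - (\<integral>\<omega>. Z 0 \<omega> \<partial>P)
              = (\<Sum>k=1..R. c k * h powr (\<alpha> * real k)) + h powr (\<alpha> * real R) * \<eta> h)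
       \<and> (\<eta> \<longlongrightarrow> 0) (at 0 within H))"

definition strong_error ::
  "'a measure \<Rightarrow> real set \<Rightarrow> (real \<Rightarrow> 'a \<Rightarrow> real) \<Rightarrow> real \<Rightarrow> real \<Rightarrow> bool" where
  "strong_error P H Z \<beta> V\<^sub>1 \<longleftrightarrow>
    (\<forall>h\<in>H. (\<integral>\<^sup>+\<omega>. ennreal (\<bar>Z h \<omega> - Z 0 \<omega>\<bar>\<^sup>2) \<partial>P) \<le> ennreal (V\<^sub>1 * h powr \<beta>))"

definition Lp_strong_error ::
  "'a measure \<Rightarrow> real set \<Rightarrow> (real \<Rightarrow> 'a \<Rightarrow> real) \<Rightarrow> real \<Rightarrow> real \<Rightarrow> real \<Rightarrow> bool" where
  "Lp_strong_error P H Z p \<beta> V \<longleftrightarrow>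
    (\<forall>h\<in>H. Lp_norm_pow P p (\<lambda>\<omega>. Z h \<omega> - Z 0 \<omega>) \<le> ennreal (V * h powr (\<beta> / 2 * p)))"

text \<open>\<open>Zc j k\<close> is the \<open>k\<close>-th copy used on level \<open>j\<close>. Copies are taken of the family as a whole:
  the joint law over all indices in \<open>I\<close> is reproduced, and distinct copies are mutually
  independent as random elements of the product space over \<open>I\<close>.\<close>

definition independent_copies ::
  "'a measure \<Rightarrow> real set \<Rightarrow> (real \<Rightarrow> 'a \<Rightarrow> real) \<Rightarrow> (nat \<Rightarrow> nat \<Rightarrow> real \<Rightarrow> 'a \<Rightarrow> real) \<Rightarrow> bool" where
  "independent_copies P I Z Zc \<longleftrightarrow>
    prob_space.indep_vars P (\<lambda>_. \<Pi>\<^sub>M h\<in>I. borel) (\<lambda>(j, k) \<omega>. \<lambda>h\<in>I. Zc j k h \<omega>) ({1..} \<times> {1..}) \<and>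
    (\<forall>j\<ge>1. \<forall>k\<ge>1. distr P (\<Pi>\<^sub>M h\<in>I. borel) (\<lambda>\<omega>. \<lambda>h\<in>I. Zc j k h \<omega>)
                 = distr P (\<Pi>\<^sub>M h\<in>I. borel) (\<lambda>\<omega>. \<lambda>h\<in>I. Z h \<omega>))"

definition refiner :: "nat \<Rightarrow> nat \<Rightarrow> nat" where
  "refiner M j = M ^ (j - 1)"

text \<open>The solution of the Vandermonde system, extended by zero outside \<open>{1..R}\<close> so that it is
  unique as a function on the naturals.\<close>

definition ml2r_w :: "real \<Rightarrow> nat \<Rightarrow> nat \<Rightarrow> nat \<Rightarrow> real" where
  "ml2r_w \<alpha> M R = (THE w.
     (\<forall>r. r \<notin> {1..R} \<longrightarrow> w r = 0) \<and>
     (\<Sum>r=1..R. w r) = 1 \<and>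
     (\<forall>i\<in>{1..R-1}. (\<Sum>r=1..R. w r * real (refiner M r) powr (- \<alpha> * real i)) = 0))"

definition ml2r_W :: "real \<Rightarrow> nat \<Rightarrow> nat \<Rightarrow> nat \<Rightarrow> real" where
  "ml2r_W \<alpha> M R j = (\<Sum>r=j..R. ml2r_w \<alpha> M R r)"

text \<open>In the estimators, the weights for the selected depth \<open>R\<close> are passed as \<open>W\<close>. For \<open>x > 0\<close>,
  \<open>nat \<lceil>x\<rceil>\<close> is the positive integer \<open>n\<close> with \<open>n - 1 < x \<le> n\<close>. A level with \<open>W j = 0\<close> (which can
  occur for the weighted estimator at exceptional values of \<open>\<alpha>\<close>) contributes zero.\<close>

definition ml_estimator ::
  "nat \<Rightarrow> (nat \<Rightarrow> real) \<Rightarrow> (nat \<Rightarrow> nat \<Rightarrow> real \<Rightarrow> 'a \<Rightarrow> real) \<Rightarrow> real \<Rightarrow> nat \<Rightarrow> (nat \<Rightarrow> real) \<Rightarrow> real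
    \<Rightarrow> 'a \<Rightarrow> real" where
  "ml_estimator M W Zc h R q N \<omega> =
    (let n = (\<lambda>j. nat \<lceil>N * q j\<rceil>); hl = (\<lambda>j. h / real (refiner M j))
     in 1 / real (n 1) * (\<Sum>k=1..n 1. Zc 1 k h \<omega>)
        + (\<Sum>j=2..R. W j / real (n j) * (\<Sum>k=1..n j. Zc j k (hl j) \<omega> - Zc j k (hl (j - 1)) \<omega>)))"

definition C_lower :: "nat \<Rightarrow> real \<Rightarrow> real" where
  "C_lower M \<beta> = (1 + real M powr (\<beta> / 2)) / sqrt (1 + 1 / real M)"

definition C_upper :: "nat \<Rightarrow> real \<Rightarrow> real" where
  "C_upper M \<beta> = (1 + real M powr (\<beta> / 2)) * sqrt (1 + 1 / real M)"

text \<open>\<open>q_shape\<close> is the allocation up to its normalising factor \<open>\<mu>\<close>.\<close>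

definition q_shape :: "nat \<Rightarrow> real \<Rightarrow> real \<Rightarrow> (nat \<Rightarrow> real) \<Rightarrow> real \<Rightarrow> nat \<Rightarrow> real" where
  "q_shape M \<beta> \<theta> W h j =
    (if j = 1 then 1 + \<theta> * h powr (\<beta> / 2)
     else \<theta> * h powr (\<beta> / 2) * C_lower M \<beta> * \<bar>W j\<bar> * real M powr (- ((1 + \<beta>) / 2) * (real j - 1)))"

definition mu_star :: "nat \<Rightarrow> real \<Rightarrow> real \<Rightarrow> (nat \<Rightarrow> real) \<Rightarrow> real \<Rightarrow> nat \<Rightarrow> real" where
  "mu_star M \<beta> \<theta> W h R = 1 / (\<Sum>j=1..R. q_shape M \<beta> \<theta> W h j)"

definition q_alloc :: "nat \<Rightarrow> real \<Rightarrow> real \<Rightarrow> (nat \<Rightarrow> real) \<Rightarrow> real \<Rightarrow> nat \<Rightarrow> nat \<Rightarrow> real" where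
  "q_alloc M \<beta> \<theta> W h R j = mu_star M \<beta> \<theta> W h R * q_shape M \<beta> \<theta> W h j"

lemma sum_q_alloc:
  assumes "\<theta> \<ge> 0" "R \<ge> 1"
  shows "(\<Sum>j=1..R. q_alloc M \<beta> \<theta> W h R j) = 1"
proof -
  have nn: "q_shape M \<beta> \<theta> W h j \<ge> 0" for j
    using assms(1) by (simp add: q_shape_def C_lower_def)
  have "0 < q_shape M \<beta> \<theta> W h 1"
    using assms(1) by (simp add: q_shape_def add_pos_nonneg)
  also have "\<dots> \<le> (\<Sum>j=1..R. q_shape M \<beta> \<theta> W h j)"
    using assms(2) nn by (intro member_le_sum) auto
  finally show ?thesis
    by (simp add: q_alloc_def mu_star_def flip: sum_divide_distrib)
qed

definition total_size ::
  "nat \<Rightarrow> real \<Rightarrow> real \<Rightarrow> real \<Rightarrow> real \<Rightarrow> (nat \<Rightarrow> real) \<Rightarrow> real \<Rightarrow> nat \<Rightarrow> real \<Rightarrow> real" where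
  "total_size M \<beta> \<rho> v \<theta> W h R \<epsilon> =
    \<rho> * (v * (1 + \<theta> * h powr (\<beta> / 2)
              + \<theta> * h powr (\<beta> / 2) * C_upper M \<beta>
                * (\<Sum>j=2..R. \<bar>W j\<bar> * real M powr ((1 - \<beta>) / 2 * (real j - 1)))))
      / (\<epsilon>\<^sup>2 * mu_star M \<beta> \<theta> W h R)"

text \<open>Parameters as functions of \<open>\<epsilon>\<close>; \<open>hb\<close> is the coarsest bias parameter \<open>1/K\<^sub>0\<close>, \<open>c1\<close> the first
  weak error coefficient and \<open>ci\<close> the limit of \<open>|c\<^sub>R| powr (1/R)\<close>.\<close>

definition mlmc_R :: "real \<Rightarrow> nat \<Rightarrow> real \<Rightarrow> real \<Rightarrow> real \<Rightarrow> nat" where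
  "mlmc_R \<alpha> M hb c1 \<epsilon> =
    nat \<lceil>1 + ln (\<bar>c1\<bar> powr (1 / \<alpha>) * hb) / ln (real M) + ln (sqrt (1 + 2 * \<alpha>) / \<epsilon>) / (\<alpha> * ln (real M))\<rceil>"

definition mlmc_h :: "real \<Rightarrow> nat \<Rightarrow> real \<Rightarrow> real \<Rightarrow> real \<Rightarrow> real" where
  "mlmc_h \<alpha> M hb c1 \<epsilon> =
    (let R = mlmc_R \<alpha> M hb c1 \<epsilon>
     in hb / real (nat \<lceil>hb * (1 + 2 * \<alpha>) powr (1 / (2 * \<alpha>)) * \<bar>c1\<bar> powr (1 / \<alpha>)
                       * \<epsilon> powr (- (1 / \<alpha>)) * real M powr (- (real R - 1))\<rceil>))"

definition ml2r_kappa :: "real \<Rightarrow> nat \<Rightarrow> real \<Rightarrow> real \<Rightarrow> real" where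
  "ml2r_kappa \<alpha> M hb ci = 1 / 2 + ln (ci powr (1 / \<alpha>) * hb) / ln (real M)"

definition ml2r_R :: "real \<Rightarrow> nat \<Rightarrow> real \<Rightarrow> real \<Rightarrow> real \<Rightarrow> nat" where
  "ml2r_R \<alpha> M hb ci \<epsilon> =
    nat \<lceil>ml2r_kappa \<alpha> M hb ci
        + sqrt ((ml2r_kappa \<alpha> M hb ci)\<^sup>2 + 2 * ln (sqrt (1 + 4 * \<alpha>) / \<epsilon>) / (\<alpha> * ln (real M)))\<rceil>"

definition ml2r_h :: "real \<Rightarrow> nat \<Rightarrow> real \<Rightarrow> real \<Rightarrow> real \<Rightarrow> real" where
  "ml2r_h \<alpha> M hb ci \<epsilon> =
    (let R = ml2r_R \<alpha> M hb ci \<epsilon>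
     in hb / real (nat \<lceil>hb * (1 + 2 * \<alpha> * real R) powr (1 / (2 * \<alpha> * real R)) * ci powr (1 / \<alpha>)
                       * \<epsilon> powr (- (1 / (\<alpha> * real R))) * real M powr (- ((real R - 1) / 2))\<rceil>))"

text \<open>The estimators at accuracy \<open>\<epsilon>\<close>. The argument \<open>v\<close> is the variance of the target variable and
  \<open>V\<^sub>1\<close> the strong error constant. They are meaningful once \<open>\<epsilon>\<close> is so small that the depth is at
  least 2.\<close>

definition mlmc_estimator ::
  "real \<Rightarrow> real \<Rightarrow> nat \<Rightarrow> real \<Rightarrow> real \<Rightarrow> real \<Rightarrow> real \<Rightarrow> (nat \<Rightarrow> nat \<Rightarrow> real \<Rightarrow> 'a \<Rightarrow> real)
    \<Rightarrow> real \<Rightarrow> 'a \<Rightarrow> real" where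
  "mlmc_estimator \<alpha> \<beta> M hb c1 V\<^sub>1 v Zc \<epsilon> \<omega> =
    (let R = mlmc_R \<alpha> M hb c1 \<epsilon>; h = mlmc_h \<alpha> M hb c1 \<epsilon>;
         \<theta> = sqrt (V\<^sub>1 / v); W = (\<lambda>_. 1)
     in ml_estimator M W Zc h R (q_alloc M \<beta> \<theta> W h R)
          (total_size M \<beta> (1 + 1 / (2 * \<alpha>)) v \<theta> W h R \<epsilon>) \<omega>)"

definition ml2r_estimator ::
  "real \<Rightarrow> real \<Rightarrow> nat \<Rightarrow> real \<Rightarrow> real \<Rightarrow> real \<Rightarrow> real \<Rightarrow> (nat \<Rightarrow> nat \<Rightarrow> real \<Rightarrow> 'a \<Rightarrow> real)
    \<Rightarrow> real \<Rightarrow> 'a \<Rightarrow> real" where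
  "ml2r_estimator \<alpha> \<beta> M hb ci V\<^sub>1 v Zc \<epsilon> \<omega> =
    (let R = ml2r_R \<alpha> M hb ci \<epsilon>; h = ml2r_h \<alpha> M hb ci \<epsilon>;
         \<theta> = sqrt (V\<^sub>1 / v); W = ml2r_W \<alpha> M R
     in ml_estimator M W Zc h R (q_alloc M \<beta> \<theta> W h R)
          (total_size M \<beta> (1 + 1 / (2 * \<alpha> * real R)) v \<theta> W h R \<epsilon>) \<omega>)"

text \<open>The exceptional null set may depend on the sequence \<open>\<epsilon>\<close>.\<close>

definition slln_along ::
  "'a measure \<Rightarrow> real \<Rightarrow> (real \<Rightarrow> 'a \<Rightarrow> real) \<Rightarrow> real \<Rightarrow> bool" where
  "slln_along P p est I\<^sub>0 \<longleftrightarrow>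
    (\<forall>\<epsilon> :: nat \<Rightarrow> real. (\<forall>k. \<epsilon> k > 0) \<longrightarrow> summable (\<lambda>k. \<epsilon> k powr p) \<longrightarrow>
       (AE \<omega> in P. (\<lambda>k. est (\<epsilon> k) \<omega>) \<longlonglongrightarrow> I\<^sub>0))"

end

theory Submission
  imports Defs
begin

text \<open>
  Everything rests on one moment inequality, \<open>indep_sum_moment_bound\<close>: if the \<open>X\<^sub>i\<close> are
  independent and centred with \<open>E |X\<^sub>i|\<^sup>p \<le> m s\<^sub>i powr (p/2)\<close> and \<open>p \<ge> 2\<close>, then
  \<open>E |\<Sum> X\<^sub>i|\<^sup>p \<le> C m (\<Sum> s\<^sub>i) powr (p/2)\<close> with \<open>C\<close> depending on \<open>p\<close> only. This is the
  combination of the Marcinkiewicz--Zygmund inequality with Minkowski's inequality, and it says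
  that the squared \<open>L\<^sup>p\<close> norm is subadditive, up to a constant factor, over independent centred
  variables. It is proved by adding one variable at a time, using a second order expansion of
  \<open>|x + y|\<^sup>p\<close> whose first order term has mean zero.

  The inequality is used twice. For the inner simulation, put \<open>G y = E F(\<xi>, y)\<close>, so that
  \<open>G(Y) = E[X | Y]\<close>. With \<open>Y\<close> frozen at \<open>y\<close> the deviations \<open>F(\<xi>\<^sub>k, y) - G y\<close> are independent and
  centred. The difference of the averages over \<open>K \<le> K'\<close> samples is a combination
  \<open>\<Sum> a\<^sub>k (F(\<xi>\<^sub>k, y) - G y)\<close> with \<open>\<Sum> a\<^sub>k\<^sup>2 = 1/K - 1/K'\<close>, exactly the distance \<open>|h' - h|\<close>.
  Integrating over the law of \<open>Y\<close> gives the increment bound, and the coefficients \<open>a\<^sub>k = 1/K\<close>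
  give both strong error bounds.

  For the estimators, the fluctuation around the mean is a sum over levels \<open>j\<close> and copies \<open>k\<close>
  whose terms have scale \<open>s = (W\<^sub>j / N\<^sub>j)\<^sup>2 h\<^sub>j\<close> for \<open>j \<ge> 2\<close>. The sample allocation is designed so that
  these scales add up to at most a constant times \<open>\<epsilon>\<^sup>2\<close>, whatever the weights, the depth and the
  bias parameter are (\<open>allocation_variance_bound\<close>). Hence the \<open>p\<close>-th moment of the fluctuation is
  \<open>O(\<epsilon>\<^sup>p)\<close>, and summability of \<open>\<epsilon>\<^sub>k\<^sup>p\<close> forces almost sure convergence to zero.

  The mean of the estimator is \<open>\<Sum> w\<^sub>r E Y(h\<^sub>r)\<close> by Abel summation, where \<open>\<Sum> w\<^sub>r = 1\<close>, and
  \<open>|E Y(h) - E Y(0)| = O(\<surd>h)\<close>. Since \<open>h\<^sub>r \<le> M powr (- (r - 1))\<close>, the bias is at most a constant times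
  \<open>\<Sum> |w\<^sub>r| M powr (- (r - 1) / 2)\<close>. For MLMC the weight sits entirely at \<open>r = R\<close>. For ML2R the
  weights are values at \<open>0\<close> of Lagrange basis polynomials with geometric nodes, which decay
  geometrically in \<open>R - r\<close> (\<open>abs_ml2r_w_le\<close>). In both cases the sum tends to \<open>0\<close> as the depth
  \<open>R(\<epsilon>)\<close> tends to infinity.
\<close>

section \<open>A perturbation inequality for the absolute power\<close>


text \<open>Two applications of the mean value theorem: the derivative of \<open>(1 + u)\<^sup>p - p u\<close> is itself
  \<open>O(|u|)\<close> on the interval.\<close>

lemma one_plus_powr_Taylor_bound:
  fixes p :: real
  assumes "p \<ge> 2"
  shows "\<exists>C\<ge>0. \<forall>u. \<bar>u\<bar> \<le> 1/2 \<longrightarrow> (1 + u) powr p \<le> 1 + p * u + C * u\<^sup>2"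
proof -
  define C where "C = p * ((p - 1) * (3/2) powr (p - 2))"
  have lip: "\<bar>(1 + v) powr (p - 1) - 1\<bar> \<le> (p - 1) * (3/2) powr (p - 2) * \<bar>v\<bar>"
    if "\<bar>v\<bar> \<le> 1/2" for v :: real
  proof -
    have "norm ((1 + v) powr (p - 1) - (1 + 0) powr (p - 1)) \<le> ((p - 1) * (3/2) powr (p - 2)) * norm (v - 0)"
    proof (rule field_differentiable_bound[where S = "{-1/2..1/2}"])
      fix z :: real assume z: "z \<in> {-1/2..1/2}"
      show "((\<lambda>v. (1 + v) powr (p - 1)) has_field_derivative (p - 1) * (1 + z) powr (p - 2)) (at z within {-1/2..1/2})"
        using z by (auto intro!: derivative_eq_intros)
      have "(1 + z) powr (p - 2) \<le> (3/2) powr (p - 2)"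
        using z assms by (intro powr_mono2) auto
      then show "norm ((p - 1) * (1 + z) powr (p - 2)) \<le> (p - 1) * (3/2) powr (p - 2)"
        using assms by (simp add: abs_mult)
    qed (use that in auto)
    then show ?thesis by simp
  qed
  have "(1 + u) powr p \<le> 1 + p * u + C * u\<^sup>2" if u: "\<bar>u\<bar> \<le> 1/2" for u :: real
  proof -
    have "norm (((1 + u) powr p - p * u) - ((1 + 0) powr p - p * 0)) \<le> (C * \<bar>u\<bar>) * norm (u - 0)"
    proof (rule field_differentiable_bound[where S = "{-\<bar>u\<bar>..\<bar>u\<bar>}"])
      fix z :: real assume z: "z \<in> {-\<bar>u\<bar>..\<bar>u\<bar>}"
      show "((\<lambda>v. (1 + v) powr p - p * v) has_field_derivative p * ((1 + z) powr (p - 1) - 1)) (at z within {-\<bar>u\<bar>..\<bar>u\<bar>})"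
        using z u by (auto intro!: derivative_eq_intros simp: algebra_simps)
      have "\<bar>(1 + z) powr (p - 1) - 1\<bar> \<le> (p - 1) * (3/2) powr (p - 2) * \<bar>z\<bar>"
        using z u by (intro lip) auto
      also have "\<dots> \<le> (p - 1) * (3/2) powr (p - 2) * \<bar>u\<bar>"
        using z assms by (intro mult_left_mono) auto
      finally show "norm (p * ((1 + z) powr (p - 1) - 1)) \<le> C * \<bar>u\<bar>"
        using assms by (simp add: abs_mult C_def mult.assoc)
    qed auto
    then show ?thesis by (simp add: power2_eq_square abs_if mult.assoc split: if_splits)
  qed
  moreover have "C \<ge> 0" using assms by (simp add: C_def)
  ultimately show ?thesis by blast
qed

text \<open>By homogeneity the case \<open>|y| \<le> |x| / 2\<close> reduces to the expansion of \<open>(1 + u)\<^sup>p\<close> near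
  \<open>u = 0\<close>, away from the singularity of the power function. For larger \<open>y\<close> every term is
  dominated by \<open>|y|\<^sup>p\<close>.\<close>

lemma abs_powr_Taylor_bound:
  fixes p :: real
  assumes "p \<ge> 2"
  shows "\<exists>C\<ge>0. \<forall>x y. \<bar>x + y\<bar> powr p
           \<le> \<bar>x\<bar> powr p + p * (sgn x * \<bar>x\<bar> powr (p - 1)) * y + C * (y\<^sup>2 * \<bar>x\<bar> powr (p - 2) + \<bar>y\<bar> powr p)"
proof -
  obtain C0 where C0: "C0 \<ge> 0" and Taylor: "\<And>u. \<bar>u\<bar> \<le> 1/2 \<Longrightarrow> (1 + u) powr p \<le> 1 + p * u + C0 * u\<^sup>2"
    using one_plus_powr_Taylor_bound[OF assms] by blast
  define C where "C = C0 + 3 powr p + p * 2 powr (p - 1)"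
  have C: "C \<ge> 0" using C0 assms by (simp add: C_def)
  have main: "\<bar>x + y\<bar> powr p \<le> \<bar>x\<bar> powr p + p * (sgn x * \<bar>x\<bar> powr (p - 1)) * y + C * (y\<^sup>2 * \<bar>x\<bar> powr (p - 2) + \<bar>y\<bar> powr p)"
    if "x \<ge> 0" for x y :: real
  proof (cases "\<bar>y\<bar> \<le> x / 2 \<and> x > 0")
    case True
    then have x: "x > 0" by simp
    define u where "u = y / x"
    have y: "y = x * u" and u: "\<bar>u\<bar> \<le> 1/2" using True by (auto simp: u_def field_simps)
    have "x + y = x * (1 + u)" by (simp add: y algebra_simps)
    then have "\<bar>x + y\<bar> powr p = x powr p * (1 + u) powr p"
      using x u by (simp add: abs_mult powr_mult)
    also have "\<dots> \<le> x powr p * (1 + p * u + C0 * u\<^sup>2)"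
      using Taylor[OF u] by (intro mult_left_mono) auto
    also have "\<dots> = x powr p + p * (x powr (p-1)) * y + C0 * (y\<^sup>2 * x powr (p - 2))"
    proof -
      have "x powr p = x powr (p - 1) * x" "x powr p = x powr (p - 2) * x\<^sup>2"
        using x powr_add[of x "p - 1" 1] powr_add[of x "p - 2" 2] by auto
      then show ?thesis by (simp add: y algebra_simps power2_eq_square)
    qed
    also have "\<dots> \<le> x powr p + p * (x powr (p-1)) * y + C * (y\<^sup>2 * x powr (p - 2) + \<bar>y\<bar> powr p)"
    proof -
      have "C0 * (y\<^sup>2 * x powr (p - 2)) \<le> C * (y\<^sup>2 * x powr (p - 2) + \<bar>y\<bar> powr p)"
        using C0 C assms by (intro mult_mono) (auto simp: C_def)
      then show ?thesis by simp
    qed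
    finally show ?thesis using x by simp
  next
    case False
    then have xy: "x \<le> 2 * \<bar>y\<bar>" using that by (cases "x = 0") auto
    have "\<bar>x + y\<bar> powr p \<le> (3 * \<bar>y\<bar>) powr p"
      using assms xy that by (intro powr_mono2) auto
    then have 1: "\<bar>x + y\<bar> powr p \<le> 3 powr p * \<bar>y\<bar> powr p" by (simp add: powr_mult)
    have "x powr (p - 1) * \<bar>y\<bar> \<le> (2 * \<bar>y\<bar>) powr (p - 1) * \<bar>y\<bar>"
      using assms xy that by (intro mult_right_mono powr_mono2) auto
    also have "\<dots> = 2 powr (p - 1) * \<bar>y\<bar> powr p"
      using powr_add[of "\<bar>y\<bar>" "p - 1" 1] by (simp add: powr_mult)
    finally have 2: "p * (x powr (p - 1) * \<bar>y\<bar>) \<le> p * (2 powr (p - 1) * \<bar>y\<bar> powr p)"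
      using assms by (intro mult_left_mono) auto
    have 3: "- (p * (sgn x * \<bar>x\<bar> powr (p - 1)) * y) \<le> p * (x powr (p - 1) * \<bar>y\<bar>)"
    proof (cases "x = 0")
      case False
      have "x powr (p - 1) * (- y) \<le> x powr (p - 1) * \<bar>y\<bar>" by (intro mult_left_mono) auto
      then have "p * (x powr (p - 1) * (- y)) \<le> p * (x powr (p - 1) * \<bar>y\<bar>)"
        using assms by (intro mult_left_mono) auto
      then show ?thesis using False that by (simp add: sgn_if mult.assoc)
    qed simp
    have 4: "(3 powr p + p * 2 powr (p - 1)) * \<bar>y\<bar> powr p \<le> C * \<bar>y\<bar> powr p"
      using C0 by (intro mult_right_mono) (auto simp: C_def)
    have 5: "0 \<le> C * (y\<^sup>2 * \<bar>x\<bar> powr (p - 2))" using C by simp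
    have 6: "0 \<le> \<bar>x\<bar> powr p" by simp
    show ?thesis using 1 2 3 4 5 6 unfolding ring_distribs mult.assoc by linarith
  qed
  have "\<bar>x + y\<bar> powr p \<le> \<bar>x\<bar> powr p + p * (sgn x * \<bar>x\<bar> powr (p - 1)) * y + C * (y\<^sup>2 * \<bar>x\<bar> powr (p - 2) + \<bar>y\<bar> powr p)"
    for x y :: real
  \<comment> \<open>The inequality is invariant under changing both signs.\<close>
  proof (cases "x \<ge> 0")
    case False
    then show ?thesis using main[of "- x" "- y"] by (simp add: sgn_minus flip: abs_minus_commute minus_add_distrib) (simp add: add.commute abs_minus_commute)
  qed (rule main)
  with C show ?thesis by blast
qed

text \<open>Either \<open>y\<^sup>2\<close> is small compared with \<open>x\<^sup>2 / t\<close> and the first term dominates, or \<open>x\<^sup>2\<close> is at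
  most a multiple of \<open>t y\<^sup>2\<close> and the second one does. The parameter \<open>t\<close> will be the ratio of the
  scale of a sum to the scale of one summand.\<close>

lemma scaled_Young_bound:
  fixes p :: real
  assumes "p \<ge> 2" "\<delta> > 0" "t \<ge> 1"
  shows "y\<^sup>2 * \<bar>x\<bar> powr (p - 2) \<le> \<delta> / t * \<bar>x\<bar> powr p + (1 / \<delta>) powr (p/2 - 1) * t powr (p/2 - 1) * \<bar>y\<bar> powr p"
proof (cases "y\<^sup>2 \<le> \<delta> / t * x\<^sup>2")
  case True
  then have "y\<^sup>2 * \<bar>x\<bar> powr (p - 2) \<le> \<delta> / t * x\<^sup>2 * \<bar>x\<bar> powr (p - 2)"
    by (intro mult_right_mono) auto
  also have "\<dots> = \<delta> / t * \<bar>x\<bar> powr p"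
    using powr_add[of "\<bar>x\<bar>" "p - 2" 2] by (simp add: mult_ac)
  also have "\<dots> \<le> \<dots> + (1 / \<delta>) powr (p/2 - 1) * t powr (p/2 - 1) * \<bar>y\<bar> powr p" by simp
  finally show ?thesis .
next
  case False
  have "\<bar>x\<bar> powr (p - 2) = (\<bar>x\<bar> powr 2) powr (p/2 - 1)"
    by (simp add: powr_powr right_diff_distrib del: powr_numeral)
  also have "\<dots> \<le> (1 / \<delta> * t * \<bar>y\<bar> powr 2) powr (p/2 - 1)"
    using False assms by (intro powr_mono2) (auto simp: field_simps)
  also have "\<dots> = (1 / \<delta>) powr (p/2 - 1) * t powr (p/2 - 1) * \<bar>y\<bar> powr (p - 2)"
    using assms by (subst powr_mult)+ (simp add: powr_powr right_diff_distrib del: powr_numeral)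
  finally have "y\<^sup>2 * \<bar>x\<bar> powr (p - 2) \<le> y\<^sup>2 * ((1 / \<delta>) powr (p/2 - 1) * t powr (p/2 - 1) * \<bar>y\<bar> powr (p - 2))"
    by (intro mult_left_mono) auto
  also have "\<dots> = (1 / \<delta>) powr (p/2 - 1) * t powr (p/2 - 1) * \<bar>y\<bar> powr p"
    using powr_add[of "\<bar>y\<bar>" "p - 2" 2] by (simp add: mult_ac)
  also have "\<dots> \<le> \<delta> / t * \<bar>x\<bar> powr p + \<dots>" using assms by simp
  finally show ?thesis .
qed

text \<open>The form of the expansion that iterates well. Adding a summand whose share of the new total
  scale is \<open>1 / t\<close> enlarges the intended moment bound at least by the factor \<open>1 + 1 / t\<close>; the
  leading coefficient uses up only half of this, and the rest absorbs the last term.\<close>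

lemma abs_powr_add_bound:
  fixes p :: real
  assumes "p \<ge> 2"
  shows "\<exists>B\<ge>0. \<forall>x y t. t \<ge> 1 \<longrightarrow> \<bar>x + y\<bar> powr p
           \<le> (1 + 1 / (2 * t)) * \<bar>x\<bar> powr p + p * (sgn x * \<bar>x\<bar> powr (p - 1) * y) + B * t powr (p/2 - 1) * \<bar>y\<bar> powr p"
proof -
  obtain C where C: "C \<ge> 0" and Taylor: "\<And>x y. \<bar>x + y\<bar> powr p
           \<le> \<bar>x\<bar> powr p + p * (sgn x * \<bar>x\<bar> powr (p - 1)) * y + C * (y\<^sup>2 * \<bar>x\<bar> powr (p - 2) + \<bar>y\<bar> powr p)"
    using abs_powr_Taylor_bound[OF assms] by blast
  \<comment> \<open>This choice makes the mixed term of the expansion at most \<open>1 / (2 t)\<close> times \<open>|x|\<^sup>p\<close>.\<close>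
  define \<delta> where "\<delta> = 1 / (2 * (C + 1))"
  have \<delta>: "\<delta> > 0" using C by (simp add: \<delta>_def)
  define B where "B = C * ((1 / \<delta>) powr (p/2 - 1) + 1)"
  have "\<bar>x + y\<bar> powr p
           \<le> (1 + 1 / (2 * t)) * \<bar>x\<bar> powr p + p * (sgn x * \<bar>x\<bar> powr (p - 1) * y) + B * t powr (p/2 - 1) * \<bar>y\<bar> powr p"
    if t: "t \<ge> 1" for x y t :: real
  proof -
    define X where "X = \<bar>x\<bar> powr p"
    define U where "U = \<bar>y\<bar> powr p"
    define s where "s = t powr (p/2 - 1)"
    have nn: "X \<ge> 0" "U \<ge> 0" by (auto simp: X_def U_def)
    have s: "s \<ge> 1" using t assms by (simp add: s_def ge_one_powr_ge_zero)
    have "C * (y\<^sup>2 * \<bar>x\<bar> powr (p - 2) + U) \<le> C * ((\<delta> / t * X + (1 / \<delta>) powr (p/2 - 1) * s * U) + s * U)"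
      using scaled_Young_bound[OF assms \<delta> t, of y x] C s nn mult_right_mono[of 1 s U]
      by (intro mult_left_mono add_mono) (auto simp: X_def U_def s_def)
    also have "\<dots> = C * \<delta> / t * X + B * s * U" by (simp add: B_def algebra_simps)
    also have "C * \<delta> / t * X \<le> 1 / (2 * t) * X"
    proof (intro mult_right_mono)
      have "C * \<delta> \<le> 1 / 2" using C by (simp add: \<delta>_def field_simps)
      then have "C * \<delta> / t \<le> 1 / 2 / t" using t by (intro divide_right_mono) auto
      then show "C * \<delta> / t \<le> 1 / (2 * t)" by simp
    qed (use nn in auto)
    finally show ?thesis
      using Taylor[of x y] by (simp add: X_def U_def s_def algebra_simps)
  qed
  moreover have "B \<ge> 0" using C by (simp add: B_def)
  ultimately show ?thesis by blast
qed


section \<open>Elementary facts about p-th moments\<close>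

lemma abs_add_powr_le:
  fixes x y p :: real
  assumes "p \<ge> 0"
  shows "\<bar>x + y\<bar> powr p \<le> 2 powr p * (\<bar>x\<bar> powr p + \<bar>y\<bar> powr p)"
proof -
  have "\<bar>x + y\<bar> powr p \<le> (2 * max \<bar>x\<bar> \<bar>y\<bar>) powr p"
    using assms by (intro powr_mono2) auto
  also have "\<dots> = 2 powr p * (max \<bar>x\<bar> \<bar>y\<bar>) powr p"
    by (simp add: powr_mult)
  also have "(max \<bar>x\<bar> \<bar>y\<bar>) powr p \<le> \<bar>x\<bar> powr p + \<bar>y\<bar> powr p"
    by (simp add: max_def)
  finally show ?thesis by simp
qed

lemma in_Lp_add:
  assumes "p \<ge> 0" "in_Lp P p U" "in_Lp P p V"
  shows "in_Lp P p (\<lambda>\<omega>. U \<omega> + V \<omega>)"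
proof -
  have [measurable]: "U \<in> borel_measurable P" "V \<in> borel_measurable P"
    using assms by (auto simp: in_Lp_def)
  have "integrable P (\<lambda>\<omega>. 2 powr p * (\<bar>U \<omega>\<bar> powr p + \<bar>V \<omega>\<bar> powr p))"
    using assms by (auto simp: in_Lp_def)
  then have "integrable P (\<lambda>\<omega>. \<bar>U \<omega> + V \<omega>\<bar> powr p)"
    by (rule Bochner_Integration.integrable_bound) (auto simp: abs_add_powr_le assms(1))
  then show ?thesis by (simp add: in_Lp_def)
qed

lemma in_Lp_cmult:
  assumes "in_Lp P p U"
  shows "in_Lp P p (\<lambda>\<omega>. c * U \<omega>)"
  using assms by (auto simp: in_Lp_def abs_mult powr_mult)

lemma in_Lp_diff:
  assumes "p \<ge> 0" "in_Lp P p U" "in_Lp P p V"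
  shows "in_Lp P p (\<lambda>\<omega>. U \<omega> - V \<omega>)"
  using in_Lp_add[OF assms(1,2) in_Lp_cmult[OF assms(3), of "-1"]] by simp

lemma in_Lp_const: "prob_space P \<Longrightarrow> in_Lp P p (\<lambda>_. c)"
  using prob_space.finite_measure finite_measure.integrable_const by (fastforce simp: in_Lp_def)

lemma in_Lp_sum:
  assumes "p \<ge> 0" "finite I" "\<And>i. i \<in> I \<Longrightarrow> in_Lp P p (X i)"
  shows "in_Lp P p (\<lambda>\<omega>. \<Sum>i\<in>I. X i \<omega>)"
  using assms(2,3)
proof (induction I)
  case empty
  then show ?case using assms(1) by (simp add: in_Lp_def)
next
  case (insert i I)
  then show ?case using in_Lp_add[OF assms(1), of P "X i" "\<lambda>\<omega>. \<Sum>i\<in>I. X i \<omega>"] by simp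
qed

lemma in_Lp_iff_Lp_norm_pow_finite:
  "in_Lp P p U \<longleftrightarrow> U \<in> borel_measurable P \<and> Lp_norm_pow P p U < \<infinity>"
  by (auto simp: in_Lp_def Lp_norm_pow_def integrable_iff_bounded)

lemma Lp_norm_pow_eq_integral:
  "in_Lp P p U \<Longrightarrow> Lp_norm_pow P p U = ennreal (\<integral>\<omega>. \<bar>U \<omega>\<bar> powr p \<partial>P)"
  unfolding in_Lp_def Lp_norm_pow_def by (intro nn_integral_eq_integral) auto

text \<open>The extended norm carries integrability, so a finite bound transfers to the Bochner
  integral.\<close>

lemma Lp_norm_pow_le_ennrealD:
  assumes "U \<in> borel_measurable P" "Lp_norm_pow P p U \<le> ennreal b" "b \<ge> 0"
  shows "in_Lp P p U" "(\<integral>\<omega>. \<bar>U \<omega>\<bar> powr p \<partial>P) \<le> b"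
proof -
  show "in_Lp P p U"
    using assms le_less_trans[OF assms(2) ennreal_less_top] by (simp add: in_Lp_iff_Lp_norm_pow_finite)
  from Lp_norm_pow_eq_integral[OF this] show "(\<integral>\<omega>. \<bar>U \<omega>\<bar> powr p \<partial>P) \<le> b"
    using assms by simp
qed

context prob_space
begin

lemma in_Lp_imp_integrable:
  assumes "p \<ge> 1" "in_Lp M p U"
  shows "integrable M U"
proof (rule Bochner_Integration.integrable_bound[where f = "\<lambda>\<omega>. 1 + \<bar>U \<omega>\<bar> powr p"])
  have "\<bar>u\<bar> \<le> 1 + \<bar>u\<bar> powr p" for u :: real
  proof (cases "\<bar>u\<bar> \<le> 1")
    case False
    then have "\<bar>u\<bar> powr 1 \<le> \<bar>u\<bar> powr p" using assms by (intro powr_mono) auto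
    then show ?thesis using False by simp
  qed (simp add: add_increasing2)
  then show "AE \<omega> in M. norm (U \<omega>) \<le> norm (1 + \<bar>U \<omega>\<bar> powr p)" by (auto simp: abs_of_nonneg add_nonneg_nonneg)
qed (use assms in \<open>auto simp: in_Lp_def\<close>)

text \<open>Jensen's inequality for \<open>|u|\<^sup>p\<close>. With \<open>a = E |U|\<close> it follows by integrating Young's inequality
  for the product of \<open>|U|\<close> and \<open>a powr (p - 1)\<close>, whose left side integrates to \<open>a\<^sup>p\<close>.\<close>

lemma abs_expectation_powr_le:
  assumes "p > 1" "in_Lp M p U"
  shows "\<bar>expectation U\<bar> powr p \<le> expectation (\<lambda>\<omega>. \<bar>U \<omega>\<bar> powr p)"
proof -
  define a where "a = expectation (\<lambda>\<omega>. \<bar>U \<omega>\<bar>)"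
  define q where "q = p / (p - 1)"
  have q: "q > 1" "1/p + 1/q = 1" using assms by (auto simp: q_def field_simps)
  have int: "integrable M U" using in_Lp_imp_integrable[OF _ assms(2)] assms(1) by simp
  have a: "a \<ge> 0" by (simp add: a_def)
  have "a powr p = a powr (p - 1) * a"
    using a powr_add[of a "p - 1" 1] by simp
  also have "\<dots> = expectation (\<lambda>\<omega>. \<bar>U \<omega>\<bar> * a powr (p - 1))"
    by (simp add: a_def)
  also have "\<dots> \<le> expectation (\<lambda>\<omega>. \<bar>U \<omega>\<bar> powr p / p + (a powr (p - 1)) powr q / q)"
  proof (rule integral_mono)
    show "integrable M (\<lambda>\<omega>. \<bar>U \<omega>\<bar> powr p / p + (a powr (p - 1)) powr q / q)"
      using assms by (auto simp: in_Lp_def)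
    show "\<bar>U \<omega>\<bar> * a powr (p - 1) \<le> \<bar>U \<omega>\<bar> powr p / p + (a powr (p - 1)) powr q / q" for \<omega>
      using assms q by (intro Youngs_inequality) auto
  qed (use int in auto)
  also have "(a powr (p - 1)) powr q = a powr p" using assms by (simp add: powr_powr q_def)
  also have "expectation (\<lambda>\<omega>. \<bar>U \<omega>\<bar> powr p / p + a powr p / q) = expectation (\<lambda>\<omega>. \<bar>U \<omega>\<bar> powr p) / p + a powr p / q"
    using assms by (subst Bochner_Integration.integral_add) (auto simp: in_Lp_def prob_space)
  finally have "a powr p * (1 - 1 / q) \<le> expectation (\<lambda>\<omega>. \<bar>U \<omega>\<bar> powr p) / p"
    by (simp add: algebra_simps)
  moreover have "1 - 1 / q = 1 / p" using q by simp
  ultimately have "a powr p \<le> expectation (\<lambda>\<omega>. \<bar>U \<omega>\<bar> powr p)"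
    using assms by (simp add: field_simps)
  moreover have "\<bar>expectation U\<bar> powr p \<le> a powr p"
    using assms int by (intro powr_mono2) (auto simp: a_def)
  ultimately show ?thesis by linarith
qed

lemma expectation_centred_powr_le:
  assumes "p > 1" "in_Lp M p U"
  shows "expectation (\<lambda>\<omega>. \<bar>U \<omega> - expectation U\<bar> powr p) \<le> 2 * 2 powr p * expectation (\<lambda>\<omega>. \<bar>U \<omega>\<bar> powr p)"
proof -
  have int: "integrable M (\<lambda>\<omega>. \<bar>U \<omega>\<bar> powr p)" using assms by (simp add: in_Lp_def)
  have "expectation (\<lambda>\<omega>. \<bar>U \<omega> - expectation U\<bar> powr p)
      \<le> expectation (\<lambda>\<omega>. 2 powr p * (\<bar>U \<omega>\<bar> powr p + \<bar>expectation U\<bar> powr p))"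
  proof (rule integral_mono)
    show "integrable M (\<lambda>\<omega>. \<bar>U \<omega> - expectation U\<bar> powr p)"
      using in_Lp_diff[of p M U "\<lambda>_. expectation U"] in_Lp_const[of M p] assms prob_space_axioms
      by (simp add: in_Lp_def)
    show "\<bar>U \<omega> - expectation U\<bar> powr p \<le> 2 powr p * (\<bar>U \<omega>\<bar> powr p + \<bar>expectation U\<bar> powr p)" for \<omega>
      using abs_add_powr_le[of p "U \<omega>" "- expectation U"] assms by simp
  qed (use int in auto)
  also have "\<dots> = 2 powr p * (expectation (\<lambda>\<omega>. \<bar>U \<omega>\<bar> powr p) + \<bar>expectation U\<bar> powr p)"
    using int by (simp add: prob_space)
  also have "\<dots> \<le> 2 powr p * (expectation (\<lambda>\<omega>. \<bar>U \<omega>\<bar> powr p) + expectation (\<lambda>\<omega>. \<bar>U \<omega>\<bar> powr p))"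
    using abs_expectation_powr_le[OF assms] by simp
  finally show ?thesis by simp
qed

end

section \<open>Moments of sums of independent centred variables\<close>

text \<open>A choice of the constant in the perturbation inequality, so that later bounds can name their
  constants and visibly depend on \<open>p\<close> only.\<close>

definition moment_const :: "real \<Rightarrow> real" where
  "moment_const p = (SOME B. B \<ge> 0 \<and> (\<forall>x y t. t \<ge> 1 \<longrightarrow> \<bar>x + y\<bar> powr p
           \<le> (1 + 1 / (2 * t)) * \<bar>x\<bar> powr p + p * (sgn x * \<bar>x\<bar> powr (p - 1) * y) + B * t powr (p/2 - 1) * \<bar>y\<bar> powr p))"

lemma moment_const:
  assumes "p \<ge> 2"
  shows "moment_const p \<ge> 0"
    and "t \<ge> 1 \<Longrightarrow> \<bar>x + y\<bar> powr p
           \<le> (1 + 1 / (2 * t)) * \<bar>x\<bar> powr p + p * (sgn x * \<bar>x\<bar> powr (p - 1) * y) + moment_const p * t powr (p/2 - 1) * \<bar>y\<bar> powr p"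
  using someI_ex[OF abs_powr_add_bound[OF assms, unfolded Bex_def]] unfolding moment_const_def
  by blast+

text \<open>Induction on the index set. Adding \<open>X\<^sub>i\<close> to the partial sum \<open>S\<close>, the first order term of
  the perturbation inequality vanishes by independence, and with \<open>T\<close> the new total scale and
  \<open>t = T / s\<^sub>i\<close> the other two terms add up to at most the new bound.\<close>

lemma (in prob_space) indep_sum_moment_bound:
  fixes X :: "'i \<Rightarrow> 'a \<Rightarrow> real"
  assumes p: "p \<ge> 2" and "m \<ge> 0" and "finite I" and "indep_vars (\<lambda>_. borel) X I"
    and "\<And>i. i \<in> I \<Longrightarrow> in_Lp M p (X i)"
    and "\<And>i. i \<in> I \<Longrightarrow> expectation (X i) = 0"
    and "\<And>i. i \<in> I \<Longrightarrow> s i \<ge> 0"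
    and "\<And>i. i \<in> I \<Longrightarrow> expectation (\<lambda>\<omega>. \<bar>X i \<omega>\<bar> powr p) \<le> m * s i powr (p / 2)"
  shows "expectation (\<lambda>\<omega>. \<bar>\<Sum>i\<in>I. X i \<omega>\<bar> powr p) \<le> 2 * moment_const p * m * (\<Sum>i\<in>I. s i) powr (p / 2)"
  using assms(3-)
proof (induction I)
  case empty
  then show ?case by simp
next
  case (insert i I)
  define S where "S = (\<lambda>\<omega>. \<Sum>i\<in>I. X i \<omega>)"
  define V where "V = (\<Sum>i\<in>I. s i)"
  define T where "T = s i + V"
  define r where "r = p / 2"
  define B where "B = moment_const p"
  define a where "a = expectation (\<lambda>\<omega>. \<bar>S \<omega>\<bar> powr p)"
  have B: "B \<ge> 0" using moment_const(1)[OF p] by (simp add: B_def)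
  have r: "r \<ge> 1" using p by (simp add: r_def)
  have IH: "a \<le> 2 * B * m * V powr r"
    unfolding a_def S_def V_def r_def B_def
    by (rule insert.IH) (use insert.prems indep_vars_subset[OF insert.prems(1), of I] in auto)
  have Lp: "in_Lp M p (X i)" "in_Lp M p S"
    using insert.prems(2) in_Lp_sum[of p I M X] p insert.hyps by (auto simp: S_def)
  then have [measurable]: "X i \<in> borel_measurable M" "S \<in> borel_measurable M"
    and int: "integrable M (\<lambda>\<omega>. \<bar>X i \<omega>\<bar> powr p)" "integrable M (\<lambda>\<omega>. \<bar>S \<omega>\<bar> powr p)"
    by (auto simp: in_Lp_def)
  have si: "s i \<ge> 0" and V: "V \<ge> 0" using insert.prems(4) by (auto simp: V_def intro!: sum_nonneg)
  have Xi: "expectation (\<lambda>\<omega>. \<bar>X i \<omega>\<bar> powr p) \<le> m * s i powr r"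
    using insert.prems(5) by (simp add: r_def)
  have "expectation (\<lambda>\<omega>. \<bar>S \<omega> + X i \<omega>\<bar> powr p) \<le> 2 * B * m * T powr r"
  \<comment> \<open>A summand of scale zero vanishes almost surely; it is treated apart because \<open>t\<close> divides by
    \<open>s\<^sub>i\<close>.\<close>
  proof (cases "s i = 0")
    case True
    then have "expectation (\<lambda>\<omega>. \<bar>X i \<omega>\<bar> powr p) = 0"
      using Xi by (intro antisym) auto
    then have "AE \<omega> in M. \<bar>X i \<omega>\<bar> powr p = 0"
      using int(1) by (subst (asm) integral_nonneg_eq_0_iff_AE) auto
    then have "expectation (\<lambda>\<omega>. \<bar>S \<omega> + X i \<omega>\<bar> powr p) = a"
      unfolding a_def by (intro integral_cong_AE) (auto elim!: eventually_mono)
    then show ?thesis using IH True by (simp add: T_def)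
  next
    case False
    with si have si: "s i > 0" by simp
    have T: "T > 0" "T \<ge> s i" using si V by (auto simp: T_def)
    define \<phi> :: "real \<Rightarrow> real" where "\<phi> = (\<lambda>x. sgn x * \<bar>x\<bar> powr (p - 1))"
    have [measurable]: "\<phi> \<in> borel_measurable borel" unfolding \<phi>_def by measurable
    have \<phi>_le: "\<bar>\<phi> x\<bar> \<le> 1 + \<bar>x\<bar> powr p" for x :: real
    proof (cases "\<bar>x\<bar> \<le> 1")
      case True
      then have "\<bar>x\<bar> powr (p - 1) \<le> 1 powr (p - 1)" using p by (intro powr_mono2) auto
      then show ?thesis by (simp add: \<phi>_def abs_mult abs_sgn_eq add_increasing2)
    next
      case False
      then have "\<bar>x\<bar> powr (p - 1) \<le> \<bar>x\<bar> powr p" by (intro powr_mono) auto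
      then show ?thesis by (simp add: \<phi>_def abs_mult abs_sgn_eq)
    qed
    have int_\<phi>: "integrable M (\<lambda>\<omega>. \<phi> (S \<omega>))"
      by (rule Bochner_Integration.integrable_bound[where f = "\<lambda>\<omega>. 1 + \<bar>S \<omega>\<bar> powr p"])
        (use int \<phi>_le in \<open>auto simp: add_nonneg_nonneg\<close>)
    have int_X: "integrable M (X i)" using in_Lp_imp_integrable[OF _ Lp(1)] p by simp
    have "indep_var borel (X i) borel S"
      unfolding S_def by (rule indep_vars_sum) (use insert in auto)
    then have "indep_var borel (id \<circ> X i) borel (\<phi> \<circ> S)"
      by (rule indep_var_compose) auto
    then have indep: "indep_var borel (X i) borel (\<lambda>\<omega>. \<phi> (S \<omega>))" by (simp add: comp_def)
    \<comment> \<open>The first order term of the expansion integrates to zero.\<close>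
    have cross: "expectation (\<lambda>\<omega>. \<phi> (S \<omega>) * X i \<omega>) = 0"
      using indep_var_lebesgue_integral[OF indep int_X int_\<phi>] insert.prems(3) by (simp add: mult.commute)
    have int_cross: "integrable M (\<lambda>\<omega>. \<phi> (S \<omega>) * X i \<omega>)"
      using indep_var_integrable[OF indep int_X int_\<phi>] by (simp add: mult.commute)
    define t where "t = T / s i"
    have t: "t \<ge> 1" using T si by (simp add: t_def)
    have "expectation (\<lambda>\<omega>. \<bar>S \<omega> + X i \<omega>\<bar> powr p)
        \<le> expectation (\<lambda>\<omega>. (1 + 1 / (2 * t)) * \<bar>S \<omega>\<bar> powr p + p * (\<phi> (S \<omega>) * X i \<omega>) + B * t powr (r - 1) * \<bar>X i \<omega>\<bar> powr p)"
    proof (rule integral_mono)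
      show "integrable M (\<lambda>\<omega>. \<bar>S \<omega> + X i \<omega>\<bar> powr p)"
        using in_Lp_add[OF _ Lp(2,1)] p by (simp add: in_Lp_def)
      show "\<bar>S \<omega> + X i \<omega>\<bar> powr p \<le> (1 + 1 / (2 * t)) * \<bar>S \<omega>\<bar> powr p + p * (\<phi> (S \<omega>) * X i \<omega>) + B * t powr (r - 1) * \<bar>X i \<omega>\<bar> powr p" for \<omega>
        using moment_const(2)[OF p t] by (simp add: B_def r_def \<phi>_def)
    qed (use int int_cross in auto)
    also have "\<dots> = (1 + 1 / (2 * t)) * a + B * t powr (r - 1) * expectation (\<lambda>\<omega>. \<bar>X i \<omega>\<bar> powr p)"
      using int int_cross cross by (simp add: a_def)
    also have "\<dots> \<le> (1 + 1 / (2 * t)) * (2 * B * m * V powr r) + B * t powr (r - 1) * (m * s i powr r)"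
      using IH Xi B t by (intro add_mono mult_left_mono) auto
    also have "t powr (r - 1) * s i powr r = s i * T powr (r - 1)"
    proof -
      have "s i powr r = s i powr (r - 1) * s i" using si powr_add[of "s i" "r - 1" 1] by simp
      then show ?thesis using si T by (simp add: t_def powr_divide)
    qed
    then have "B * t powr (r - 1) * (m * s i powr r) = B * m * (s i * T powr (r - 1))" by (simp add: mult_ac)
    also have "(1 + 1 / (2 * t)) * (2 * B * m * V powr r) + B * m * (s i * T powr (r - 1))
        = B * m * (2 * V powr r + s i * (V powr r / T) + s i * T powr (r - 1))"
      using T si by (simp add: t_def field_simps)
    also have "\<dots> \<le> B * m * (2 * (V * T powr (r - 1)) + s i * T powr (r - 1) + s i * T powr (r - 1))"
    proof -
      \<comment> \<open>The old bound is small enough because \<open>V \<le> T\<close> and \<open>r \<ge> 1\<close>.\<close>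
      have VV: "V powr r \<le> V * T powr (r - 1)"
      proof (cases "V = 0")
        case False
        with V have "V > 0" by simp
        then have "V powr r = V * V powr (r - 1)" using powr_add[of V 1 "r - 1"] by simp
        also have "\<dots> \<le> V * T powr (r - 1)"
          using \<open>V > 0\<close> si r by (intro mult_left_mono powr_mono2) (auto simp: T_def)
        finally show ?thesis .
      qed simp
      moreover have "V * T powr (r - 1) \<le> T * T powr (r - 1)"
        using si by (intro mult_right_mono) (auto simp: T_def)
      ultimately have "V powr r \<le> T * T powr (r - 1)" by (rule order.trans)
      then have "V powr r / T \<le> T powr (r - 1)" using T by (simp add: divide_le_eq mult.commute)
      with VV show ?thesis using B \<open>m \<ge> 0\<close> si by (intro mult_left_mono add_mono) auto
    qed
    also have "\<dots> = 2 * B * m * (T * T powr (r - 1))" by (simp add: T_def algebra_simps)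
    also have "T * T powr (r - 1) = T powr r" using T powr_add[of T 1 "r - 1"] by simp
    finally show ?thesis .
  qed
  then show ?case
    using insert.hyps by (simp add: S_def T_def V_def r_def B_def add.commute)
qed


section \<open>Freezing one of two independent variables\<close>

lemma distr_pair_indep_rv:
  assumes "prob_space P" "indep_rv P S U T V"
  shows "distr P (S \<Otimes>\<^sub>M T) (\<lambda>\<omega>. (U \<omega>, V \<omega>)) = distr P S U \<Otimes>\<^sub>M distr P T V"
proof -
  interpret prob_space P by fact
  have [measurable]: "U \<in> measurable P S" "V \<in> measurable P T"
    and ind: "indep_set (sets (vimage_algebra (space P) U S)) (sets (vimage_algebra (space P) V T))"
    using assms(2) by (auto simp: indep_rv_def)
  interpret U: prob_space "distr P S U" by (rule prob_space_distr) simp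
  interpret V: prob_space "distr P T V" by (rule prob_space_distr) simp
  show ?thesis
  proof (rule pair_measure_eqI[symmetric])
    show "sigma_finite_measure (distr P S U)" "sigma_finite_measure (distr P T V)"
      by unfold_locales
    show "sets (distr P S U \<Otimes>\<^sub>M distr P T V) = sets (distr P (S \<Otimes>\<^sub>M T) (\<lambda>\<omega>. (U \<omega>, V \<omega>)))"
      by (simp cong: sets_pair_measure_cong)
    fix A B assume "A \<in> sets (distr P S U)" "B \<in> sets (distr P T V)"
    then have [measurable]: "A \<in> sets S" "B \<in> sets T" by auto
    have "prob (U -` A \<inter> space P \<inter> (V -` B \<inter> space P)) = prob (U -` A \<inter> space P) * prob (V -` B \<inter> space P)"
      by (rule indep_setD[OF ind]) (auto simp: in_vimage_algebra)
    moreover have "U -` A \<inter> space P \<inter> (V -` B \<inter> space P) = (\<lambda>\<omega>. (U \<omega>, V \<omega>)) -` (A \<times> B) \<inter> space P" by auto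
    ultimately show "emeasure (distr P S U) A * emeasure (distr P T V) B
        = emeasure (distr P (S \<Otimes>\<^sub>M T) (\<lambda>\<omega>. (U \<omega>, V \<omega>))) (A \<times> B)"
      by (simp add: emeasure_distr emeasure_eq_measure ennreal_mult)
  qed
qed

text \<open>Tonelli's theorem on the original probability space: the outer variable is drawn with an
  independent copy \<open>\<omega>'\<close> of the randomness, and inside it is a constant.\<close>

lemma nn_integral_freeze:
  assumes "prob_space P" "indep_rv P S U T V" and [measurable]: "\<Psi> \<in> borel_measurable (S \<Otimes>\<^sub>M T)"
  shows "(\<integral>\<^sup>+\<omega>. \<Psi> (U \<omega>, V \<omega>) \<partial>P) = (\<integral>\<^sup>+\<omega>'. (\<integral>\<^sup>+\<omega>. \<Psi> (U \<omega>', V \<omega>) \<partial>P) \<partial>P)"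
proof -
  interpret prob_space P by fact
  have [measurable]: "U \<in> measurable P S" "V \<in> measurable P T"
    using assms(2) by (auto simp: indep_rv_def)
  interpret V: prob_space "distr P T V" by (rule prob_space_distr) simp
  have "(\<integral>\<^sup>+\<omega>. \<Psi> (U \<omega>, V \<omega>) \<partial>P) = (\<integral>\<^sup>+z. \<Psi> z \<partial>(distr P S U \<Otimes>\<^sub>M distr P T V))"
    by (simp add: nn_integral_distr flip: distr_pair_indep_rv[OF assms(1,2)])
  also have "\<dots> = (\<integral>\<^sup>+u. (\<integral>\<^sup>+v. \<Psi> (u, v) \<partial>distr P T V) \<partial>distr P S U)"
    by (rule V.nn_integral_fst[symmetric]) simp
  also have "\<dots> = (\<integral>\<^sup>+\<omega>'. (\<integral>\<^sup>+\<omega>. \<Psi> (U \<omega>', V \<omega>) \<partial>P) \<partial>P)"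
    by (subst nn_integral_distr, measurable)
      (auto intro!: nn_integral_cong nn_integral_distr simp: space_pair_measure measurable_space[OF \<open>U \<in> measurable P S\<close>])
  finally show ?thesis .
qed

lemma indep_rv_commute:
  assumes "prob_space P" "indep_rv P S U T V"
  shows "indep_rv P T V S U"
proof -
  interpret prob_space P by fact
  have ind: "indep_set (sets (vimage_algebra (space P) U S)) (sets (vimage_algebra (space P) V T))"
    using assms(2) by (simp add: indep_rv_def)
  have "indep_set (sets (vimage_algebra (space P) V T)) (sets (vimage_algebra (space P) U S))"
    by (rule indep_setI[OF indep_setD_ev2[OF ind] indep_setD_ev1[OF ind]])
      (metis Int_commute indep_setD[OF ind] mult.commute)
  then show ?thesis using assms(2) by (simp add: indep_rv_def)
qed

lemma integral_freeze:
  fixes \<Psi> :: "_ \<Rightarrow> real"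
  assumes "prob_space P" "indep_rv P S U T V" and [measurable]: "\<Psi> \<in> borel_measurable (S \<Otimes>\<^sub>M T)"
    and int: "integrable P (\<lambda>\<omega>. \<Psi> (U \<omega>, V \<omega>))"
  shows "(\<integral>\<omega>. \<Psi> (U \<omega>, V \<omega>) \<partial>P) = (\<integral>\<omega>'. (\<integral>\<omega>. \<Psi> (U \<omega>', V \<omega>) \<partial>P) \<partial>P)"
    and "integrable P (\<lambda>\<omega>'. \<integral>\<omega>. \<Psi> (U \<omega>', V \<omega>) \<partial>P)"
proof -
  interpret prob_space P by fact
  have [measurable]: "U \<in> measurable P S" "V \<in> measurable P T"
    using assms(2) by (auto simp: indep_rv_def)
  interpret U: prob_space "distr P S U" by (rule prob_space_distr) simp
  interpret V: prob_space "distr P T V" by (rule prob_space_distr) simp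
  interpret UV: pair_sigma_finite "distr P S U" "distr P T V" ..
  have int': "integrable (distr P S U \<Otimes>\<^sub>M distr P T V) \<Psi>"
    using int by (simp add: integrable_distr_eq flip: distr_pair_indep_rv[OF assms(1,2)])
  have inner: "(\<integral>v. \<Psi> (U \<omega>', v) \<partial>distr P T V) = (\<integral>\<omega>. \<Psi> (U \<omega>', V \<omega>) \<partial>P)" if "\<omega>' \<in> space P" for \<omega>'
    using measurable_space[OF \<open>U \<in> measurable P S\<close> that] by (intro integral_distr) auto
  have meas: "(\<lambda>u. \<integral>v. \<Psi> (u, v) \<partial>distr P T V) \<in> borel_measurable S" by measurable
  have "(\<integral>\<omega>. \<Psi> (U \<omega>, V \<omega>) \<partial>P) = (\<integral>z. \<Psi> z \<partial>(distr P S U \<Otimes>\<^sub>M distr P T V))"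
    by (simp add: integral_distr flip: distr_pair_indep_rv[OF assms(1,2)])
  also have "\<dots> = (\<integral>u. (\<integral>v. \<Psi> (u, v) \<partial>distr P T V) \<partial>distr P S U)"
    by (rule UV.integral_fst'[symmetric, OF int'])
  also have "\<dots> = (\<integral>\<omega>'. (\<integral>v. \<Psi> (U \<omega>', v) \<partial>distr P T V) \<partial>P)"
    by (rule integral_distr) (use meas in auto)
  also have "\<dots> = (\<integral>\<omega>'. (\<integral>\<omega>. \<Psi> (U \<omega>', V \<omega>) \<partial>P) \<partial>P)"
    by (intro Bochner_Integration.integral_cong refl inner)
  finally show "(\<integral>\<omega>. \<Psi> (U \<omega>, V \<omega>) \<partial>P) = (\<integral>\<omega>'. (\<integral>\<omega>. \<Psi> (U \<omega>', V \<omega>) \<partial>P) \<partial>P)" .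
  have "integrable (distr P S U) (\<lambda>u. \<integral>v. \<Psi> (u, v) \<partial>distr P T V)"
    by (rule UV.integrable_fst'[OF int'])
  then have "integrable P (\<lambda>\<omega>'. \<integral>v. \<Psi> (U \<omega>', v) \<partial>distr P T V)"
    by (subst (asm) integrable_distr_eq) (use meas in auto)
  then show "integrable P (\<lambda>\<omega>'. \<integral>\<omega>. \<Psi> (U \<omega>', V \<omega>) \<partial>P)"
    by (subst Bochner_Integration.integrable_cong[OF refl inner[symmetric]]) auto
qed

lemma borel_measurable_frozen_expectation:
  fixes F :: "'c::second_countable_topology \<times> 'b::second_countable_topology \<Rightarrow> real"
  assumes "prob_space P" and [measurable]: "\<xi> \<in> borel_measurable P" "F \<in> borel_measurable borel"
  shows "(\<lambda>y. \<integral>\<omega>. F (\<xi> \<omega>, y) \<partial>P) \<in> borel_measurable borel"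
proof -
  interpret prob_space P by fact
  have "F \<in> borel_measurable (borel \<Otimes>\<^sub>M borel)" by (simp add: borel_prod)
  then show ?thesis by measurable
qed

text \<open>The conditional expectation given \<open>Y\<close> of a function of \<open>\<xi>\<close> and \<open>Y\<close> averages over \<open>\<xi>\<close> with
  \<open>Y\<close> frozen: on every event \<open>Y \<in> B\<close> both sides have the same integral, by Fubini's theorem.\<close>

lemma cond_exp_given_freeze:
  fixes F :: "'c::second_countable_topology \<times> 'b::second_countable_topology \<Rightarrow> real"
  assumes P: "prob_space P" and indep: "indep_rv P borel \<xi> borel Y" and F: "F \<in> borel_measurable borel"
    and X: "integrable P X" "AE \<omega> in P. X \<omega> = F (\<xi> \<omega>, Y \<omega>)"
  shows "AE \<omega> in P. cond_exp_given P X Y \<omega> = (\<integral>\<omega>'. F (\<xi> \<omega>', Y \<omega>) \<partial>P)"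
proof -
  interpret prob_space P by fact
  have [measurable]: "\<xi> \<in> borel_measurable P" "Y \<in> borel_measurable P"
    using indep by (auto simp: indep_rv_def)
  have [measurable]: "F \<in> borel_measurable (borel \<Otimes>\<^sub>M borel)" using F by (simp add: borel_prod)
  have sub: "subalgebra P (vimage_algebra (space P) Y borel)"
    unfolding subalgebra_def using measurable_sets[of Y P borel] by (auto simp: sets_vimage_algebra2)
  interpret finite_measure_subalgebra P "vimage_algebra (space P) Y borel"
    by unfold_locales (rule sub)
  define G where "G = (\<lambda>y. \<integral>\<omega>'. F (\<xi> \<omega>', y) \<partial>P)"
  have [measurable]: "G \<in> borel_measurable borel"
    unfolding G_def by (rule borel_measurable_frozen_expectation[OF P _ F]) simp
  have indep': "indep_rv P borel Y borel \<xi>"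
    by (rule indep_rv_commute[OF P indep])
  have intF: "integrable P (\<lambda>\<omega>. F (\<xi> \<omega>, Y \<omega>))"
    using X by (subst integrable_cong_AE[symmetric, of X]) auto
  have "AE \<omega> in P. real_cond_exp P (vimage_algebra (space P) Y borel) X \<omega> = G (Y \<omega>)"
  proof (rule real_cond_exp_charact)
    show "integrable P (\<lambda>\<omega>. G (Y \<omega>))"
      using integral_freeze(2)[OF P indep', of "\<lambda>(y, x). F (x, y)"] intF by (simp add: G_def)
    show "integrable P X" by (rule X)
    show "(\<lambda>\<omega>. G (Y \<omega>)) \<in> borel_measurable (vimage_algebra (space P) Y borel)"
      by (rule measurable_compose[OF measurable_vimage_algebra1]) auto
    fix A assume "A \<in> sets (vimage_algebra (space P) Y borel)"
    then obtain B where [measurable]: "B \<in> sets borel" and A: "A = Y -` B \<inter> space P"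
      by (auto simp: sets_vimage_algebra2)
    have "(\<integral>\<omega>\<in>A. X \<omega> \<partial>P) = (\<integral>\<omega>. indicator B (Y \<omega>) * F (\<xi> \<omega>, Y \<omega>) \<partial>P)"
      unfolding set_lebesgue_integral_def using X
      by (intro integral_cong_AE) (auto simp: A indicator_def elim!: eventually_mono)
    also have "\<dots> = (\<integral>\<omega>'. (\<integral>\<omega>. indicator B (Y \<omega>') * F (\<xi> \<omega>, Y \<omega>') \<partial>P) \<partial>P)"
    proof -
      have "integrable P (\<lambda>\<omega>. indicator B (Y \<omega>) * F (\<xi> \<omega>, Y \<omega>))"
        by (rule Bochner_Integration.integrable_bound[OF intF]) (auto simp: indicator_def)
      then show ?thesis
        using integral_freeze(1)[OF P indep', of "\<lambda>(y, x). indicator B y * F (x, y)"] by simp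
    qed
    also have "\<dots> = (\<integral>\<omega>\<in>A. G (Y \<omega>) \<partial>P)"
      unfolding set_lebesgue_integral_def
      by (intro Bochner_Integration.integral_cong) (auto simp: A G_def indicator_def)
    finally show "(\<integral>\<omega>\<in>A. X \<omega> \<partial>P) = (\<integral>\<omega>\<in>A. G (Y \<omega>) \<partial>P)" .
  qed
  then show ?thesis by (simp add: cond_exp_given_def G_def)
qed


section \<open>The nested Monte Carlo family\<close>

lemma Lp_norm_pow_mono_AE:
  assumes "AE \<omega> in P. \<bar>U \<omega>\<bar> \<le> c * \<bar>V \<omega>\<bar>" "c \<ge> 0" "p \<ge> 0" and [measurable]: "V \<in> borel_measurable P"
  shows "Lp_norm_pow P p U \<le> ennreal (c powr p) * Lp_norm_pow P p V"
proof -
  have "Lp_norm_pow P p U \<le> (\<integral>\<^sup>+\<omega>. ennreal (c powr p) * ennreal (\<bar>V \<omega>\<bar> powr p) \<partial>P)"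
    unfolding Lp_norm_pow_def
  proof (rule nn_integral_mono_AE)
    show "AE \<omega> in P. ennreal (\<bar>U \<omega>\<bar> powr p) \<le> ennreal (c powr p) * ennreal (\<bar>V \<omega>\<bar> powr p)"
      using assms(1)
    proof eventually_elim
      case (elim \<omega>)
      then have "\<bar>U \<omega>\<bar> powr p \<le> (c * \<bar>V \<omega>\<bar>) powr p" using assms by (intro powr_mono2) auto
      then show ?case using assms by (simp add: powr_mult flip: ennreal_mult)
    qed
  qed
  also have "\<dots> = ennreal (c powr p) * Lp_norm_pow P p V"
    unfolding Lp_norm_pow_def by (rule nn_integral_cmult) simp
  finally show ?thesis .
qed

locale nested_setting = prob_space P for P :: "'a measure" +
  fixes f :: "real \<Rightarrow> real"
    and F :: "'c::second_countable_topology \<times> 'b::second_countable_topology \<Rightarrow> real"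
    and X :: "'a \<Rightarrow> real" and Y :: "'a \<Rightarrow> 'b" and \<xi> :: "'a \<Rightarrow> 'c" and \<xi>s :: "nat \<Rightarrow> 'a \<Rightarrow> 'c"
    and L :: real
  assumes F_measurable: "F \<in> borel_measurable borel"
    and X_eq: "AE \<omega> in P. X \<omega> = F (\<xi> \<omega>, Y \<omega>)"
    and indep_\<xi>_Y: "indep_rv P borel \<xi> borel Y"
    and inner: "inner_samples P \<xi> Y \<xi>s"
    and Lipschitz: "L-lipschitz_on UNIV f"
    and X_integrable: "integrable P X"
begin

abbreviation Z :: "real \<Rightarrow> 'a \<Rightarrow> real" where "Z \<equiv> nested P f F X Y \<xi>s"

text \<open>A regular version of \<open>E[X | Y = y]\<close>.\<close>

definition G :: "'b \<Rightarrow> real" where "G y = expectation (\<lambda>\<omega>. F (\<xi> \<omega>, y))"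

lemma measurable_data [measurable]:
  "\<xi> \<in> borel_measurable P" "Y \<in> borel_measurable P" "F \<in> borel_measurable (borel \<Otimes>\<^sub>M borel)"
  "G \<in> borel_measurable borel"
proof -
  show "\<xi> \<in> borel_measurable P" "Y \<in> borel_measurable P"
    using indep_\<xi>_Y by (auto simp: indep_rv_def)
  then show "G \<in> borel_measurable borel"
    unfolding G_def using borel_measurable_frozen_expectation[OF prob_space_axioms _ F_measurable] by simp
  show "F \<in> borel_measurable (borel \<Otimes>\<^sub>M borel)" using F_measurable by (simp add: borel_prod)
qed

lemma measurable_inner_sample [measurable (raw)]: "k \<ge> 1 \<Longrightarrow> \<xi>s k \<in> borel_measurable P"
  using inner by (auto simp: inner_samples_def indep_vars_def)

lemma distr_inner_sample: "k \<ge> 1 \<Longrightarrow> distr P borel (\<xi>s k) = distr P borel \<xi>"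
  using inner by (simp add: inner_samples_def)

lemma f_measurable [measurable]: "f \<in> borel_measurable borel"
  using lipschitz_on_continuous_on[OF Lipschitz] by (rule borel_measurable_continuous_onI)

lemma L_nonneg: "L \<ge> 0" and f_diff_le: "\<bar>f u - f v\<bar> \<le> L * \<bar>u - v\<bar>"
  using Lipschitz lipschitz_onD[OF Lipschitz, of u v] by (auto simp: lipschitz_on_def dist_real_def)

lemma Z_zero: "AE \<omega> in P. Z 0 \<omega> = f (G (Y \<omega>))"
  using cond_exp_given_freeze[OF prob_space_axioms indep_\<xi>_Y F_measurable X_integrable X_eq]
  by (auto simp: nested_zero G_def)

definition deviation :: "nat \<Rightarrow> 'a \<Rightarrow> real" where
  "deviation k \<omega> = F (\<xi>s k \<omega>, Y \<omega>) - G (Y \<omega>)"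

lemma deviation_measurable: "k \<ge> 1 \<Longrightarrow> deviation k \<in> borel_measurable P"
  unfolding deviation_def by measurable

text \<open>For fixed \<open>y\<close> the variables \<open>F(\<xi>\<^sub>k, y) - G y\<close> are independent, centred and equal in law, so
  the moment inequality applies with scales \<open>a\<^sub>k\<^sup>2\<close>.\<close>

lemma frozen_sum_moment_bound:
  assumes p: "p \<ge> 2" and A: "finite A" "A \<subseteq> {1..}"
    and y: "in_Lp P p (\<lambda>\<omega>. F (\<xi> \<omega>, y))"
  shows "Lp_norm_pow P p (\<lambda>\<omega>. \<Sum>k\<in>A. a k * (F (\<xi>s k \<omega>, y) - G y))
    \<le> ennreal (4 * 2 powr p * moment_const p * (\<Sum>k\<in>A. (a k)\<^sup>2) powr (p / 2))
        * Lp_norm_pow P p (\<lambda>\<omega>. F (\<xi> \<omega>, y))"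
proof -
  define m where "m = 2 * 2 powr p * expectation (\<lambda>\<omega>. \<bar>F (\<xi> \<omega>, y)\<bar> powr p)"
  have m: "m \<ge> 0" by (simp add: m_def)
  define D where "D = (\<lambda>k \<omega>. F (\<xi>s k \<omega>, y) - G y)"
  have Lp0: "in_Lp P p (\<lambda>\<omega>. F (\<xi> \<omega>, y) - G y)"
    using in_Lp_diff[OF _ y in_Lp_const[OF prob_space_axioms]] p by simp
  have int0: "integrable P (\<lambda>\<omega>. F (\<xi> \<omega>, y))" by (rule in_Lp_imp_integrable[OF _ y]) (use p in simp)
  have transfer: "expectation (\<lambda>\<omega>. g (\<xi>s k \<omega>)) = expectation (\<lambda>\<omega>. g (\<xi> \<omega>))"
      "integrable P (\<lambda>\<omega>. g (\<xi>s k \<omega>)) \<longleftrightarrow> integrable P (\<lambda>\<omega>. g (\<xi> \<omega>))"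
    if "k \<ge> 1" and [measurable]: "g \<in> borel_measurable borel" for g :: "'c \<Rightarrow> real" and k
  proof -
    have [measurable]: "\<xi>s k \<in> borel_measurable P" using that(1) by simp
    show "expectation (\<lambda>\<omega>. g (\<xi>s k \<omega>)) = expectation (\<lambda>\<omega>. g (\<xi> \<omega>))"
      using integral_distr[of "\<xi>s k" P borel g] integral_distr[of \<xi> P borel g] distr_inner_sample[OF that(1)] by simp
    show "integrable P (\<lambda>\<omega>. g (\<xi>s k \<omega>)) \<longleftrightarrow> integrable P (\<lambda>\<omega>. g (\<xi> \<omega>))"
      using integrable_distr_eq[of "\<xi>s k" P borel g] integrable_distr_eq[of \<xi> P borel g] distr_inner_sample[OF that(1)] by simp
  qed
  have Lp: "in_Lp P p (D k)" and mean: "expectation (D k) = 0"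
    and mom: "expectation (\<lambda>\<omega>. \<bar>D k \<omega>\<bar> powr p) \<le> m" if "k \<ge> 1" for k
  proof -
    show "in_Lp P p (D k)"
      using Lp0 transfer(2)[OF that, of "\<lambda>x. \<bar>F (x, y) - G y\<bar> powr p"] that by (simp add: in_Lp_def D_def)
    show "expectation (D k) = 0"
      using transfer(1)[OF that, of "\<lambda>x. F (x, y) - G y"] int0 by (simp add: D_def G_def prob_space)
    show "expectation (\<lambda>\<omega>. \<bar>D k \<omega>\<bar> powr p) \<le> m"
      using transfer(1)[OF that, of "\<lambda>x. \<bar>F (x, y) - G y\<bar> powr p"] expectation_centred_powr_le[OF _ y] p
      by (simp add: D_def m_def G_def)
  qed
  have indep: "indep_vars (\<lambda>_. borel) (\<lambda>k \<omega>. a k * D k \<omega>) A"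
  proof -
    have "indep_vars (\<lambda>_. borel) \<xi>s A"
      using inner A(2) by (auto simp: inner_samples_def intro: indep_vars_subset)
    then show ?thesis unfolding D_def
      by (rule indep_vars_compose2[where Y = "\<lambda>k x. a k * (F (x, y) - G y)"]) simp
  qed
  have k: "k \<ge> 1" if "k \<in> A" for k using A(2) that by auto
  have "expectation (\<lambda>\<omega>. \<bar>\<Sum>k\<in>A. a k * D k \<omega>\<bar> powr p) \<le> 2 * moment_const p * m * (\<Sum>k\<in>A. (a k)\<^sup>2) powr (p / 2)"
  proof (rule indep_sum_moment_bound[OF p m A(1) indep])
    fix i assume i: "i \<in> A"
    show "in_Lp P p (\<lambda>\<omega>. a i * D i \<omega>)" by (rule in_Lp_cmult[OF Lp[OF k[OF i]]])
    show "expectation (\<lambda>\<omega>. a i * D i \<omega>) = 0" using mean[OF k[OF i]] by simp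
    have "((a i)\<^sup>2) powr (p / 2) = \<bar>a i\<bar> powr p"
    proof -
      have "(a i)\<^sup>2 = \<bar>a i\<bar> powr 2" by simp
      then show ?thesis by (simp only: powr_powr) simp
    qed
    then show "expectation (\<lambda>\<omega>. \<bar>a i * D i \<omega>\<bar> powr p) \<le> m * ((a i)\<^sup>2) powr (p / 2)"
      using mult_left_mono[OF mom[OF k[OF i]], of "\<bar>a i\<bar> powr p"] by (simp add: abs_mult powr_mult mult.commute)
  qed simp
  moreover have "in_Lp P p (\<lambda>\<omega>. \<Sum>k\<in>A. a k * D k \<omega>)"
    using p A Lp k by (intro in_Lp_sum in_Lp_cmult) auto
  ultimately show ?thesis
    using moment_const(1)[OF p] unfolding D_def
    by (simp add: Lp_norm_pow_eq_integral y m_def mult_ac flip: ennreal_mult)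
qed

text \<open>By independence of \<open>\<xi>\<close> and \<open>Y\<close>, no moment is lost by freezing \<open>Y\<close> and averaging over it
  afterwards.\<close>

lemma nn_integral_Lp_norm_pow_frozen:
  "(\<integral>\<^sup>+\<omega>'. Lp_norm_pow P p (\<lambda>\<omega>. F (\<xi> \<omega>, Y \<omega>')) \<partial>P) = Lp_norm_pow P p X"
proof -
  have "Lp_norm_pow P p X = (\<integral>\<^sup>+\<omega>. ennreal (\<bar>F (\<xi> \<omega>, Y \<omega>)\<bar> powr p) \<partial>P)"
    unfolding Lp_norm_pow_def using X_eq by (intro nn_integral_cong_AE) auto
  also have "\<dots> = (\<integral>\<^sup>+\<omega>'. (\<integral>\<^sup>+\<omega>. ennreal (\<bar>F (\<xi> \<omega>, Y \<omega>')\<bar> powr p) \<partial>P) \<partial>P)"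
    using nn_integral_freeze[OF prob_space_axioms indep_rv_commute[OF prob_space_axioms indep_\<xi>_Y],
      of "\<lambda>(y, x). ennreal (\<bar>F (x, y)\<bar> powr p)"] by simp
  finally show ?thesis by (simp add: Lp_norm_pow_def)
qed

lemma measurable_Lp_norm_pow_frozen:
  "(\<lambda>\<omega>'. Lp_norm_pow P p (\<lambda>\<omega>. F (\<xi> \<omega>, Y \<omega>'))) \<in> borel_measurable P"
  unfolding Lp_norm_pow_def by measurable

lemma AE_frozen_in_Lp:
  assumes "in_Lp P p X"
  shows "AE \<omega>' in P. in_Lp P p (\<lambda>\<omega>. F (\<xi> \<omega>, Y \<omega>'))"
proof -
  have "AE \<omega>' in P. Lp_norm_pow P p (\<lambda>\<omega>. F (\<xi> \<omega>, Y \<omega>')) \<noteq> \<infinity>"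
    using assms nn_integral_Lp_norm_pow_frozen[of p]
    by (intro nn_integral_PInf_AE measurable_Lp_norm_pow_frozen) (auto simp: in_Lp_iff_Lp_norm_pow_finite)
  then show ?thesis by eventually_elim (auto simp: in_Lp_iff_Lp_norm_pow_finite less_top)
qed

lemma G_in_Lp:
  assumes p: "p > 1" and X: "in_Lp P p X"
  shows "in_Lp P p (\<lambda>\<omega>. G (Y \<omega>))"
proof -
  have "Lp_norm_pow P p (\<lambda>\<omega>. G (Y \<omega>)) \<le> (\<integral>\<^sup>+\<omega>'. Lp_norm_pow P p (\<lambda>\<omega>. F (\<xi> \<omega>, Y \<omega>')) \<partial>P)"
    unfolding Lp_norm_pow_def[of P p "\<lambda>\<omega>. G (Y \<omega>)"]
  proof (rule nn_integral_mono_AE)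
    show "AE \<omega>' in P. ennreal (\<bar>G (Y \<omega>')\<bar> powr p) \<le> Lp_norm_pow P p (\<lambda>\<omega>. F (\<xi> \<omega>, Y \<omega>'))"
      using AE_frozen_in_Lp[OF X]
      by eventually_elim (use abs_expectation_powr_le[OF p] in \<open>simp add: Lp_norm_pow_eq_integral G_def ennreal_leI\<close>)
  qed
  also have "\<dots> < \<infinity>" using X by (simp add: nn_integral_Lp_norm_pow_frozen in_Lp_iff_Lp_norm_pow_finite)
  finally show ?thesis by (simp add: in_Lp_iff_Lp_norm_pow_finite)
qed

text \<open>The bound for frozen \<open>y\<close>, integrated over the law of \<open>Y\<close>. Freezing is legitimate because the
  whole sequence of inner samples is independent of \<open>Y\<close>.\<close>

lemma deviation_sum_moment_bound:
  assumes p: "p \<ge> 2" and A: "finite A" "A \<subseteq> {1..}" and X: "in_Lp P p X"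
  shows "Lp_norm_pow P p (\<lambda>\<omega>. \<Sum>k\<in>A. a k * deviation k \<omega>)
    \<le> ennreal (4 * 2 powr p * moment_const p * expectation (\<lambda>\<omega>. \<bar>X \<omega>\<bar> powr p)
        * (\<Sum>k\<in>A. (a k)\<^sup>2) powr (p / 2))"
proof -
  define C where "C = ennreal (4 * 2 powr p * moment_const p * (\<Sum>k\<in>A. (a k)\<^sup>2) powr (p / 2))"
  have "Lp_norm_pow P p (\<lambda>\<omega>. \<Sum>k\<in>A. a k * deviation k \<omega>)
      = (\<integral>\<^sup>+\<omega>'. Lp_norm_pow P p (\<lambda>\<omega>. \<Sum>k\<in>A. a k * (F (\<xi>s k \<omega>, Y \<omega>') - G (Y \<omega>'))) \<partial>P)"
  proof -
    have indep: "indep_rv P borel Y (\<Pi>\<^sub>M k\<in>{1..}. borel) (\<lambda>\<omega>. \<lambda>k\<in>{1..}. \<xi>s k \<omega>)"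
      using inner by (simp add: inner_samples_def)
    have meas_sum: "(\<lambda>u. \<bar>\<Sum>k\<in>A. a k * (F (snd u k, fst u) - G (fst u))\<bar> powr p)
        \<in> borel_measurable (borel \<Otimes>\<^sub>M (\<Pi>\<^sub>M k\<in>{1..}. borel))"
    proof -
      have [measurable]: "(\<lambda>u. snd u k) \<in> borel_measurable ((borel :: 'b measure) \<Otimes>\<^sub>M (\<Pi>\<^sub>M k\<in>{1..}. (borel :: 'c measure)))"
        if "k \<in> A" for k
        using A(2) that by (intro measurable_compose[OF measurable_snd measurable_component_singleton]) auto
      show ?thesis by measurable
    qed
    have sum_eq: "(\<Sum>k\<in>A. a k * (F ((\<lambda>k\<in>{1..}. \<xi>s k \<omega>) k, y) - G y)) = (\<Sum>k\<in>A. a k * (F (\<xi>s k \<omega>, y) - G y))" for \<omega> y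
      using A(2) by (intro sum.cong) auto
    show ?thesis
      using nn_integral_freeze[OF prob_space_axioms indep measurable_compose[OF meas_sum measurable_ennreal]]
      unfolding Lp_norm_pow_def deviation_def fst_conv snd_conv sum_eq .
  qed
  also have "\<dots> \<le> (\<integral>\<^sup>+\<omega>'. C * Lp_norm_pow P p (\<lambda>\<omega>. F (\<xi> \<omega>, Y \<omega>')) \<partial>P)"
    using AE_frozen_in_Lp[OF X] unfolding C_def
    by (intro nn_integral_mono_AE) (auto elim!: eventually_mono intro: frozen_sum_moment_bound[OF p A])
  also have "\<dots> = C * Lp_norm_pow P p X"
    by (simp add: nn_integral_cmult measurable_Lp_norm_pow_frozen nn_integral_Lp_norm_pow_frozen)
  finally show ?thesis
    using moment_const(1)[OF p] by (simp add: C_def Lp_norm_pow_eq_integral X mult_ac flip: ennreal_mult)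
qed

definition increment_const :: "real \<Rightarrow> real" where
  "increment_const p = L powr p * (4 * 2 powr p * moment_const p * expectation (\<lambda>\<omega>. \<bar>X \<omega>\<bar> powr p))"

lemma increment_const_nonneg: "p \<ge> 2 \<Longrightarrow> increment_const p \<ge> 0"
  using moment_const(1) by (simp add: increment_const_def)

lemma Lp_norm_pow_Lipschitz_deviation_le:
  assumes p: "p \<ge> 2" and X: "in_Lp P p X" and A: "finite A" "A \<subseteq> {1..}"
    and U: "AE \<omega> in P. \<bar>U \<omega>\<bar> \<le> L * \<bar>\<Sum>k\<in>A. a k * deviation k \<omega>\<bar>"
  shows "Lp_norm_pow P p U \<le> ennreal (increment_const p * (\<Sum>k\<in>A. (a k)\<^sup>2) powr (p / 2))"
proof -
  have "Lp_norm_pow P p U \<le> ennreal (L powr p) * Lp_norm_pow P p (\<lambda>\<omega>. \<Sum>k\<in>A. a k * deviation k \<omega>)"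
    using p L_nonneg A deviation_measurable
    by (intro Lp_norm_pow_mono_AE U borel_measurable_sum borel_measurable_times) auto
  also have "\<dots> \<le> ennreal (L powr p) * ennreal (4 * 2 powr p * moment_const p * expectation (\<lambda>\<omega>. \<bar>X \<omega>\<bar> powr p)
        * (\<Sum>k\<in>A. (a k)\<^sup>2) powr (p / 2))"
    by (intro mult_left_mono deviation_sum_moment_bound p X A) auto
  finally show ?thesis
    using moment_const(1)[OF p] by (simp add: increment_const_def mult_ac flip: ennreal_mult)
qed

lemma inner_average_eq:
  assumes "K \<ge> 1"
  shows "1 / real K * (\<Sum>k=1..K. F (\<xi>s k \<omega>, Y \<omega>)) = G (Y \<omega>) + (\<Sum>k=1..K. (1 / real K) * deviation k \<omega>)"
  using assms by (simp add: deviation_def sum_subtractf field_simps flip: sum_divide_distrib)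

lemma nested_strong_error:
  assumes p: "p \<ge> 2" and X: "in_Lp P p X" and K: "K \<ge> 1"
  shows "Lp_norm_pow P p (\<lambda>\<omega>. Z (1 / real K) \<omega> - Z 0 \<omega>) \<le> ennreal (increment_const p * (1 / real K) powr (p / 2))"
proof -
  have "AE \<omega> in P. \<bar>Z (1 / real K) \<omega> - Z 0 \<omega>\<bar> \<le> L * \<bar>\<Sum>k=1..K. (1 / real K) * deviation k \<omega>\<bar>"
    using Z_zero
  proof eventually_elim
    case (elim \<omega>)
    show ?case
      using f_diff_le[of "G (Y \<omega>) + (\<Sum>k=1..K. (1 / real K) * deviation k \<omega>)" "G (Y \<omega>)"]
      unfolding elim nested_inverse[OF K] inner_average_eq[OF K] by simp
  qed
  from Lp_norm_pow_Lipschitz_deviation_le[OF p X _ _ this] K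
  show ?thesis by (simp add: power2_eq_square)
qed

text \<open>The deviation weights of the difference of two averages are \<open>1/K' - 1/K\<close> for the \<open>K\<close> common
  samples and \<open>1/K'\<close> for the remaining ones; their squares add up to \<open>1/K - 1/K'\<close>.\<close>

lemma nested_increment_le:
  assumes p: "p \<ge> 2" and X: "in_Lp P p X" and K: "1 \<le> K" "K \<le> K'"
  shows "Lp_norm_pow P p (\<lambda>\<omega>. Z (1 / real K') \<omega> - Z (1 / real K) \<omega>)
    \<le> ennreal (increment_const p * (1 / real K - 1 / real K') powr (p / 2))"
proof -
  define a where "a = (\<lambda>k. if k \<le> K then 1 / real K' - 1 / real K else 1 / real K')"
  have split: "sum g {1..K'} = sum g {1..K} + sum g {K+1..K'}" for g :: "nat \<Rightarrow> real"
  proof -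
    have "{1..K'} = {1..K} \<union> {K+1..K'}" using K by auto
    then show ?thesis by (simp add: sum.union_disjoint)
  qed
  have diff: "(\<Sum>k=1..K'. (1 / real K') * deviation k \<omega>) - (\<Sum>k=1..K. (1 / real K) * deviation k \<omega>)
      = (\<Sum>k=1..K'. a k * deviation k \<omega>)" for \<omega>
  proof -
    have "(\<Sum>k=1..K. a k * deviation k \<omega>) = (\<Sum>k=1..K. (1 / real K') * deviation k \<omega>) - (\<Sum>k=1..K. (1 / real K) * deviation k \<omega>)"
      unfolding sum_subtractf[symmetric] by (intro sum.cong) (auto simp: a_def algebra_simps)
    moreover have "(\<Sum>k=K+1..K'. a k * deviation k \<omega>) = (\<Sum>k=K+1..K'. (1 / real K') * deviation k \<omega>)"
      by (intro sum.cong) (auto simp: a_def)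
    ultimately show ?thesis by (simp only: split)
  qed
  have "AE \<omega> in P. \<bar>Z (1 / real K') \<omega> - Z (1 / real K) \<omega>\<bar> \<le> L * \<bar>\<Sum>k=1..K'. a k * deviation k \<omega>\<bar>"
  proof (rule AE_I2)
    fix \<omega>
    have K': "K' \<ge> 1" using K by simp
    show "\<bar>Z (1 / real K') \<omega> - Z (1 / real K) \<omega>\<bar> \<le> L * \<bar>\<Sum>k=1..K'. a k * deviation k \<omega>\<bar>"
      using f_diff_le[of "G (Y \<omega>) + (\<Sum>k=1..K'. (1 / real K') * deviation k \<omega>)" "G (Y \<omega>) + (\<Sum>k=1..K. (1 / real K) * deviation k \<omega>)"]
      unfolding nested_inverse[OF K(1)] nested_inverse[OF K'] inner_average_eq[OF K(1)] inner_average_eq[OF K'] diff[symmetric] by simp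
  qed
  moreover have "(\<Sum>k=1..K'. (a k)\<^sup>2) = 1 / real K - 1 / real K'"
  proof -
    have "(\<Sum>k=1..K. (a k)\<^sup>2) = real K * (1 / real K' - 1 / real K)\<^sup>2"
      by (simp add: a_def)
    moreover have "(\<Sum>k=K+1..K'. (a k)\<^sup>2) = (real K' - real K) * (1 / real K')\<^sup>2"
      using K by (simp add: a_def of_nat_diff)
    ultimately show ?thesis using K
      by (simp only: split) (simp add: field_simps power2_eq_square)
  qed
  ultimately show ?thesis
    using Lp_norm_pow_Lipschitz_deviation_le[OF p X, of "{1..K'}" _ a] by simp
qed

lemma nested_increment_bound:
  assumes p: "p \<ge> 2" and X: "in_Lp P p X" and K\<^sub>0: "K\<^sub>0 \<ge> 1" and h: "h \<in> levels K\<^sub>0" "h' \<in> levels K\<^sub>0"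
  shows "Lp_norm_pow P p (\<lambda>\<omega>. Z h' \<omega> - Z h \<omega>) \<le> ennreal (increment_const p * \<bar>h' - h\<bar> powr (p / 2))"
proof -
  obtain n n' where n: "n \<ge> 1" "h = 1 / real (K\<^sub>0 * n)" and n': "n' \<ge> 1" "h' = 1 / real (K\<^sub>0 * n')"
    using h by (auto simp: levels_def)
  define K K' where "K = K\<^sub>0 * n" and "K' = K\<^sub>0 * n'"
  have K: "K \<ge> 1" "K' \<ge> 1" using K\<^sub>0 n(1) n'(1) by (auto simp: K_def K'_def Suc_le_eq)
  have hK: "h = 1 / real K" "h' = 1 / real K'" unfolding K_def K'_def n(2) n'(2) by (rule refl)+
  show ?thesis
  proof (cases "K \<le> K'")
    case True
    have "1 / real K' \<le> 1 / real K" using True K by (intro divide_left_mono) auto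
    then have "\<bar>1 / real K' - 1 / real K\<bar> = 1 / real K - 1 / real K'" by linarith
    then show ?thesis unfolding hK using nested_increment_le[OF p X K(1) True] by simp
  next
    case False
    then have le: "K' \<le> K" by simp
    have "1 / real K \<le> 1 / real K'" using le K by (intro divide_left_mono) auto
    then have "\<bar>1 / real K' - 1 / real K\<bar> = 1 / real K' - 1 / real K" by linarith
    then show ?thesis unfolding hK using nested_increment_le[OF p X K(2) le]
      by (simp add: Lp_norm_pow_def abs_minus_commute)
  qed
qed

lemma nested_strong_error_levels:
  assumes p: "p \<ge> 2" and X: "in_Lp P p X" and K\<^sub>0: "K\<^sub>0 \<ge> 1" and h: "h \<in> levels K\<^sub>0"
  shows "Lp_norm_pow P p (\<lambda>\<omega>. Z h \<omega> - Z 0 \<omega>) \<le> ennreal (increment_const p * h powr (p / 2))"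
proof -
  obtain n where n: "n \<ge> 1" "h = 1 / real (K\<^sub>0 * n)" using h by (auto simp: levels_def)
  have "K\<^sub>0 * n \<ge> 1" using K\<^sub>0 n(1) by (simp add: Suc_le_eq)
  from nested_strong_error[OF p X this] show ?thesis unfolding n(2) .
qed

lemma Z_measurable:
  assumes "K\<^sub>0 \<ge> 1" "h \<in> levels K\<^sub>0 \<union> {0}"
  shows "Z h \<in> borel_measurable P"
proof (cases "h = 0")
  case True
  have [measurable]: "cond_exp_given P X Y \<in> borel_measurable P"
    unfolding cond_exp_given_def by simp
  have "Z h = (\<lambda>\<omega>. f (cond_exp_given P X Y \<omega>))" by (simp add: fun_eq_iff True nested_zero)
  then show ?thesis by simp
next
  case False
  then obtain n where n: "n \<ge> 1" "h = 1 / real (K\<^sub>0 * n)" using assms(2) by (auto simp: levels_def)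
  define K where "K = K\<^sub>0 * n"
  have K: "K \<ge> 1" using assms(1) n(1) by (simp add: K_def Suc_le_eq)
  have hK: "h = 1 / real K" unfolding K_def n(2) by (rule refl)
  have "(\<lambda>\<omega>. f (1 / real K * (\<Sum>k=1..K. F (\<xi>s k \<omega>, Y \<omega>)))) \<in> borel_measurable P"
    by measurable
  then show ?thesis unfolding hK by (simp only: nested_inverse[OF K, abs_def])
qed

text \<open>A Lipschitz function grows at most linearly, so \<open>f(G(Y))\<close> inherits the integrability of
  \<open>G(Y)\<close>.\<close>

lemma Z_zero_in_Lp:
  assumes p: "p \<ge> 2" and X: "in_Lp P p X"
  shows "in_Lp P p (Z 0)"
proof -
  have Lp: "in_Lp P p (\<lambda>\<omega>. \<bar>f 0\<bar> + L * \<bar>G (Y \<omega>)\<bar>)"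
  proof (intro in_Lp_add in_Lp_cmult)
    show "in_Lp P p (\<lambda>\<omega>. \<bar>G (Y \<omega>)\<bar>)" using G_in_Lp[OF _ X] p by (simp add: in_Lp_def)
  qed (use p in_Lp_const[OF prob_space_axioms] in auto)
  have "AE \<omega> in P. \<bar>Z 0 \<omega>\<bar> \<le> 1 * \<bar>\<bar>f 0\<bar> + L * \<bar>G (Y \<omega>)\<bar>\<bar>"
    using Z_zero
  proof eventually_elim
    case (elim \<omega>)
    show ?case using f_diff_le[of "G (Y \<omega>)" 0] L_nonneg unfolding elim by simp
  qed
  from Lp_norm_pow_mono_AE[OF this, of p] Lp p
  have "Lp_norm_pow P p (Z 0) < \<infinity>"
    by (auto simp: in_Lp_iff_Lp_norm_pow_finite intro: le_less_trans)
  moreover have "Z 0 \<in> borel_measurable P" by (rule Z_measurable[of 1]) auto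
  ultimately show ?thesis by (simp add: in_Lp_iff_Lp_norm_pow_finite)
qed

end


section \<open>Vandermonde weights for geometric nodes\<close>

text \<open>The value at \<open>0\<close> of the Lagrange basis polynomial attached to the node \<open>x r\<close>.\<close>

definition Lagrange_weight :: "('i \<Rightarrow> real) \<Rightarrow> 'i set \<Rightarrow> 'i \<Rightarrow> real" where
  "Lagrange_weight x S r = (\<Prod>s\<in>S - {r}. x s / (x s - x r))"

lemma Lagrange_basis_polynomial:
  fixes x :: "'i \<Rightarrow> real"
  assumes "finite S" "inj_on x S" "r \<in> S"
  obtains q where "degree q < card S" "poly q (x r) = 1" "\<And>s. s \<in> S \<Longrightarrow> s \<noteq> r \<Longrightarrow> poly q (x s) = 0"
    "poly q 0 = Lagrange_weight x S r"
proof -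
  define q where "q = (\<Prod>s\<in>S - {r}. [: x s / (x s - x r), - 1 / (x s - x r) :])"
  have ne: "x s - x r \<noteq> 0" if "s \<in> S - {r}" for s
    using that assms(2,3) by (auto simp: inj_on_def)
  have eval: "poly q u = (\<Prod>s\<in>S - {r}. (x s - u) / (x s - x r))" for u
    by (simp add: q_def poly_prod diff_divide_distrib)
  have "degree q \<le> (\<Sum>s\<in>S - {r}. degree [: x s / (x s - x r), - 1 / (x s - x r) :])"
    unfolding q_def using assms(1) by (intro order.trans[OF degree_prod_sum_le]) (auto simp: comp_def)
  also have "\<dots> \<le> (\<Sum>s\<in>S - {r}. 1)" by (intro sum_mono) auto
  also have "\<dots> < card S" using assms card_Diff1_less[OF assms(1,3)] by simp
  finally have deg: "degree q < card S" .
  have one: "poly q (x r) = 1" unfolding eval using ne by (intro prod.neutral) auto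
  have zero: "poly q (x s) = 0" if "s \<in> S" "s \<noteq> r" for s
    unfolding eval using that assms(1) by (intro prod_zero) auto
  show ?thesis
    by (rule that[OF deg one zero]) (simp_all add: eval Lagrange_weight_def)
qed

text \<open>Interpolating the monomial of degree \<open>i < card S\<close> at the nodes reproduces it; evaluate the
  interpolation polynomial at \<open>0\<close>.\<close>

lemma sum_Lagrange_weight_power:
  fixes x :: "'i \<Rightarrow> real"
  assumes S: "finite S" "inj_on x S" and i: "i < card S"
  shows "(\<Sum>r\<in>S. Lagrange_weight x S r * x r ^ i) = 0 ^ i"
proof -
  have "\<forall>r\<in>S. \<exists>q. degree q < card S \<and> poly q (x r) = 1 \<and> (\<forall>s\<in>S. s \<noteq> r \<longrightarrow> poly q (x s) = 0)
    \<and> poly q 0 = Lagrange_weight x S r"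
    using Lagrange_basis_polynomial[OF S] by metis
  then obtain q where q: "\<And>r. r \<in> S \<Longrightarrow> degree (q r) < card S" "\<And>r. r \<in> S \<Longrightarrow> poly (q r) (x r) = 1"
    "\<And>r s. r \<in> S \<Longrightarrow> s \<in> S \<Longrightarrow> s \<noteq> r \<Longrightarrow> poly (q r) (x s) = 0"
    "\<And>r. r \<in> S \<Longrightarrow> poly (q r) 0 = Lagrange_weight x S r"
    by metis
  define Q where "Q = (\<Sum>r\<in>S. smult (x r ^ i) (q r))"
  have "Q = monom 1 i"
  proof (rule poly_eqI_degree[where A = "x ` S"])
    fix u assume "u \<in> x ` S"
    then obtain s where s: "s \<in> S" "u = x s" by auto
    have "poly Q u = (\<Sum>r\<in>S. if r = s then x s ^ i else 0)"
      unfolding Q_def poly_sum s(2) using q s by (intro sum.cong) auto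
    also have "\<dots> = poly (monom 1 i) u" using s S by (simp add: poly_monom)
    finally show "poly Q u = poly (monom 1 i) u" .
  next
    have card: "card (x ` S) = card S" using S by (simp add: card_image)
    have "degree Q < card S"
      unfolding Q_def
      by (rule degree_sum_less) (use q(1) i in \<open>auto intro: le_less_trans[OF degree_smult_le]\<close>)
    then show "degree Q < card (x ` S)" by (simp add: card)
    show "degree (monom (1::real) i) < card (x ` S)" using i by (simp add: card degree_monom_eq)
  qed
  then have "poly Q 0 = 0 ^ i" by (simp add: poly_monom)
  then show ?thesis using q(4) by (simp add: Q_def poly_sum mult.commute)
qed

text \<open>The equations say that the functional \<open>\<Sum> w\<^sub>s q(x\<^sub>s)\<close> is evaluation at \<open>0\<close> for every polynomial
  \<open>q\<close> of degree below \<open>card S\<close>. Applied to a Lagrange basis polynomial it returns a single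
  weight.\<close>

lemma Vandermonde_solution_unique:
  fixes x :: "'i \<Rightarrow> real"
  assumes S: "finite S" "inj_on x S" and w: "\<And>i. i < card S \<Longrightarrow> (\<Sum>r\<in>S. w r * x r ^ i) = 0 ^ i" and r: "r \<in> S"
  shows "w r = Lagrange_weight x S r"
proof -
  obtain q where q: "degree q < card S" "poly q (x r) = 1" "\<And>s. s \<in> S \<Longrightarrow> s \<noteq> r \<Longrightarrow> poly q (x s) = 0"
    "poly q 0 = Lagrange_weight x S r"
    using Lagrange_basis_polynomial[OF S r] by blast
  have "w r = (\<Sum>s\<in>S. if s = r then w s else 0)" using S r by simp
  also have "\<dots> = (\<Sum>s\<in>S. w s * poly q (x s))"
    using q by (intro sum.cong) auto
  also have "\<dots> = (\<Sum>i\<le>degree q. coeff q i * (\<Sum>s\<in>S. w s * x s ^ i))"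
    unfolding poly_altdef sum_distrib_left by (subst sum.swap) (simp add: mult_ac)
  also have "\<dots> = (\<Sum>i\<le>degree q. coeff q i * 0 ^ i)"
    using q(1) w by (intro sum.cong) auto
  also have "\<dots> = poly q 0" by (simp add: poly_altdef)
  finally show ?thesis using q(4) by simp
qed

lemma refiner_powr:
  assumes "M \<ge> 2"
  shows "real (refiner M r) powr (- \<alpha> * real i) = ((real M powr (- \<alpha>)) ^ (r - 1)) ^ i"
proof -
  have M: "real M > 0" using assms by simp
  have "real (refiner M r) powr (- \<alpha> * real i) = (real M powr real (r - 1)) powr (- \<alpha> * real i)"
    using M by (simp add: refiner_def powr_realpow)
  also have "\<dots> = real M powr (- \<alpha> * real (r - 1) * real i)"
    by (simp only: powr_powr) (simp add: mult_ac)
  also have "\<dots> = ((real M powr (- \<alpha>)) ^ (r - 1)) ^ i"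
    using M by (simp add: powr_powr mult_ac flip: powr_realpow)
  finally show ?thesis .
qed

lemma powr_neg_less_1: "M \<ge> 2 \<Longrightarrow> \<alpha> > 0 \<Longrightarrow> real M powr (- \<alpha>) < 1"
  using powr_less_mono[of "- \<alpha>" 0 "real M"] by simp

lemma inj_on_geometric_nodes:
  assumes "M \<ge> 2" "\<alpha> > 0"
  shows "inj_on (\<lambda>r. (real M powr (- \<alpha>)) ^ (r - 1)) {1..R}"
proof (rule inj_onI)
  fix r s assume *: "r \<in> {1..R}" "s \<in> {1..R}" "(real M powr (- \<alpha>)) ^ (r - 1) = (real M powr (- \<alpha>)) ^ (s - 1)"
  have "r - 1 = s - 1"
    using *(3) power_inject_exp'[of "real M powr (- \<alpha>)" "r - 1" "s - 1"] powr_neg_less_1[OF assms] assms by auto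
  then show "r = s" using * by auto
qed

lemma ml2r_w_eq:
  assumes M: "M \<ge> 2" and \<alpha>: "\<alpha> > 0" and R: "R \<ge> 1"
  defines "x \<equiv> \<lambda>r. (real M powr (- \<alpha>)) ^ (r - 1)"
  shows "ml2r_w \<alpha> M R = (\<lambda>r. if r \<in> {1..R} then Lagrange_weight x {1..R} r else 0)"
  unfolding ml2r_w_def
proof (rule the_equality)
  have inj: "inj_on x {1..R}" unfolding x_def by (rule inj_on_geometric_nodes[OF M \<alpha>])
  have system: "(\<Sum>r=1..R. w r) = 1 \<and> (\<forall>i\<in>{1..R-1}. (\<Sum>r=1..R. w r * real (refiner M r) powr (- \<alpha> * real i)) = 0)
    \<longleftrightarrow> (\<forall>i<R. (\<Sum>r=1..R. w r * x r ^ i) = 0 ^ i)" for w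
  proof -
    have "(\<forall>i<R. (\<Sum>r=1..R. w r * x r ^ i) = 0 ^ i) \<longleftrightarrow>
        (\<Sum>r=1..R. w r * x r ^ 0) = 0 ^ 0 \<and> (\<forall>i\<in>{1..R-1}. (\<Sum>r=1..R. w r * x r ^ i) = 0 ^ i)"
    proof -
      have "{..<R} = insert 0 {1..R-1}" using R by auto
      then have "(\<forall>i<R. Q i) \<longleftrightarrow> Q 0 \<and> (\<forall>i\<in>{1..R-1}. Q i)" for Q
        by (metis insert_iff lessThan_iff)
      then show ?thesis .
    qed
    then show ?thesis unfolding refiner_powr[OF M] x_def by auto
  qed
  let ?w = "\<lambda>r. if r \<in> {1..R} then Lagrange_weight x {1..R} r else 0"
  have "\<forall>i<R. (\<Sum>r=1..R. ?w r * x r ^ i) = 0 ^ i"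
    using sum_Lagrange_weight_power[OF _ inj] by simp
  then show "(\<forall>r. r \<notin> {1..R} \<longrightarrow> ?w r = 0) \<and> (\<Sum>r=1..R. ?w r) = 1
      \<and> (\<forall>i\<in>{1..R-1}. (\<Sum>r=1..R. ?w r * real (refiner M r) powr (- \<alpha> * real i)) = 0)"
    using system[of ?w] by auto
  fix w assume w: "(\<forall>r. r \<notin> {1..R} \<longrightarrow> w r = 0) \<and> (\<Sum>r=1..R. w r) = 1
      \<and> (\<forall>i\<in>{1..R-1}. (\<Sum>r=1..R. w r * real (refiner M r) powr (- \<alpha> * real i)) = 0)"
  then have "\<forall>i<R. (\<Sum>r=1..R. w r * x r ^ i) = 0 ^ i" using system[of w] by blast
  then have "w r = Lagrange_weight x {1..R} r" if "r \<in> {1..R}" for r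
    by (intro Vandermonde_solution_unique[OF _ inj _ that]) auto
  then show "w = ?w" using w by auto
qed

lemma sum_ml2r_w:
  assumes "M \<ge> 2" "\<alpha> > 0" "R \<ge> 1"
  shows "(\<Sum>r=1..R. ml2r_w \<alpha> M R r) = 1"
proof -
  show ?thesis
    using sum_Lagrange_weight_power[OF _ inj_on_geometric_nodes[OF assms(1,2)], of R 0] assms(3) by (simp add: ml2r_w_eq[OF assms])
qed

text \<open>A bound on the partial products of \<open>1 / (1 - y\<^sup>j)\<close> that is uniform in the index set, by
  comparison with a geometric series in the exponent.\<close>

lemma prod_inverse_one_minus_power_le:
  fixes y :: real
  assumes y: "0 < y" "y < 1" and J: "finite J" "J \<subseteq> {1..}"
  shows "(\<Prod>j\<in>J. 1 / (1 - y ^ j)) \<le> exp (1 / (1 - y)\<^sup>2)"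
proof -
  have "(\<Prod>j\<in>J. 1 / (1 - y ^ j)) \<le> (\<Prod>j\<in>J. exp (y ^ j / (1 - y)))"
  proof (rule prod_mono)
    fix j assume "j \<in> J"
    then have "y ^ j \<le> y ^ 1" using J y by (intro power_decreasing) auto
    then have yj: "y ^ j \<le> y" by simp
    then have pos: "1 - y ^ j > 0" using y by simp
    have "1 / (1 - y ^ j) = 1 + y ^ j / (1 - y ^ j)" using pos by (simp add: field_simps)
    also have "\<dots> \<le> 1 + y ^ j / (1 - y)" using yj y by (intro add_left_mono divide_left_mono) auto
    also have "\<dots> \<le> exp (y ^ j / (1 - y))" by (rule exp_ge_add_one_self)
    finally show "0 \<le> 1 / (1 - y ^ j) \<and> 1 / (1 - y ^ j) \<le> exp (y ^ j / (1 - y))" using pos by simp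
  qed
  also have "\<dots> = exp ((\<Sum>j\<in>J. y ^ j) / (1 - y))"
    using J by (simp add: exp_sum sum_divide_distrib)
  also have "(\<Sum>j\<in>J. y ^ j) \<le> 1 / (1 - y)"
    using sum_le_suminf[OF summable_geometric, of y J] suminf_geometric[of y] y J by simp
  then have "exp ((\<Sum>j\<in>J. y ^ j) / (1 - y)) \<le> exp (1 / (1 - y)\<^sup>2)"
    using y by (simp add: power2_eq_square divide_right_mono flip: divide_divide_eq_left)
  finally show ?thesis .
qed

text \<open>The factors of the Lagrange weight with \<open>s < r\<close> are \<open>1 / (1 - y ^ (r - s))\<close>, with bounded
  product. Those with \<open>s > r\<close> carry an additional \<open>y ^ (s - r)\<close>, and already the one with
  \<open>s = R\<close> yields the decay.\<close>

lemma abs_ml2r_w_le: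
  assumes M: "M \<ge> 2" and \<alpha>: "\<alpha> > 0" and r: "r \<in> {1..R}"
  defines "y \<equiv> real M powr (- \<alpha>)"
  shows "\<bar>ml2r_w \<alpha> M R r\<bar> \<le> (exp (1 / (1 - y)\<^sup>2))\<^sup>2 * y ^ (R - r)"
proof -
  define E where "E = exp (1 / (1 - y)\<^sup>2)"
  have y: "0 < y" "y < 1" using M powr_neg_less_1[OF M \<alpha>] by (auto simp: y_def)
  have E: "E > 0" by (simp add: E_def)
  have pow_less: "y ^ n < 1" if "n \<ge> 1" for n
    using y that by (simp add: power_Suc_less_one power_less_one_iff)
  have coarse: "(\<Prod>s\<in>{1..<r}. \<bar>y ^ (s - 1) / (y ^ (s - 1) - y ^ (r - 1))\<bar>) \<le> E"
  proof -
    have "(\<Prod>s\<in>{1..<r}. \<bar>y ^ (s - 1) / (y ^ (s - 1) - y ^ (r - 1))\<bar>) = (\<Prod>s\<in>{1..<r}. 1 / (1 - y ^ (r - s)))"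
    proof (rule prod.cong[OF refl])
      fix s assume s: "s \<in> {1..<r}"
      have "y ^ (r - 1) = y ^ (s - 1) * y ^ (r - s)" using s by (simp flip: power_add)
      then have "y ^ (s - 1) - y ^ (r - 1) = y ^ (s - 1) * (1 - y ^ (r - s))" by (simp add: algebra_simps)
      then show "\<bar>y ^ (s - 1) / (y ^ (s - 1) - y ^ (r - 1))\<bar> = 1 / (1 - y ^ (r - s))"
        using y less_imp_le[OF pow_less[of "r - s"]] s by (auto simp: abs_mult)
    qed
    also have "\<dots> = (\<Prod>j\<in>(\<lambda>s. r - s) ` {1..<r}. 1 / (1 - y ^ j))"
      by (subst prod.reindex) (auto simp: inj_on_def)
    also have "\<dots> \<le> E" unfolding E_def by (rule prod_inverse_one_minus_power_le[OF y]) auto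
    finally show ?thesis .
  qed
  have fine: "(\<Prod>s\<in>{r<..R}. \<bar>y ^ (s - 1) / (y ^ (s - 1) - y ^ (r - 1))\<bar>) \<le> y ^ (R - r) * E"
  proof -
    have "(\<Prod>s\<in>{r<..R}. \<bar>y ^ (s - 1) / (y ^ (s - 1) - y ^ (r - 1))\<bar>) = (\<Prod>s\<in>{r<..R}. y ^ (s - r) * (1 / (1 - y ^ (s - r))))"
    proof (rule prod.cong[OF refl])
      fix s assume s: "s \<in> {r<..R}"
      have "y ^ (s - 1) = y ^ (r - 1) * y ^ (s - r)" using s r by (simp flip: power_add)
      then have "y ^ (s - 1) - y ^ (r - 1) = - (y ^ (r - 1) * (1 - y ^ (s - r)))"
         "y ^ (s - 1) = y ^ (r - 1) * y ^ (s - r)" by (simp_all add: algebra_simps)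
      then show "\<bar>y ^ (s - 1) / (y ^ (s - 1) - y ^ (r - 1))\<bar> = y ^ (s - r) * (1 / (1 - y ^ (s - r)))"
        using y less_imp_le[OF pow_less[of "s - r"]] s by (auto simp: abs_mult)
    qed
    also have "\<dots> = (\<Prod>s\<in>{r<..R}. y ^ (s - r)) * (\<Prod>j\<in>(\<lambda>s. s - r) ` {r<..R}. 1 / (1 - y ^ j))"
      unfolding prod.distrib by (subst prod.reindex) (auto simp: inj_on_def)
    also have "\<dots> \<le> y ^ (R - r) * E"
    proof (rule mult_mono)
      show "(\<Prod>s\<in>{r<..R}. y ^ (s - r)) \<le> y ^ (R - r)"
      proof (cases "r = R")
        case False
        then have "(\<Prod>s\<in>{r<..R}. y ^ (s - r)) = y ^ (R - r) * (\<Prod>s\<in>{r<..R} - {R}. y ^ (s - r))"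
          using r by (intro prod.remove) auto
        also have "\<dots> \<le> y ^ (R - r) * 1"
          using y by (intro mult_left_mono prod_le_1) (auto simp: power_le_one)
        finally show ?thesis by simp
      qed simp
      show "(\<Prod>j\<in>(\<lambda>s. s - r) ` {r<..R}. 1 / (1 - y ^ j)) \<le> E"
        unfolding E_def by (rule prod_inverse_one_minus_power_le[OF y]) auto
      show "0 \<le> (\<Prod>j\<in>(\<lambda>s. s - r) ` {r<..R}. 1 / (1 - y ^ j))"
        using pow_less by (intro prod_nonneg) (auto simp: less_imp_le)
    qed (use y in auto)
    finally show ?thesis .
  qed
  have "ml2r_w \<alpha> M R r = (\<Prod>s\<in>{1..R} - {r}. y ^ (s - 1) / (y ^ (s - 1) - y ^ (r - 1)))"
    using r ml2r_w_eq[OF M \<alpha>, of R] by (simp add: Lagrange_weight_def y_def)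
  moreover have "{1..R} - {r} = {1..<r} \<union> {r<..R}" using r by auto
  ultimately have "\<bar>ml2r_w \<alpha> M R r\<bar> = (\<Prod>s\<in>{1..<r} \<union> {r<..R}. \<bar>y ^ (s - 1) / (y ^ (s - 1) - y ^ (r - 1))\<bar>)"
    by (simp only: abs_prod)
  also have "\<dots> = (\<Prod>s\<in>{1..<r}. \<bar>y ^ (s - 1) / (y ^ (s - 1) - y ^ (r - 1))\<bar>) * (\<Prod>s\<in>{r<..R}. \<bar>y ^ (s - 1) / (y ^ (s - 1) - y ^ (r - 1))\<bar>)"
    by (rule prod.union_disjoint) auto
  also have "\<dots> \<le> E * (y ^ (R - r) * E)"
    by (intro mult_mono coarse fine prod_nonneg) (use E in auto)
  finally show ?thesis by (simp add: E_def power2_eq_square mult_ac)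
qed

text \<open>The weights concentrate near \<open>r = R\<close> whereas \<open>z ^ (r - 1)\<close> is concentrated near \<open>r = 1\<close>:
  every product is at most a constant times \<open>q ^ R\<close> with \<open>q = max y z < 1\<close>, and there are
  only \<open>R\<close> of them.\<close>

lemma ml2r_weighted_sum_tendsto_0:
  assumes M: "M \<ge> 2" and \<alpha>: "\<alpha> > 0" and z: "0 \<le> z" "z < 1"
  shows "(\<lambda>R. \<Sum>r=1..R. \<bar>ml2r_w \<alpha> M R r\<bar> * z ^ (r - 1)) \<longlonglongrightarrow> 0"
proof -
  define y where "y = real M powr (- \<alpha>)"
  define E where "E = (exp (1 / (1 - y)\<^sup>2))\<^sup>2"
  define q where "q = max y z"
  have y: "0 < y" "y < 1" using M powr_neg_less_1[OF M \<alpha>] by (auto simp: y_def)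
  have q: "0 < q" "q < 1" "y \<le> q" "z \<le> q" using y z by (auto simp: q_def)
  have E: "E > 0" by (simp add: E_def)
  have bound: "(\<Sum>r=1..R. \<bar>ml2r_w \<alpha> M R r\<bar> * z ^ (r - 1)) \<le> E / q * (real R * q ^ R)" for R
  proof -
    have "(\<Sum>r=1..R. \<bar>ml2r_w \<alpha> M R r\<bar> * z ^ (r - 1)) \<le> (\<Sum>r=1..R. E / q * q ^ R)"
    proof (rule sum_mono)
      fix r assume r: "r \<in> {1..R}"
      have "\<bar>ml2r_w \<alpha> M R r\<bar> * z ^ (r - 1) \<le> (E * y ^ (R - r)) * z ^ (r - 1)"
        using abs_ml2r_w_le[OF M \<alpha> r] z by (intro mult_right_mono) (auto simp: E_def y_def)
      also have "\<dots> \<le> (E * q ^ (R - r)) * q ^ (r - 1)"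
        using q y z E by (intro mult_mono power_mono) auto
      also have "\<dots> = E / q * q ^ R"
      proof -
        have "q ^ (R - r) * q ^ (r - 1) * q = q ^ R" using r by (simp flip: power_add power_Suc2)
        then show ?thesis using q by (simp add: field_simps)
      qed
      finally show "\<bar>ml2r_w \<alpha> M R r\<bar> * z ^ (r - 1) \<le> E / q * q ^ R" .
    qed
    then show ?thesis by (simp add: mult_ac)
  qed
  have "(\<lambda>R. E / q * (real R * q ^ R)) \<longlonglongrightarrow> E / q * 0"
    using q by (intro tendsto_mult_left powser_times_n_limit_0) auto
  then have "(\<lambda>R. E / q * (real R * q ^ R)) \<longlonglongrightarrow> 0" by simp
  then show ?thesis
    by (rule Lim_null_comparison[rotated]) (use bound z in \<open>auto intro!: always_eventually simp: abs_of_nonneg sum_nonneg\<close>)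
qed


section \<open>Fluctuations of the multilevel estimators\<close>

lemma levels_bounds:
  assumes "K\<^sub>0 \<ge> 1" "h \<in> levels K\<^sub>0"
  shows "0 < h" "h \<le> 1"
proof -
  obtain n where n: "n \<ge> 1" "h = 1 / real (K\<^sub>0 * n)" using assms(2) by (auto simp: levels_def)
  have "K\<^sub>0 * n \<ge> 1" using assms(1) n(1) by (simp add: Suc_le_eq)
  then have "real 1 \<le> real (K\<^sub>0 * n)" by (rule of_nat_mono)
  then show "0 < h" "h \<le> 1" unfolding n(2) by (auto simp del: of_nat_mult)
qed

lemma refiner_pos: "M \<ge> 2 \<Longrightarrow> refiner M j > 0"
  by (simp add: refiner_def)

lemma levels_divide_refiner:
  assumes "M \<ge> 2" "h \<in> levels K\<^sub>0"
  shows "h / real (refiner M j) \<in> levels K\<^sub>0"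
proof -
  obtain n where n: "n \<ge> 1" "h = 1 / real (K\<^sub>0 * n)" using assms(2) by (auto simp: levels_def)
  have "n * refiner M j \<ge> 1" using n(1) refiner_pos[OF assms(1), of j] by (simp add: Suc_le_eq)
  moreover have "h / real (refiner M j) = 1 / real (K\<^sub>0 * (n * refiner M j))" by (simp add: n(2))
  ultimately show ?thesis unfolding levels_def by blast
qed

text \<open>Level \<open>j\<close> receives at least \<open>v S q\<^sub>j / \<epsilon>\<^sup>2\<close> samples, where \<open>q\<^sub>j\<close> is its unnormalised share,
  proportional to \<open>|W\<^sub>j| M powr (- (j - 1))\<close> for \<open>j \<ge> 2\<close>, and \<open>S\<close> contains the sum of all \<open>|W\<^sub>j|\<close>. The contribution of
  level \<open>j\<close> is therefore at most \<open>\<epsilon>\<^sup>2 |W\<^sub>j| / (\<Sum> |W\<^sub>i|)\<close> up to a constant, and these bounds add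
  up to a multiple of \<open>\<epsilon>\<^sup>2\<close> in which neither the depth nor the weights appear. The normalisation
  \<open>\<mu>\<close> cancels. A level with zero weight may receive no sample at all, which is why positivity of
  the sample size is asserted for nonzero weights only.\<close>

lemma allocation_variance_bound:
  fixes W :: "nat \<Rightarrow> real"
  assumes M: "M \<ge> 2" and \<theta>: "\<theta> > 0" and v: "v > 0" and \<rho>: "\<rho> \<ge> 1" and \<epsilon>: "\<epsilon> > 0" and h: "h > 0" and R: "R \<ge> 1"
  defines "n \<equiv> \<lambda>j. nat \<lceil>total_size M 1 \<rho> v \<theta> W h R \<epsilon> * q_alloc M 1 \<theta> W h R j\<rceil>"
  shows "n 1 \<ge> 1" and "j \<in> {2..R} \<Longrightarrow> W j \<noteq> 0 \<Longrightarrow> n j \<ge> 1"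
    and "1 / real (n 1) + (\<Sum>j=2..R. (W j)\<^sup>2 * (h / real (refiner M j)) / real (n j))
        \<le> (1 / v + 1 / (v * \<theta>\<^sup>2 * C_lower M 1 * C_upper M 1)) * \<epsilon>\<^sup>2"
proof -
  define T where "T = (\<Sum>j=2..R. \<bar>W j\<bar>)"
  define g where "g = h powr (1/2)"
  define S where "S = 1 + \<theta> * g + \<theta> * g * C_upper M 1 * T"
  have g: "g > 0" "g * g = h" using h by (auto simp: g_def simp flip: powr_add)
  have C: "C_lower M 1 > 0" "C_upper M 1 > 0"
    using M by (auto simp: C_lower_def C_upper_def intro!: divide_pos_pos mult_pos_pos add_pos_nonneg)
  have T: "T \<ge> 0" by (simp add: T_def sum_nonneg)
  have S: "S \<ge> 1" "S \<ge> \<theta> * g * C_upper M 1 * T" using \<theta> g C T by (auto simp: S_def)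
  have shape_nonneg: "q_shape M 1 \<theta> W h j \<ge> 0" for j
    using \<theta> C by (simp add: q_shape_def)
  have shape1: "q_shape M 1 \<theta> W h 1 \<ge> 1" using \<theta> by (simp add: q_shape_def)
  have "q_shape M 1 \<theta> W h 1 \<le> (\<Sum>j=1..R. q_shape M 1 \<theta> W h j)"
    using R shape_nonneg by (intro member_le_sum) auto
  then have \<mu>: "mu_star M 1 \<theta> W h R > 0" using shape1 by (simp add: mu_star_def)
  have size: "total_size M 1 \<rho> v \<theta> W h R \<epsilon> * q_alloc M 1 \<theta> W h R j = \<rho> * (v * S) * q_shape M 1 \<theta> W h j / \<epsilon>\<^sup>2" for j
  proof -
    have "(\<Sum>j=2..R. \<bar>W j\<bar> * real M powr ((1 - 1) / 2 * (real j - 1))) = T" using M by (simp add: T_def)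
    then have "total_size M 1 \<rho> v \<theta> W h R \<epsilon> = \<rho> * (v * S) / (\<epsilon>\<^sup>2 * mu_star M 1 \<theta> W h R)"
      unfolding total_size_def S_def g_def by simp
    then show ?thesis using \<mu> by (simp add: q_alloc_def)
  qed
  have n_ge: "real (n j) \<ge> v * S * q_shape M 1 \<theta> W h j / \<epsilon>\<^sup>2" for j
  proof -
    have "1 * (v * S * q_shape M 1 \<theta> W h j) \<le> \<rho> * (v * S * q_shape M 1 \<theta> W h j)"
      using \<rho> v S(1) shape_nonneg by (intro mult_right_mono) auto
    then have "v * S * q_shape M 1 \<theta> W h j / \<epsilon>\<^sup>2 \<le> \<rho> * (v * S) * q_shape M 1 \<theta> W h j / \<epsilon>\<^sup>2"
      by (intro divide_right_mono) (auto simp: mult_ac)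
    also have "\<dots> \<le> real (n j)" unfolding n_def size by (rule real_nat_ceiling_ge)
    finally show ?thesis .
  qed
  have "v * 1 * 1 / \<epsilon>\<^sup>2 \<le> v * S * q_shape M 1 \<theta> W h 1 / \<epsilon>\<^sup>2"
    using v S(1) shape1 by (intro divide_right_mono mult_mono) auto
  then have n1: "v / \<epsilon>\<^sup>2 \<le> real (n 1)" using n_ge[of 1] by simp
  have v\<epsilon>: "v / \<epsilon>\<^sup>2 > 0" using v \<epsilon> by simp
  with n1 have n1_pos: "real (n 1) > 0" by linarith
  then show "n 1 \<ge> 1" by simp
  have first: "1 / real (n 1) \<le> \<epsilon>\<^sup>2 / v"
  proof -
    have "1 / real (n 1) \<le> 1 / (v / \<epsilon>\<^sup>2)"
      using n1 n1_pos v\<epsilon> by (intro divide_left_mono mult_pos_pos) auto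
    then show ?thesis by simp
  qed
  have shape: "q_shape M 1 \<theta> W h j = \<theta> * g * C_lower M 1 * \<bar>W j\<bar> / real (refiner M j)" if "j \<in> {2..R}" for j
  proof -
    have *: "real M powr (- real k) = 1 / real (M ^ k)" for k
      using M by (simp add: powr_minus_divide powr_realpow)
    have **: "real j - 1 = real (j - 1)" using that by auto
    have "real M powr (- (real j - 1)) = 1 / real (refiner M j)"
      unfolding ** * refiner_def ..
    then show ?thesis using that by (simp add: q_shape_def g_def)
  qed
  have pos: "v * S * q_shape M 1 \<theta> W h j / \<epsilon>\<^sup>2 > 0" if "j \<in> {2..R}" "W j \<noteq> 0" for j
    unfolding shape[OF that(1)] using that v S(1) \<theta> g C \<epsilon> refiner_pos[OF M, of j] by (intro divide_pos_pos mult_pos_pos) auto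
  show "n j \<ge> 1" if "j \<in> {2..R}" "W j \<noteq> 0"
  proof -
    have "real (n j) > 0" using less_le_trans[OF pos[OF that] n_ge] .
    then show ?thesis by simp
  qed
  define c where "c = g * \<epsilon>\<^sup>2 / (v * S * \<theta> * C_lower M 1)"
  have level: "(W j)\<^sup>2 * (h / real (refiner M j)) / real (n j) \<le> c * \<bar>W j\<bar>" if j: "j \<in> {2..R}" for j
  proof (cases "W j = 0")
    case False
    have "(W j)\<^sup>2 * (h / real (refiner M j)) / real (n j)
        \<le> (W j)\<^sup>2 * (h / real (refiner M j)) / (v * S * q_shape M 1 \<theta> W h j / \<epsilon>\<^sup>2)"
      using h n_ge[of j] pos[OF j False] by (intro divide_left_mono mult_pos_pos) auto
    also have "\<dots> = \<bar>W j\<bar> * \<bar>W j\<bar> * (g * g / real (refiner M j))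
        / (v * S * (\<theta> * g * C_lower M 1 * \<bar>W j\<bar> / real (refiner M j)) / \<epsilon>\<^sup>2)"
      by (simp only: shape[OF j] g(2) power2_eq_square abs_mult_self_eq)
    also have "\<dots> = c * \<bar>W j\<bar>"
    proof -
      have "\<bar>W j\<bar> > 0" "real (refiner M j) > 0" using False refiner_pos[OF M, of j] by auto
      moreover have "A * A * (g * g / r) / (v * S * (\<theta> * g * C_lower M 1 * A / r) / \<epsilon>\<^sup>2) = c * A"
        if "A > 0" "r > 0" for A r :: real
        using that g(1) C v S(1) \<theta> \<epsilon> unfolding c_def by (simp add: divide_simps)
      ultimately show ?thesis by blast
    qed
    finally show ?thesis .
  qed simp
  have "(\<Sum>j=2..R. (W j)\<^sup>2 * (h / real (refiner M j)) / real (n j)) \<le> c * T"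
    unfolding T_def sum_distrib_left by (intro sum_mono level)
  also have "\<dots> = (\<epsilon>\<^sup>2 / (v * \<theta>\<^sup>2 * C_lower M 1 * C_upper M 1)) * ((\<theta> * g * C_upper M 1 * T) / S)"
    using C \<theta> v S(1) by (simp add: c_def power2_eq_square mult_ac)
  also have "\<dots> \<le> (\<epsilon>\<^sup>2 / (v * \<theta>\<^sup>2 * C_lower M 1 * C_upper M 1)) * 1"
    using S C v \<theta> by (intro mult_left_mono) auto
  finally have second: "(\<Sum>j=2..R. (W j)\<^sup>2 * (h / real (refiner M j)) / real (n j))
      \<le> \<epsilon>\<^sup>2 / (v * \<theta>\<^sup>2 * C_lower M 1 * C_upper M 1)" by (simp only: mult_1_right)
  have "(1 / v + 1 / (v * \<theta>\<^sup>2 * C_lower M 1 * C_upper M 1)) * \<epsilon>\<^sup>2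
      = \<epsilon>\<^sup>2 / v + \<epsilon>\<^sup>2 / (v * \<theta>\<^sup>2 * C_lower M 1 * C_upper M 1)"
    by (simp only: distrib_right times_divide_eq_left mult_1_left)
  with first second show "1 / real (n 1) + (\<Sum>j=2..R. (W j)\<^sup>2 * (h / real (refiner M j)) / real (n j))
        \<le> (1 / v + 1 / (v * \<theta>\<^sup>2 * C_lower M 1 * C_upper M 1)) * \<epsilon>\<^sup>2"
    by linarith
qed

text \<open>What the analysis of the estimators uses about the nested family: increments and strong errors
  of order one half in \<open>L\<^sup>p\<close>, and independent copies of the family as a whole.\<close>

locale multilevel_copies = prob_space P for P :: "'a measure" +
  fixes K\<^sub>0 :: nat and Z :: "real \<Rightarrow> 'a \<Rightarrow> real" and Zc :: "nat \<Rightarrow> nat \<Rightarrow> real \<Rightarrow> 'a \<Rightarrow> real"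
    and p V :: real
  assumes K\<^sub>0: "K\<^sub>0 \<ge> 1" and p: "p \<ge> 2" and V: "V \<ge> 0"
    and Z_measurable: "h \<in> levels K\<^sub>0 \<union> {0} \<Longrightarrow> Z h \<in> borel_measurable P"
    and Z_zero_Lp: "in_Lp P p (Z 0)"
    and increment: "h \<in> levels K\<^sub>0 \<Longrightarrow> h' \<in> levels K\<^sub>0 \<Longrightarrow>
      Lp_norm_pow P p (\<lambda>\<omega>. Z h' \<omega> - Z h \<omega>) \<le> ennreal (V * \<bar>h' - h\<bar> powr (p / 2))"
    and strong: "h \<in> levels K\<^sub>0 \<Longrightarrow> Lp_norm_pow P p (\<lambda>\<omega>. Z h \<omega> - Z 0 \<omega>) \<le> ennreal (V * h powr (p / 2))"
    and copies: "independent_copies P (levels K\<^sub>0 \<union> {0}) Z Zc"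
begin

lemma increment_in_Lp:
  assumes "h \<in> levels K\<^sub>0" "h' \<in> levels K\<^sub>0"
  shows "in_Lp P p (\<lambda>\<omega>. Z h' \<omega> - Z h \<omega>)"
    "expectation (\<lambda>\<omega>. \<bar>Z h' \<omega> - Z h \<omega>\<bar> powr p) \<le> V * \<bar>h' - h\<bar> powr (p / 2)"
  using Lp_norm_pow_le_ennrealD[OF _ increment[OF assms]] V Z_measurable assms by auto

lemma strong_in_Lp:
  assumes "h \<in> levels K\<^sub>0"
  shows "in_Lp P p (\<lambda>\<omega>. Z h \<omega> - Z 0 \<omega>)"
    "expectation (\<lambda>\<omega>. \<bar>Z h \<omega> - Z 0 \<omega>\<bar> powr p) \<le> V * h powr (p / 2)"
  using Lp_norm_pow_le_ennrealD[OF _ strong[OF assms]] V Z_measurable assms by auto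

lemma Z_in_Lp:
  assumes h: "h \<in> levels K\<^sub>0"
  shows "in_Lp P p (Z h)"
    and "expectation (\<lambda>\<omega>. \<bar>Z h \<omega>\<bar> powr p) \<le> 2 powr p * (V + expectation (\<lambda>\<omega>. \<bar>Z 0 \<omega>\<bar> powr p))"
proof -
  show Lp: "in_Lp P p (Z h)"
    using in_Lp_add[OF _ strong_in_Lp(1)[OF h] Z_zero_Lp] p by simp
  have "expectation (\<lambda>\<omega>. \<bar>Z h \<omega>\<bar> powr p) \<le> expectation (\<lambda>\<omega>. 2 powr p * (\<bar>Z h \<omega> - Z 0 \<omega>\<bar> powr p + \<bar>Z 0 \<omega>\<bar> powr p))"
  proof (rule integral_mono)
    show "\<bar>Z h \<omega>\<bar> powr p \<le> 2 powr p * (\<bar>Z h \<omega> - Z 0 \<omega>\<bar> powr p + \<bar>Z 0 \<omega>\<bar> powr p)" for \<omega>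
      using abs_add_powr_le[of p "Z h \<omega> - Z 0 \<omega>" "Z 0 \<omega>"] p by simp
  qed (use Lp strong_in_Lp(1)[OF h] Z_zero_Lp in \<open>auto simp: in_Lp_def\<close>)
  also have "\<dots> = 2 powr p * (expectation (\<lambda>\<omega>. \<bar>Z h \<omega> - Z 0 \<omega>\<bar> powr p) + expectation (\<lambda>\<omega>. \<bar>Z 0 \<omega>\<bar> powr p))"
    using strong_in_Lp(1)[OF h] Z_zero_Lp by (simp add: in_Lp_def)
  also have "expectation (\<lambda>\<omega>. \<bar>Z h \<omega> - Z 0 \<omega>\<bar> powr p) \<le> V"
  proof -
    have "h powr (p / 2) \<le> 1" using levels_bounds[OF K\<^sub>0 h] p by (intro powr_le1) auto
    then show ?thesis using strong_in_Lp(2)[OF h] V mult_left_mono[of "h powr (p / 2)" 1 V] by linarith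
  qed
  finally show "expectation (\<lambda>\<omega>. \<bar>Z h \<omega>\<bar> powr p) \<le> 2 powr p * (V + expectation (\<lambda>\<omega>. \<bar>Z 0 \<omega>\<bar> powr p))"
    by simp
qed

text \<open>The \<open>p\<close>-th root of the strong error bound, through Jensen's inequality.\<close>

lemma abs_bias_le:
  assumes h: "h \<in> levels K\<^sub>0"
  shows "\<bar>expectation (Z h) - expectation (Z 0)\<bar> \<le> V powr (1 / p) * h powr (1 / 2)"
proof -
  have int: "integrable P (Z h)" "integrable P (Z 0)"
    using in_Lp_imp_integrable[OF _ Z_in_Lp(1)[OF h]] in_Lp_imp_integrable[OF _ Z_zero_Lp] p by auto
  have "\<bar>expectation (\<lambda>\<omega>. Z h \<omega> - Z 0 \<omega>)\<bar> powr p \<le> V * h powr (p / 2)"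
    using abs_expectation_powr_le[OF _ strong_in_Lp(1)[OF h]] strong_in_Lp(2)[OF h] p by simp
  then have "(\<bar>expectation (\<lambda>\<omega>. Z h \<omega> - Z 0 \<omega>)\<bar> powr p) powr (1 / p) \<le> (V * h powr (p / 2)) powr (1 / p)"
    using p by (intro powr_mono2) auto
  moreover have "(\<bar>expectation (\<lambda>\<omega>. Z h \<omega> - Z 0 \<omega>)\<bar> powr p) powr (1 / p) = \<bar>expectation (Z h) - expectation (Z 0)\<bar>"
    using p int by (simp add: powr_powr)
  moreover have "(V * h powr (p / 2)) powr (1 / p) = V powr (1 / p) * h powr (1 / 2)"
    using p V by (subst powr_mult) (simp_all add: powr_powr)
  ultimately show ?thesis by (simp only:)
qed

definition level_difference :: "nat \<Rightarrow> real \<Rightarrow> nat \<Rightarrow> (real \<Rightarrow> real) \<Rightarrow> real" where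
  "level_difference M h j z = z (h / real (refiner M j)) - (if j = 1 then 0 else z (h / real (refiner M (j - 1))))"

text \<open>Dominates the squared \<open>L\<^sup>p\<close> norm of the level difference up to a constant
  factor. Level one holds a full variable instead of an increment, hence its scale is of order one.\<close>

definition level_scale :: "nat \<Rightarrow> real \<Rightarrow> nat \<Rightarrow> real" where
  "level_scale M h j = (if j = 1 then 1 else h / real (refiner M j))"

definition level_const :: "nat \<Rightarrow> real" where
  "level_const M = 2 * 2 powr p * (V * (real M - 1) powr (p / 2)
     + 2 powr p * (V + expectation (\<lambda>\<omega>. \<bar>Z 0 \<omega>\<bar> powr p)))"

lemma level_const_nonneg: "level_const M \<ge> 0"
  using V by (simp add: level_const_def)

lemma level_difference_measurable:
  assumes "M \<ge> 2" "h \<in> levels K\<^sub>0"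
  shows "level_difference M h j \<in> borel_measurable (\<Pi>\<^sub>M h\<in>levels K\<^sub>0 \<union> {0}. borel)"
proof -
  have [measurable]: "(\<lambda>z. z (h / real (refiner M i))) \<in> borel_measurable (\<Pi>\<^sub>M h\<in>levels K\<^sub>0 \<union> {0}. (borel :: real measure))" for i
    using levels_divide_refiner[OF assms] by (intro measurable_component_singleton) auto
  show ?thesis unfolding level_difference_def by measurable
qed

lemma level_difference_moments:
  assumes M: "M \<ge> 2" and h: "h \<in> levels K\<^sub>0" and j: "j \<ge> 1"
  defines "D \<equiv> \<lambda>\<omega>. level_difference M h j (\<lambda>h. Z h \<omega>)"
  shows "in_Lp P p D"
    and "expectation (\<lambda>\<omega>. \<bar>D \<omega> - expectation D\<bar> powr p) \<le> level_const M * level_scale M h j powr (p / 2)"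
proof -
  note hj = levels_divide_refiner[OF M h]
  show Lp: "in_Lp P p D"
    using Z_in_Lp(1)[OF hj] in_Lp_diff[of p P] p by (cases "j = 1") (auto simp: D_def level_difference_def)
  have "expectation (\<lambda>\<omega>. \<bar>D \<omega> - expectation D\<bar> powr p) \<le> 2 * 2 powr p * expectation (\<lambda>\<omega>. \<bar>D \<omega>\<bar> powr p)"
    using expectation_centred_powr_le[OF _ Lp] p by simp
  also have "\<dots> \<le> level_const M * level_scale M h j powr (p / 2)"
  proof (cases "j = 1")
    case True
    have "expectation (\<lambda>\<omega>. \<bar>D \<omega>\<bar> powr p) \<le> V * (real M - 1) powr (p / 2)
       + 2 powr p * (V + expectation (\<lambda>\<omega>. \<bar>Z 0 \<omega>\<bar> powr p))"
      using Z_in_Lp(2)[OF hj, of j] V True by (simp add: D_def level_difference_def add_increasing)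
    then show ?thesis using True by (simp add: level_const_def level_scale_def)
  next
    case False
    define i where "i = j - 2"
    have i: "j = Suc (Suc i)" using j False by (simp add: i_def)
    let ?hj = "h / real (refiner M j)"
    \<comment> \<open>Consecutive bias parameters differ by the factor \<open>M\<close>, so their distance is a fixed multiple of
      the finer one.\<close>
    have "\<bar>?hj - h / real (refiner M (j - 1))\<bar> = (real M - 1) * ?hj"
    proof -
      have "h / real (refiner M (j - 1)) = real M * ?hj" using M by (simp add: refiner_def i)
      moreover have "0 \<le> (real M - 1) * ?hj" using M levels_bounds(1)[OF K\<^sub>0 hj[of j]] by (intro mult_nonneg_nonneg) auto
      moreover have "\<bar>u - real M * u\<bar> = (real M - 1) * u" if "0 \<le> (real M - 1) * u" for u :: real
        using that unfolding left_diff_distrib mult_1_left by linarith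
      ultimately show ?thesis by metis
    qed
    then have "expectation (\<lambda>\<omega>. \<bar>D \<omega>\<bar> powr p) \<le> V * ((real M - 1) * ?hj) powr (p / 2)"
      using increment_in_Lp(2)[OF hj[of "j - 1"] hj[of j]] False by (simp add: D_def level_difference_def)
    also have "\<dots> = V * (real M - 1) powr (p / 2) * ?hj powr (p / 2)"
      using M levels_bounds(1)[OF K\<^sub>0 hj[of j]] by (subst powr_mult) auto
    also have "\<dots> \<le> (V * (real M - 1) powr (p / 2) + 2 powr p * (V + expectation (\<lambda>\<omega>. \<bar>Z 0 \<omega>\<bar> powr p))) * ?hj powr (p / 2)"
      using V by (intro mult_right_mono) auto
    finally show ?thesis using False by (simp add: level_const_def level_scale_def mult.assoc)
  qed
  finally show "expectation (\<lambda>\<omega>. \<bar>D \<omega> - expectation D\<bar> powr p) \<le> level_const M * level_scale M h j powr (p / 2)" .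
qed

text \<open>Each copy reproduces the joint law of the family, hence the law of every functional of it.\<close>

lemma copy_transfer:
  assumes jk: "j \<ge> 1" "k \<ge> 1" and g: "g \<in> borel_measurable (\<Pi>\<^sub>M h\<in>levels K\<^sub>0 \<union> {0}. borel)"
  shows "expectation (\<lambda>\<omega>. g (\<lambda>h\<in>levels K\<^sub>0 \<union> {0}. Zc j k h \<omega>)) = expectation (\<lambda>\<omega>. g (\<lambda>h\<in>levels K\<^sub>0 \<union> {0}. Z h \<omega>) :: real)"
    and "integrable P (\<lambda>\<omega>. g (\<lambda>h\<in>levels K\<^sub>0 \<union> {0}. Zc j k h \<omega>)) \<longleftrightarrow> integrable P (\<lambda>\<omega>. g (\<lambda>h\<in>levels K\<^sub>0 \<union> {0}. Z h \<omega>))"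
    and "(\<lambda>\<omega>. g (\<lambda>h\<in>levels K\<^sub>0 \<union> {0}. Zc j k h \<omega>)) \<in> borel_measurable P"
proof -
  let ?I = "levels K\<^sub>0 \<union> {0}" let ?S = "\<Pi>\<^sub>M h\<in>?I. (borel :: real measure)"
  have mZ: "(\<lambda>\<omega>. \<lambda>h\<in>?I. Z h \<omega>) \<in> measurable P ?S"
    by (intro measurable_restrict Z_measurable) auto
  have mc: "(\<lambda>\<omega>. \<lambda>h\<in>?I. Zc j k h \<omega>) \<in> measurable P ?S"
    using copies jk by (auto simp: independent_copies_def indep_vars_def)
  have eq: "distr P ?S (\<lambda>\<omega>. \<lambda>h\<in>?I. Zc j k h \<omega>) = distr P ?S (\<lambda>\<omega>. \<lambda>h\<in>?I. Z h \<omega>)"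
    using copies jk by (auto simp: independent_copies_def)
  show "expectation (\<lambda>\<omega>. g (\<lambda>h\<in>?I. Zc j k h \<omega>)) = expectation (\<lambda>\<omega>. g (\<lambda>h\<in>?I. Z h \<omega>))"
    using integral_distr[OF mZ g] integral_distr[OF mc g] eq by simp
  show "integrable P (\<lambda>\<omega>. g (\<lambda>h\<in>?I. Zc j k h \<omega>)) \<longleftrightarrow> integrable P (\<lambda>\<omega>. g (\<lambda>h\<in>?I. Z h \<omega>))"
    using integrable_distr_eq[OF mZ g] integrable_distr_eq[OF mc g] eq by simp
  show "(\<lambda>\<omega>. g (\<lambda>h\<in>?I. Zc j k h \<omega>)) \<in> borel_measurable P"
    using measurable_compose[OF mc g] .
qed

lemma level_difference_restrict:
  assumes "M \<ge> 2" "h \<in> levels K\<^sub>0"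
  shows "level_difference M h j (\<lambda>h\<in>levels K\<^sub>0 \<union> {0}. z h) = level_difference M h j z"
  using levels_divide_refiner[OF assms] by (simp add: level_difference_def)

definition estimator_mean :: "nat \<Rightarrow> (nat \<Rightarrow> real) \<Rightarrow> real \<Rightarrow> nat \<Rightarrow> real" where
  "estimator_mean M W h R = expectation (Z h)
     + (\<Sum>j=2..R. W j * (expectation (Z (h / real (refiner M j))) - expectation (Z (h / real (refiner M (j - 1))))))"

text \<open>The centred estimator is a double sum over levels and copies of independent centred terms. The
  number of copies depends on the level, so the index set is a dependent sum. A level with zero
  weight contributes zero both to the estimator and to its mean, even if it has no copies.\<close>

lemma ml_estimator_moment_bound:
  assumes M: "M \<ge> 2" and h: "h \<in> levels K\<^sub>0" and R: "R \<ge> 1"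
    and n1: "nat \<lceil>N * q 1\<rceil> \<ge> 1" and nj: "\<And>j. j \<in> {2..R} \<Longrightarrow> W j \<noteq> 0 \<Longrightarrow> nat \<lceil>N * q j\<rceil> \<ge> 1"
    and var: "1 / real (nat \<lceil>N * q 1\<rceil>) + (\<Sum>j=2..R. (W j)\<^sup>2 * (h / real (refiner M j)) / real (nat \<lceil>N * q j\<rceil>)) \<le> s"
  defines "U \<equiv> \<lambda>\<omega>. ml_estimator M W Zc h R q N \<omega> - estimator_mean M W h R"
  shows "U \<in> borel_measurable P"
    and "Lp_norm_pow P p U \<le> ennreal (2 * moment_const p * level_const M * s powr (p / 2))"
proof -
  define n where "n = (\<lambda>j. nat \<lceil>N * q j\<rceil>)"
  \<comment> \<open>The first level enters the estimator with coefficient one.\<close>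
  define w where "w = (\<lambda>j. if j = 1 then 1 else W j)"
  define J where "J = Sigma {1..R} (\<lambda>j. {1..n j})"
  define e where "e = (\<lambda>j. expectation (\<lambda>\<omega>. level_difference M h j (\<lambda>h. Z h \<omega>)))"
  define D where "D = (\<lambda>(j, k) \<omega>. level_difference M h j (\<lambda>h. Zc j k h \<omega>) - e j)"
  define a where "a = (\<lambda>(j, k :: nat). w j / real (n j))"
  have finJ: "finite J" by (simp add: J_def)
  have range: "{1..R} = insert 1 {2..R}" "1 \<notin> {2..R}" using R by auto
  have n_pos: "n j \<ge> 1" if "j \<in> {1..R}" "w j \<noteq> 0" for j
    using that n1 nj[of j] by (cases "j = 1") (auto simp: n_def w_def)
  have int: "integrable P (Z (h / real (refiner M j)))" for j
    using Z_in_Lp(1)[OF levels_divide_refiner[OF M h]] in_Lp_imp_integrable[of p] p by simp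
  have U_eq: "U \<omega> = (\<Sum>i\<in>J. a i * D i \<omega>)" for \<omega>
  proof -
    have "(\<Sum>i\<in>J. a i * D i \<omega>) = (\<Sum>j=1..R. \<Sum>k=1..n j. a (j, k) * D (j, k) \<omega>)"
      unfolding J_def by (subst sum.Sigma) auto
    also have "\<dots> = (\<Sum>j=1..R. w j / real (n j) * (\<Sum>k=1..n j. level_difference M h j (\<lambda>h. Zc j k h \<omega>)) - w j * e j)"
    proof (rule sum.cong[OF refl])
      fix j assume j: "j \<in> {1..R}"
      show "(\<Sum>k=1..n j. a (j, k) * D (j, k) \<omega>) = w j / real (n j) * (\<Sum>k=1..n j. level_difference M h j (\<lambda>h. Zc j k h \<omega>)) - w j * e j"
        using n_pos[OF j] by (cases "w j = 0")
          (auto simp: a_def D_def right_diff_distrib sum_subtractf sum_distrib_left)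
    qed
    also have "\<dots> = (\<Sum>j=1..R. w j / real (n j) * (\<Sum>k=1..n j. level_difference M h j (\<lambda>h. Zc j k h \<omega>))) - (\<Sum>j=1..R. w j * e j)"
      by (rule sum_subtractf)
    also have "(\<Sum>j=1..R. w j * e j) = estimator_mean M W h R"
    proof -
      have "e 1 = expectation (Z h)" by (simp add: e_def level_difference_def refiner_def)
      moreover have "e j = expectation (Z (h / real (refiner M j))) - expectation (Z (h / real (refiner M (j - 1))))"
        if "j \<in> {2..R}" for j
        using that int[of j] int[of "j - 1"] by (simp add: e_def level_difference_def)
      ultimately show ?thesis using range(2) unfolding range(1)
        by (simp add: estimator_mean_def w_def)
    qed
    also have "(\<Sum>j=1..R. w j / real (n j) * (\<Sum>k=1..n j. level_difference M h j (\<lambda>h. Zc j k h \<omega>))) = ml_estimator M W Zc h R q N \<omega>"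
      using range(2) unfolding range(1)
      by (simp add: ml_estimator_def Let_def w_def n_def level_difference_def refiner_def)
    finally show ?thesis by (simp add: U_def)
  qed
  have ge1: "j \<ge> 1" "k \<ge> 1" if "(j, k) \<in> J" for j k using that by (auto simp: J_def)
  let ?I = "levels K\<^sub>0 \<union> {0}"
  have transfer:
      "expectation (\<lambda>\<omega>. g (level_difference M h j (\<lambda>h. Zc j k h \<omega>))) = expectation (\<lambda>\<omega>. g (level_difference M h j (\<lambda>h. Z h \<omega>)))"
      "integrable P (\<lambda>\<omega>. g (level_difference M h j (\<lambda>h. Zc j k h \<omega>))) \<longleftrightarrow> integrable P (\<lambda>\<omega>. g (level_difference M h j (\<lambda>h. Z h \<omega>)))"
      "(\<lambda>\<omega>. g (level_difference M h j (\<lambda>h. Zc j k h \<omega>))) \<in> borel_measurable P"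
    if "j \<ge> 1" "k \<ge> 1" "g \<in> borel_measurable borel" for j k and g :: "real \<Rightarrow> real"
    using copy_transfer[OF that(1,2) measurable_compose[OF level_difference_measurable[OF M h, of j] that(3)]]
    unfolding level_difference_restrict[OF M h] by blast+
  have Lp: "in_Lp P p (D i)" and mean: "expectation (D i) = 0"
    and mom: "expectation (\<lambda>\<omega>. \<bar>D i \<omega>\<bar> powr p) \<le> level_const M * level_scale M h (fst i) powr (p / 2)" if "i \<in> J" for i
  proof -
    obtain j k where i: "i = (j, k)" by (cases i)
    note jk = ge1[of j k, OF that[unfolded i]]
    note moments = level_difference_moments[OF M h jk(1)]
    have Lp': "in_Lp P p (\<lambda>\<omega>. level_difference M h j (\<lambda>h. Z h \<omega>) - e j)"
      using in_Lp_diff[OF _ moments(1) in_Lp_const[OF prob_space_axioms]] p by simp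
    show "in_Lp P p (D i)"
      using transfer(2)[OF jk, of "\<lambda>u. \<bar>u - e j\<bar> powr p"]
        transfer(3)[OF jk, of "\<lambda>u. u - e j"] Lp'
      by (simp add: in_Lp_def D_def i)
    have "expectation (\<lambda>\<omega>. level_difference M h j (\<lambda>h. Z h \<omega>) - e j) = 0"
      using in_Lp_imp_integrable[OF _ moments(1)] p by (simp add: e_def prob_space)
    then show "expectation (D i) = 0"
      using transfer(1)[OF jk, of "\<lambda>u. u - e j"] by (simp add: D_def i)
    show "expectation (\<lambda>\<omega>. \<bar>D i \<omega>\<bar> powr p) \<le> level_const M * level_scale M h (fst i) powr (p / 2)"
      using transfer(1)[OF jk, of "\<lambda>u. \<bar>u - e j\<bar> powr p"] moments(2) by (simp add: D_def i e_def)
  qed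
  have indep: "indep_vars (\<lambda>_. borel) (\<lambda>i \<omega>. a i * D i \<omega>) J"
  proof -
    have "indep_vars (\<lambda>_. \<Pi>\<^sub>M h\<in>?I. borel) (\<lambda>(j, k) \<omega>. \<lambda>h\<in>?I. Zc j k h \<omega>) J"
      using copies unfolding independent_copies_def
      by (elim conjE indep_vars_subset) (auto simp: J_def)
    then have "indep_vars (\<lambda>_. borel) (\<lambda>i \<omega>. a i * (level_difference M h (fst i) ((\<lambda>(j, k) \<omega>. \<lambda>h\<in>?I. Zc j k h \<omega>) i \<omega>) - e (fst i))) J"
      by (rule indep_vars_compose2[where Y = "\<lambda>i z. a i * (level_difference M h (fst i) z - e (fst i))"])
        (intro borel_measurable_times borel_measurable_diff borel_measurable_const level_difference_measurable[OF M h])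
    moreover have "(\<lambda>i \<omega>. a i * (level_difference M h (fst i) ((\<lambda>(j, k) \<omega>. \<lambda>h\<in>?I. Zc j k h \<omega>) i \<omega>) - e (fst i))) = (\<lambda>i \<omega>. a i * D i \<omega>)"
      by (auto simp: fun_eq_iff D_def level_difference_restrict[OF M h, simplified])
    ultimately show ?thesis by simp
  qed
  have scale: "level_scale M h j \<ge> 0" for j
    using levels_bounds[OF K\<^sub>0 h] by (simp add: level_scale_def)
  have bound: "expectation (\<lambda>\<omega>. \<bar>\<Sum>i\<in>J. a i * D i \<omega>\<bar> powr p)
      \<le> 2 * moment_const p * level_const M * (\<Sum>i\<in>J. (a i)\<^sup>2 * level_scale M h (fst i)) powr (p / 2)"
  proof (rule indep_sum_moment_bound[OF p level_const_nonneg finJ indep])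
    fix i assume i: "i \<in> J"
    show "in_Lp P p (\<lambda>\<omega>. a i * D i \<omega>)" by (rule in_Lp_cmult[OF Lp[OF i]])
    show "expectation (\<lambda>\<omega>. a i * D i \<omega>) = 0" using mean[OF i] by simp
    show "0 \<le> (a i)\<^sup>2 * level_scale M h (fst i)" using scale by simp
    have "((a i)\<^sup>2) powr (p / 2) = \<bar>a i\<bar> powr p"
    proof -
      have "(a i)\<^sup>2 = \<bar>a i\<bar> powr 2" by simp
      then show ?thesis by (simp only: powr_powr) simp
    qed
    then show "expectation (\<lambda>\<omega>. \<bar>a i * D i \<omega>\<bar> powr p) \<le> level_const M * ((a i)\<^sup>2 * level_scale M h (fst i)) powr (p / 2)"
      using mult_left_mono[OF mom[OF i], of "\<bar>a i\<bar> powr p"] scale by (simp add: abs_mult powr_mult mult_ac)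
  qed
  also have "(\<Sum>i\<in>J. (a i)\<^sup>2 * level_scale M h (fst i)) \<le> s"
  proof -
    have "(\<Sum>i\<in>J. (a i)\<^sup>2 * level_scale M h (fst i)) = (\<Sum>j=1..R. \<Sum>k=1..n j. (a (j, k))\<^sup>2 * level_scale M h j)"
      unfolding J_def by (subst sum.Sigma) (auto intro!: sum.cong)
    also have "\<dots> = (\<Sum>j=1..R. (w j)\<^sup>2 * level_scale M h j / real (n j))"
      by (intro sum.cong refl) (simp add: a_def power2_eq_square)
    also have "\<dots> \<le> s"
      using var range(2) unfolding range(1)
      by (simp add: w_def level_scale_def n_def)
    finally show ?thesis .
  qed
  then have "2 * moment_const p * level_const M * (\<Sum>i\<in>J. (a i)\<^sup>2 * level_scale M h (fst i)) powr (p / 2)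
      \<le> 2 * moment_const p * level_const M * s powr (p / 2)"
    using moment_const(1)[OF p] level_const_nonneg scale p
    by (intro mult_left_mono powr_mono2 sum_nonneg) auto
  finally have "expectation (\<lambda>\<omega>. \<bar>U \<omega>\<bar> powr p) \<le> 2 * moment_const p * level_const M * s powr (p / 2)"
    by (simp add: U_eq)
  moreover have Lp_U: "in_Lp P p U"
    using p finJ Lp unfolding U_eq[abs_def] by (intro in_Lp_sum in_Lp_cmult) auto
  ultimately show "Lp_norm_pow P p U \<le> ennreal (2 * moment_const p * level_const M * s powr (p / 2))"
    by (simp add: Lp_norm_pow_eq_integral ennreal_leI)
  show "U \<in> borel_measurable P" using Lp_U by (simp add: in_Lp_def)
qed

end


section \<open>Almost sure convergence\<close>

text \<open>The sum of the \<open>p\<close>-th powers has finite expectation by monotone convergence, so it is almost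
  surely finite and its terms tend to zero.\<close>

lemma AE_tendsto_0_if_summable_moments:
  fixes U :: "nat \<Rightarrow> 'a \<Rightarrow> real"
  assumes p: "p > 0" and e: "\<And>k. e k \<ge> 0" "summable e"
    and U: "\<forall>\<^sub>F k in sequentially. U k \<in> borel_measurable P \<and> Lp_norm_pow P p (U k) \<le> ennreal (e k)"
  shows "AE \<omega> in P. (\<lambda>k. U k \<omega>) \<longlonglongrightarrow> 0"
proof -
  obtain k0 where k0: "\<And>k. k \<ge> k0 \<Longrightarrow> U k \<in> borel_measurable P"
      "\<And>k. k \<ge> k0 \<Longrightarrow> Lp_norm_pow P p (U k) \<le> ennreal (e k)"
    using U by (auto simp: eventually_sequentially)
  define T where "T = (\<lambda>k \<omega>. ennreal (\<bar>U (k + k0) \<omega>\<bar> powr p))"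
  have [measurable]: "U (k + k0) \<in> borel_measurable P" for k using k0 by simp
  have [measurable]: "T k \<in> borel_measurable P" for k unfolding T_def by measurable
  have sum_e: "summable (\<lambda>k. e (k + k0))" using e(2) by (simp add: summable_iff_shift)
  have "(\<integral>\<^sup>+\<omega>. (\<Sum>k. T k \<omega>) \<partial>P) = (\<Sum>k. \<integral>\<^sup>+\<omega>. T k \<omega> \<partial>P)"
    by (rule nn_integral_suminf) simp
  also have "\<dots> \<le> (\<Sum>k. ennreal (e (k + k0)))"
    using k0(2) by (intro suminf_le) (auto simp: T_def Lp_norm_pow_def)
  also have "\<dots> = ennreal (\<Sum>k. e (k + k0))"
    using e(1) sum_e by (intro suminf_ennreal2) auto
  also have "\<dots> < \<infinity>" by simp
  finally have "AE \<omega> in P. (\<Sum>k. T k \<omega>) \<noteq> \<infinity>"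
    by (intro nn_integral_PInf_AE) auto
  then show ?thesis
  proof eventually_elim
    case (elim \<omega>)
    then have "summable (\<lambda>k. \<bar>U (k + k0) \<omega>\<bar> powr p)"
      by (intro summable_suminf_not_top) (auto simp: T_def)
    then have "(\<lambda>k. \<bar>U (k + k0) \<omega>\<bar> powr p) \<longlonglongrightarrow> 0" by (rule summable_LIMSEQ_zero)
    then have "(\<lambda>k. (\<bar>U (k + k0) \<omega>\<bar> powr p) powr (1 / p)) \<longlonglongrightarrow> 0"
      by (rule tendsto_zero_powrI[OF _ tendsto_const]) (use p in \<open>auto intro: always_eventually\<close>)
    moreover have "(\<bar>u\<bar> powr p) powr (1 / p) = \<bar>u\<bar>" for u :: real using p by (simp add: powr_powr)
    ultimately have "(\<lambda>k. \<bar>U (k + k0) \<omega>\<bar>) \<longlonglongrightarrow> 0" by (simp only:)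
    then have "(\<lambda>k. U (k + k0) \<omega>) \<longlonglongrightarrow> 0" by (rule tendsto_rabs_zero_cancel)
    then show ?case by (rule LIMSEQ_offset)
  qed
qed

lemma filterlim_nat_ceiling_at_top:
  assumes "filterlim g at_top F"
  shows "filterlim (\<lambda>x. nat \<lceil>g x :: real\<rceil>) at_top F"
proof (subst filterlim_at_top, intro allI)
  fix n :: nat
  have "\<forall>\<^sub>F x in F. real n \<le> g x" using assms by (auto simp: filterlim_at_top)
  then show "\<forall>\<^sub>F x in F. n \<le> nat \<lceil>g x\<rceil>" by eventually_elim linarith
qed

lemma filterlim_ln_inverse_at_top:
  assumes "c > 0" "d > 0"
  shows "filterlim (\<lambda>\<epsilon>. ln (c / \<epsilon>) / d) at_top (at_right (0 :: real))"
proof -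
  have "filterlim (\<lambda>\<epsilon>. - ln \<epsilon>) at_top (at_right (0 :: real))"
    using ln_at_0 by (simp add: filterlim_uminus_at_top)
  then have "filterlim (\<lambda>\<epsilon>. ln c + (- ln \<epsilon>)) at_top (at_right (0 :: real))"
    by (rule filterlim_tendsto_add_at_top[OF tendsto_const])
  then have "filterlim (\<lambda>\<epsilon>. (1 / d) * (ln c + (- ln \<epsilon>))) at_top (at_right (0 :: real))"
    using assms by (intro filterlim_tendsto_pos_mult_at_top[OF tendsto_const]) auto
  moreover have ev: "\<forall>\<^sub>F \<epsilon> in at_right (0 :: real). (1 / d) * (ln c + (- ln \<epsilon>)) = ln (c / \<epsilon>) / d"
    using eventually_at_right_less[of "0 :: real"] by eventually_elim (use assms in \<open>simp add: ln_div\<close>)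
  ultimately show ?thesis by (simp only: filterlim_cong[OF refl refl ev])
qed

lemma filterlim_mlmc_R:
  assumes "M \<ge> 2" "\<alpha> > 0"
  shows "filterlim (mlmc_R \<alpha> M hb c1) at_top (at_right 0)"
  unfolding mlmc_R_def
  by (intro filterlim_nat_ceiling_at_top filterlim_tendsto_add_at_top[OF tendsto_const] filterlim_ln_inverse_at_top)
    (use assms in auto)

lemma filterlim_ml2r_R:
  assumes "M \<ge> 2" "\<alpha> > 0"
  shows "filterlim (ml2r_R \<alpha> M hb ci) at_top (at_right 0)"
proof -
  have "filterlim (\<lambda>\<epsilon>. 2 * (ln (sqrt (1 + 4 * \<alpha>) / \<epsilon>) / (\<alpha> * ln (real M)))) at_top (at_right 0)"
    by (intro filterlim_tendsto_pos_mult_at_top[OF tendsto_const] filterlim_ln_inverse_at_top)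
      (use assms in auto)
  then have "filterlim (\<lambda>\<epsilon>. 2 * ln (sqrt (1 + 4 * \<alpha>) / \<epsilon>) / (\<alpha> * ln (real M))) at_top (at_right 0)"
    by simp
  then show ?thesis unfolding ml2r_R_def
    by (intro filterlim_nat_ceiling_at_top filterlim_tendsto_add_at_top[OF tendsto_const]
      filterlim_compose[OF sqrt_at_top])
qed

lemma in_levels_divide_ceiling:
  assumes "K\<^sub>0 \<ge> 1" "x > 0"
  shows "1 / real K\<^sub>0 / real (nat \<lceil>x\<rceil>) \<in> levels K\<^sub>0"
proof -
  have "nat \<lceil>x\<rceil> \<ge> 1" using assms(2) by (simp add: Suc_le_eq)
  moreover have "1 / real K\<^sub>0 / real (nat \<lceil>x\<rceil>) = 1 / real (K\<^sub>0 * nat \<lceil>x\<rceil>)" by simp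
  ultimately show ?thesis unfolding levels_def by blast
qed

lemma mlmc_h_in_levels:
  assumes "K\<^sub>0 \<ge> 1" "M \<ge> 2" "\<alpha> > 0" "\<epsilon> > 0" "c1 \<noteq> 0"
  shows "mlmc_h \<alpha> M (1 / real K\<^sub>0) c1 \<epsilon> \<in> levels K\<^sub>0"
  unfolding mlmc_h_def Let_def using assms by (intro in_levels_divide_ceiling mult_pos_pos) auto

lemma ml2r_h_in_levels:
  assumes "K\<^sub>0 \<ge> 1" "M \<ge> 2" "\<alpha> > 0" "\<epsilon> > 0" "ci > 0"
  shows "ml2r_h \<alpha> M (1 / real K\<^sub>0) ci \<epsilon> \<in> levels K\<^sub>0"
proof -
  have "1 + 2 * \<alpha> * real (ml2r_R \<alpha> M (1 / real K\<^sub>0) ci \<epsilon>) > 0"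
    using assms(3) by (intro add_pos_nonneg) auto
  then show ?thesis unfolding ml2r_h_def Let_def using assms
    by (intro in_levels_divide_ceiling mult_pos_pos) auto
qed

context multilevel_copies
begin

text \<open>Summation by parts: the increment between levels \<open>j - 1\<close> and \<open>j\<close> is counted once for each \<open>r \<ge> j\<close>
  with weight \<open>w r\<close>.\<close>

lemma estimator_mean_Abel:
  assumes W: "\<And>j. j \<in> {1..R} \<Longrightarrow> W j = (\<Sum>r=j..R. w r)" and w: "(\<Sum>r=1..R. w r) = 1"
  shows "estimator_mean M W h R = (\<Sum>r=1..R. w r * expectation (Z (h / real (refiner M r))))"
proof -
  define a where "a = (\<lambda>j. expectation (Z (h / real (refiner M j))))"
  have "(\<Sum>j=2..R. W j * (a j - a (j - 1))) = (\<Sum>j=2..R. \<Sum>r=j..R. w r * (a j - a (j - 1)))"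
    by (intro sum.cong refl) (simp add: W sum_distrib_right)
  also have "\<dots> = (\<Sum>r=1..R. \<Sum>j=2..r. w r * (a j - a (j - 1)))"
    unfolding sum.Sigma[OF finite_atLeastAtMost ballI[OF finite_atLeastAtMost]]
    by (rule sum.reindex_bij_witness[where i = "\<lambda>(r, j). (j, r)" and j = "\<lambda>(j, r). (r, j)"]) auto
  also have "\<dots> = (\<Sum>r=1..R. w r * (a r - a 1))"
  proof (rule sum.cong[OF refl])
    fix r assume r: "r \<in> {1..R}"
    have "(\<Sum>j=2..r. a j - a (j - 1)) = a r - a 1" if "r \<ge> 1"
      using that by (induction r rule: dec_induct) (auto simp: numeral_2_eq_2)
    then show "(\<Sum>j=2..r. w r * (a j - a (j - 1))) = w r * (a r - a 1)"
      using r by (simp flip: sum_distrib_left)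
  qed
  also have "\<dots> = (\<Sum>r=1..R. w r * a r) - a 1"
    using w by (simp add: right_diff_distrib sum_subtractf flip: sum_distrib_right)
  finally have "(\<Sum>j=2..R. W j * (a j - a (j - 1))) = (\<Sum>r=1..R. w r * a r) - a 1" .
  then show ?thesis by (simp add: estimator_mean_def a_def refiner_def)
qed

lemma abs_estimator_bias_le:
  assumes M: "M \<ge> 2" and h: "h \<in> levels K\<^sub>0"
    and W: "\<And>j. j \<in> {1..R} \<Longrightarrow> W j = (\<Sum>r=j..R. w r)" and w: "(\<Sum>r=1..R. w r) = 1"
  shows "\<bar>estimator_mean M W h R - expectation (Z 0)\<bar>
    \<le> V powr (1 / p) * (\<Sum>r=1..R. \<bar>w r\<bar> * (real M powr (- (1 / 2))) ^ (r - 1))"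
proof -
  have "estimator_mean M W h R - expectation (Z 0)
      = (\<Sum>r=1..R. w r * (expectation (Z (h / real (refiner M r))) - expectation (Z 0)))"
  proof -
    have "estimator_mean M W h R = (\<Sum>r=1..R. w r * expectation (Z (h / real (refiner M r))))"
      by (rule estimator_mean_Abel) (use W w in auto)
    then show ?thesis
      using w by (simp add: right_diff_distrib sum_subtractf flip: sum_distrib_right)
  qed
  also have "\<bar>\<dots>\<bar> \<le> (\<Sum>r=1..R. \<bar>w r\<bar> * (V powr (1 / p) * (real M powr (- (1 / 2))) ^ (r - 1)))"
  proof (rule order.trans[OF sum_abs], rule sum_mono)
    fix r assume r: "r \<in> {1..R}"
    have hb: "0 < h" "h \<le> 1" using levels_bounds[OF K\<^sub>0 h] .
    have "(h / real (refiner M r)) powr (1 / 2) \<le> (real M powr (- real (r - 1))) powr (1 / 2)"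
    proof (rule powr_mono2)
      have "real M powr (- real (r - 1)) = 1 / real (refiner M r)"
        using M by (simp add: powr_minus_divide powr_realpow refiner_def)
      then show "h / real (refiner M r) \<le> real M powr (- real (r - 1))"
        using hb by (simp add: divide_right_mono)
    qed (use hb in auto)
    also have "\<dots> = (real M powr (- (1 / 2))) ^ (r - 1)"
      using M by (simp add: powr_powr mult_ac flip: powr_realpow)
    finally have "\<bar>expectation (Z (h / real (refiner M r))) - expectation (Z 0)\<bar>
        \<le> V powr (1 / p) * (real M powr (- (1 / 2))) ^ (r - 1)"
      using abs_bias_le[OF levels_divide_refiner[OF M h, of r]] by (meson mult_left_mono order_trans powr_ge_zero)
    then show "\<bar>w r * (expectation (Z (h / real (refiner M r))) - expectation (Z 0))\<bar>
        \<le> \<bar>w r\<bar> * (V powr (1 / p) * (real M powr (- (1 / 2))) ^ (r - 1))"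
      by (simp add: abs_mult mult_left_mono)
  qed
  finally show ?thesis by (simp add: sum_distrib_left mult_ac)
qed

text \<open>The fluctuations vanish by the moment bound and summability, the bias because the depth tends to
  infinity. The formulas are used only from the index on where the depth is at least one; this is
  enough for the limit.\<close>

lemma slln_estimator:
  fixes R :: "real \<Rightarrow> nat" and w W :: "nat \<Rightarrow> nat \<Rightarrow> real"
  assumes M: "M \<ge> 2" and \<theta>: "\<theta> > 0" and v: "v > 0" and \<rho>: "\<And>\<epsilon>. \<rho> \<epsilon> \<ge> 1"
    and R: "filterlim R at_top (at_right 0)"
    and h: "\<And>\<epsilon>. \<epsilon> > 0 \<Longrightarrow> h \<epsilon> \<in> levels K\<^sub>0"
    and w: "\<And>n. n \<ge> 1 \<Longrightarrow> (\<Sum>r=1..n. w n r) = 1"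
    and w_lim: "(\<lambda>n. \<Sum>r=1..n. \<bar>w n r\<bar> * (real M powr (- (1 / 2))) ^ (r - 1)) \<longlonglongrightarrow> 0"
    and W: "\<And>n j. j \<in> {1..n} \<Longrightarrow> W n j = (\<Sum>r=j..n. w n r)"
  defines "est \<equiv> \<lambda>\<epsilon>. ml_estimator M (W (R \<epsilon>)) Zc (h \<epsilon>) (R \<epsilon>) (q_alloc M 1 \<theta> (W (R \<epsilon>)) (h \<epsilon>) (R \<epsilon>))
      (total_size M 1 (\<rho> \<epsilon>) v \<theta> (W (R \<epsilon>)) (h \<epsilon>) (R \<epsilon>) \<epsilon>)"
  shows "slln_along P p est (expectation (Z 0))"
  unfolding slln_along_def
proof (intro allI impI)
  fix \<epsilon> :: "nat \<Rightarrow> real"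
  assume pos: "\<forall>k. \<epsilon> k > 0" and summ: "summable (\<lambda>k. \<epsilon> k powr p)"
  define c where "c = 1 / v + 1 / (v * \<theta>\<^sup>2 * C_lower M 1 * C_upper M 1)"
  define B where "B = 2 * moment_const p * level_const M * c powr (p / 2)"
  have c: "c \<ge> 0"
    using v \<theta> by (auto simp: c_def C_lower_def C_upper_def intro!: add_nonneg_nonneg divide_nonneg_nonneg mult_nonneg_nonneg)
  have B: "B \<ge> 0" using moment_const(1)[OF p] level_const_nonneg by (simp add: B_def)
  define mean where "mean = (\<lambda>\<epsilon>. estimator_mean M (W (R \<epsilon>)) (h \<epsilon>) (R \<epsilon>))"
  have "(\<lambda>k. (\<epsilon> k powr p) powr (1 / p)) \<longlonglongrightarrow> 0"
    by (rule tendsto_zero_powrI[OF summable_LIMSEQ_zero[OF summ] tendsto_const]) (use p in \<open>auto intro: always_eventually\<close>)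
  moreover have "(\<epsilon> k powr p) powr (1 / p) = \<epsilon> k" for k using p pos by (simp add: powr_powr less_imp_le)
  ultimately have "\<epsilon> \<longlonglongrightarrow> 0" by (simp only:)
  then have "filterlim \<epsilon> (at_right 0) sequentially"
    using pos by (intro tendsto_imp_filterlim_at_right) auto
  then have R_lim: "filterlim (\<lambda>k. R (\<epsilon> k)) at_top sequentially"
    by (rule filterlim_compose[OF R])
  then have R_ev: "\<forall>\<^sub>F k in sequentially. R (\<epsilon> k) \<ge> 1" by (auto simp: filterlim_at_top)
  have fluct: "AE \<omega> in P. (\<lambda>k. est (\<epsilon> k) \<omega> - mean (\<epsilon> k)) \<longlonglongrightarrow> 0"
  proof (rule AE_tendsto_0_if_summable_moments[where p = p and e = "\<lambda>k. B * \<epsilon> k powr p"])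
    show "summable (\<lambda>k. B * \<epsilon> k powr p)" using summ by (rule summable_mult)
    show "\<forall>\<^sub>F k in sequentially. (\<lambda>\<omega>. est (\<epsilon> k) \<omega> - mean (\<epsilon> k)) \<in> borel_measurable P \<and>
        Lp_norm_pow P p (\<lambda>\<omega>. est (\<epsilon> k) \<omega> - mean (\<epsilon> k)) \<le> ennreal (B * \<epsilon> k powr p)"
      using R_ev
    proof eventually_elim
      case (elim k)
      have \<epsilon>k: "\<epsilon> k > 0" and hk: "h (\<epsilon> k) \<in> levels K\<^sub>0" using pos h by auto
      note alloc = allocation_variance_bound[OF M \<theta> v \<rho>[of "\<epsilon> k"] \<epsilon>k levels_bounds(1)[OF K\<^sub>0 hk] elim, where W = "W (R (\<epsilon> k))"]
      note bound = ml_estimator_moment_bound[OF M hk elim alloc(1) alloc(2) alloc(3), folded c_def]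
      have "(c * (\<epsilon> k)\<^sup>2) powr (p / 2) = c powr (p / 2) * \<epsilon> k powr p"
      proof -
        have "(\<epsilon> k)\<^sup>2 = \<epsilon> k powr 2" using \<epsilon>k by simp
        then have "((\<epsilon> k)\<^sup>2) powr (p / 2) = \<epsilon> k powr p" by (simp only: powr_powr) simp
        then show ?thesis using c by (simp add: powr_mult)
      qed
      then show ?case using bound unfolding est_def mean_def B_def by (simp add: mult.assoc)
    qed
  qed (use p B in auto)
  have bias: "(\<lambda>k. mean (\<epsilon> k)) \<longlonglongrightarrow> expectation (Z 0)"
  proof -
    let ?b = "\<lambda>n. V powr (1 / p) * (\<Sum>r=1..n. \<bar>w n r\<bar> * (real M powr (- (1 / 2))) ^ (r - 1))"
    have "?b \<longlonglongrightarrow> V powr (1 / p) * 0" by (intro tendsto_mult_left w_lim)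
    then have "(\<lambda>k. ?b (R (\<epsilon> k))) \<longlonglongrightarrow> 0"
      using filterlim_compose[OF _ R_lim, of ?b] by simp
    moreover have "\<forall>\<^sub>F k in sequentially. norm (mean (\<epsilon> k) - expectation (Z 0)) \<le> ?b (R (\<epsilon> k))"
      using R_ev
    proof eventually_elim
      case (elim k)
      have "h (\<epsilon> k) \<in> levels K\<^sub>0" using pos h by auto
      from abs_estimator_bias_le[OF M this W w[OF elim]]
      show ?case by (simp add: mean_def)
    qed
    ultimately have "(\<lambda>k. mean (\<epsilon> k) - expectation (Z 0)) \<longlonglongrightarrow> 0"
      by (rule Lim_null_comparison[rotated])
    then show ?thesis by (simp add: LIM_zero_iff)
  qed
  show "AE \<omega> in P. (\<lambda>k. est (\<epsilon> k) \<omega>) \<longlonglongrightarrow> expectation (Z 0)"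
    using fluct
  proof eventually_elim
    case (elim \<omega>)
    from tendsto_add[OF elim bias] show ?case by simp
  qed
qed

text \<open>All level weights equal one, which corresponds to \<open>w\<close> being concentrated at the finest level, so
  that the mean telescopes.\<close>

lemma slln_mlmc:
  assumes M: "M \<ge> 2" and \<alpha>: "\<alpha> > 0" and v: "v > 0" and V\<^sub>1: "V\<^sub>1 > 0" and c1: "c1 \<noteq> 0"
  shows "slln_along P p (mlmc_estimator \<alpha> 1 M (1 / real K\<^sub>0) c1 V\<^sub>1 v Zc) (expectation (Z 0))"
proof -
  define w :: "nat \<Rightarrow> nat \<Rightarrow> real" where "w = (\<lambda>n r. if r = n then 1 else 0)"
  define z where "z = real M powr (- (1 / 2))"
  have z: "0 \<le> z" "z < 1" using powr_neg_less_1[OF M, of "1/2"] by (auto simp: z_def)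
  have sum_w: "(\<Sum>r=1..n. \<bar>w n r\<bar> * z ^ (r - 1)) = (if n = 0 then 0 else z ^ (n - 1))" for n
  proof -
    have "(\<Sum>r=1..n. \<bar>w n r\<bar> * z ^ (r - 1)) = (\<Sum>r=1..n. if r = n then z ^ (n - 1) else 0)"
      by (intro sum.cong) (auto simp: w_def)
    then show ?thesis by simp
  qed
  have lim: "(\<lambda>n. \<Sum>r=1..n. \<bar>w n r\<bar> * z ^ (r - 1)) \<longlonglongrightarrow> 0"
  proof (rule LIMSEQ_offset[where k = 1])
    show "(\<lambda>n. \<Sum>r=1..n + 1. \<bar>w (n + 1) r\<bar> * z ^ (r - 1)) \<longlonglongrightarrow> 0"
      unfolding sum_w using LIMSEQ_realpow_zero[OF z] by simp
  qed
  show ?thesis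
    unfolding mlmc_estimator_def[abs_def] Let_def
    by (rule slln_estimator[OF M _ v _ filterlim_mlmc_R[OF M \<alpha>] mlmc_h_in_levels[OF K\<^sub>0 M \<alpha> _ c1] _ lim[unfolded z_def],
        where W = "\<lambda>_ _. 1"])
      (use v V\<^sub>1 \<alpha> in \<open>auto simp: w_def\<close>)
qed

lemma slln_ml2r:
  assumes M: "M \<ge> 2" and \<alpha>: "\<alpha> > 0" and v: "v > 0" and V\<^sub>1: "V\<^sub>1 > 0" and ci: "ci > 0"
  shows "slln_along P p (ml2r_estimator \<alpha> 1 M (1 / real K\<^sub>0) ci V\<^sub>1 v Zc) (expectation (Z 0))"
proof -
  define z where "z = real M powr (- (1 / 2))"
  have z: "0 \<le> z" "z < 1" using powr_neg_less_1[OF M, of "1/2"] by (auto simp: z_def)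
  note lim = ml2r_weighted_sum_tendsto_0[OF M \<alpha> z, unfolded z_def]
  show ?thesis
    unfolding ml2r_estimator_def[abs_def] Let_def
    by (rule slln_estimator[OF M _ v _ filterlim_ml2r_R[OF M \<alpha>] ml2r_h_in_levels[OF K\<^sub>0 M \<alpha> _ ci] sum_ml2r_w[OF M \<alpha>] lim,
        where W = "ml2r_W \<alpha> M"])
      (use v V\<^sub>1 \<alpha> in \<open>auto simp: ml2r_W_def\<close>)
qed

end


section \<open>The strong law for nested Monte Carlo\<close>

theorem proposition6p3:
  fixes P :: "'a measure"
    and f :: "real \<Rightarrow> real"
    and F :: "(real ^ 'd) \<times> (real ^ 'e) \<Rightarrow> real"
    and X :: "'a \<Rightarrow> real"
    and Y :: "'a \<Rightarrow> real ^ 'e"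
    and \<xi> :: "'a \<Rightarrow> real ^ 'd"
    and \<xi>s :: "nat \<Rightarrow> 'a \<Rightarrow> real ^ 'd"
    and K\<^sub>0 :: nat
    and p :: real
  defines "H \<equiv> levels K\<^sub>0"
    and "Z \<equiv> nested P f F X Y \<xi>s"
  assumes "prob_space P"
    and "in_Lp P 2 X"
    and "Y \<in> borel_measurable P"
    and "\<xi> \<in> borel_measurable P"
    and "F \<in> borel_measurable borel"
    and "AE \<omega> in P. X \<omega> = F (\<xi> \<omega>, Y \<omega>)"
    and "indep_rv P borel \<xi> borel Y"
    and "inner_samples P \<xi> Y \<xi>s"
    and "K\<^sub>0 \<ge> 1"
    and "\<exists>L. L-lipschitz_on UNIV f"
    and "p \<ge> 2"
    and "in_Lp P p X"
  shows "(\<exists>V\<ge>0. \<forall>h\<in>H. \<forall>h'\<in>H.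
            Lp_norm_pow P p (\<lambda>\<omega>. Z h' \<omega> - Z h \<omega>) \<le> ennreal (V * \<bar>h' - h\<bar> powr (p / 2)))
       \<and> (\<exists>V\<ge>0. strong_error P H Z 1 V)
       \<and> (\<exists>V\<ge>0. Lp_strong_error P H Z p 1 V)
       \<and> (\<forall>(M::nat) (\<alpha>::real) (c :: nat \<Rightarrow> real) (V\<^sub>1::real) (Zc :: nat \<Rightarrow> nat \<Rightarrow> real \<Rightarrow> 'a \<Rightarrow> real).
            M \<ge> 2 \<longrightarrow> \<alpha> > 0 \<longrightarrow> 2 * \<alpha> \<ge> 1 \<longrightarrow>
            prob_space.variance P (Z 0) > 0 \<longrightarrow>
            V\<^sub>1 > 0 \<longrightarrow> strong_error P H Z 1 V\<^sub>1 \<longrightarrow>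
            (\<forall>R\<ge>1. weak_error P H Z \<alpha> c R) \<longrightarrow>
            independent_copies P (H \<union> {0}) Z Zc \<longrightarrow>
              (c 1 \<noteq> 0 \<longrightarrow>
                 slln_along P p
                   (mlmc_estimator \<alpha> 1 M (1 / real K\<^sub>0) (c 1) V\<^sub>1 (prob_space.variance P (Z 0)) Zc)
                   (prob_space.expectation P (Z 0)))
            \<and> (\<forall>ci>0. (\<lambda>R. \<bar>c R\<bar> powr (1 / real R)) \<longlonglongrightarrow> ci \<longrightarrow>
                 slln_along P p
                   (ml2r_estimator \<alpha> 1 M (1 / real K\<^sub>0) ci V\<^sub>1 (prob_space.variance P (Z 0)) Zc)
                   (prob_space.expectation P (Z 0))))"
proof -
  obtain L where L: "L-lipschitz_on UNIV f"
    using \<open>\<exists>L. L-lipschitz_on UNIV f\<close> by blast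
  have X_integrable: "integrable P X"
    by (rule prob_space.in_Lp_imp_integrable[OF \<open>prob_space P\<close> _ \<open>in_Lp P 2 X\<close>]) simp
  interpret prob_space P by fact
  interpret N: nested_setting P f F X Y \<xi> \<xi>s L
    by unfold_locales (use assms L X_integrable in auto)
  have increment: "Lp_norm_pow P p (\<lambda>\<omega>. Z h' \<omega> - Z h \<omega>) \<le> ennreal (N.increment_const p * \<bar>h' - h\<bar> powr (p / 2))"
    if "h \<in> H" "h' \<in> H" for h h'
    using N.nested_increment_bound[OF \<open>p \<ge> 2\<close> \<open>in_Lp P p X\<close> \<open>K\<^sub>0 \<ge> 1\<close>] that by (simp add: H_def Z_def)
  have strong: "Lp_norm_pow P r (\<lambda>\<omega>. Z h \<omega> - Z 0 \<omega>) \<le> ennreal (N.increment_const r * h powr (r / 2))"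
    if "h \<in> H" "r \<ge> 2" "in_Lp P r X" for h r
    using N.nested_strong_error_levels[OF that(2,3) \<open>K\<^sub>0 \<ge> 1\<close>] that(1) by (simp add: H_def Z_def)
  \<comment> \<open>The quadratic strong error is the case \<open>p = 2\<close> of the bound in \<open>L\<^sup>p\<close>.\<close>
  have "strong_error P H Z 1 (N.increment_const 2)"
    unfolding strong_error_def
    using strong[OF _ order.refl \<open>in_Lp P 2 X\<close>] by (simp add: Lp_norm_pow_def)
  moreover have "Lp_strong_error P H Z p 1 (N.increment_const p)"
    unfolding Lp_strong_error_def using strong[OF _ \<open>p \<ge> 2\<close> \<open>in_Lp P p X\<close>] by simp
  moreover have "(c 1 \<noteq> 0 \<longrightarrow> slln_along P p (mlmc_estimator \<alpha> 1 M (1 / real K\<^sub>0) (c 1) V\<^sub>1 (variance (Z 0)) Zc) (expectation (Z 0)))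
      \<and> (\<forall>ci>0. slln_along P p (ml2r_estimator \<alpha> 1 M (1 / real K\<^sub>0) ci V\<^sub>1 (variance (Z 0)) Zc) (expectation (Z 0)))"
    if M: "M \<ge> 2" and \<alpha>: "\<alpha> > 0" and v: "variance (Z 0) > 0" and V\<^sub>1: "V\<^sub>1 > 0"
      and copies: "independent_copies P (H \<union> {0}) Z Zc"
    for M :: nat and \<alpha> V\<^sub>1 :: real and c :: "nat \<Rightarrow> real" and Zc
  proof -
    interpret C: multilevel_copies P K\<^sub>0 Z Zc p "N.increment_const p"
    proof unfold_locales
      show "K\<^sub>0 \<ge> 1" "p \<ge> 2" by fact+
      show "N.increment_const p \<ge> 0" by (rule N.increment_const_nonneg) fact
      show "Z h \<in> borel_measurable P" if "h \<in> levels K\<^sub>0 \<union> {0}" for h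
        unfolding Z_def by (rule N.Z_measurable) fact+
      show "in_Lp P p (Z 0)" unfolding Z_def by (rule N.Z_zero_in_Lp) fact+
      show "Lp_norm_pow P p (\<lambda>\<omega>. Z h' \<omega> - Z h \<omega>) \<le> ennreal (N.increment_const p * \<bar>h' - h\<bar> powr (p / 2))"
        if "h \<in> levels K\<^sub>0" "h' \<in> levels K\<^sub>0" for h h'
        using increment that by (simp add: H_def)
      show "Lp_norm_pow P p (\<lambda>\<omega>. Z h \<omega> - Z 0 \<omega>) \<le> ennreal (N.increment_const p * h powr (p / 2))"
        if "h \<in> levels K\<^sub>0" for h
        using strong[of h p] that \<open>p \<ge> 2\<close> \<open>in_Lp P p X\<close> by (simp add: H_def)
      show "independent_copies P (levels K\<^sub>0 \<union> {0}) Z Zc" using copies by (simp add: H_def)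
    qed
    show ?thesis using C.slln_mlmc[OF M \<alpha> v V\<^sub>1] C.slln_ml2r[OF M \<alpha> v V\<^sub>1] by blast
  qed
  ultimately show ?thesis
    using increment N.increment_const_nonneg[OF \<open>p \<ge> 2\<close>] N.increment_const_nonneg[OF order.refl]
    by blast
qed

end
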